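(* Let $m\ge2$ be a fixed integer, and let $r\in(0,1)$ and $\rho\in(0,1]$ be fixed. For each prime $p$ let $G$ be the set of roots of $g(X)=X^{p^m}+X^p+X$ (an additive group), let $H=\mathbb{F}_{p^m}^\times$, let $n=|\langle G,H\rangle|$, let $D=D(p)\le n$ be an integer such that $\lim_{p\to\infty}D/n=\rho$, and let $\mathcal{C}=\mathcal{C}(G,H;r,D)$ be the associated evaluation code of length $n$ (all defined in the context). Then, as $p\to\infty$, the codes $\mathcal{C}$ form a family of expander codes (in the sense of the context) such that: 1. The left and right local codes have lengths $|G|=p^m$ and $|H|=p^m-1$ respectively, both of which are $\Theta(n^{\frac{1}{m+1}})$; the local codes have rate at most $r+o(1)$ and relative minimum distance at least $1-r-o(1)$. 2. The relative minimum distance $\delta$ of $\mathcal{C}$ satisfies asymptotically $\delta\ge\max(1-\rho,(1-r)^2)$, i.e. $\liminf_{p\to\infty}\delta\ge\max(1-\rho,(1-r)^2)$. 3. The rate $R=\dim_{\mathbb{F}}(\mathcal{C})/n$ satisfies asymptotically, with $C=2m$, $$R\ \ge\ \frac{1}{(C+1)!}\left(r^{C+1}-\max(0,r-\rho)^{C+1}\right),$$ i.e. $\liminf_{p\to\infty}R$ is at least the right-hand side. Here $o(1)$ denotes quantities tending to $0$ as $p\to\infty$ with $m,r,\rho$ fixed.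
   Context: Groups and field. $m\ge2$ is fixed, $p$ is a prime. $g(X)=X^{p^m}+X^p+X$; $G$ is its set of roots in its splitting field over $\mathbb{F}_p$, an additive group of order $p^m$. $H=\mathbb{F}_{p^m}^\times$. Let $\mathbb{F}$ be a finite extension field of $\mathbb{F}_p$ containing $G$ and $H$. Identify $G$ with the translation group $\{x\mapsto x+a: a\in G\}$ and $H$ with the scaling group $\{x\mapsto hx: h\in H\}$, both subgroups of $\mathrm{AGL}(1,\mathbb{F})=\{x\mapsto ax+b: a\in\mathbb{F}^\times, b\in\mathbb{F}\}$, and let $A=\langle G,H\rangle$ be the subgroup they generate; $\mathbb{F}$ is assumed large enough that $|\mathbb{F}|\ge|A|$. Put $h(X)=X^{|H|}$. Evaluation set. Since $|\mathbb{F}|\ge|A|$, there is $\alpha\in\mathbb{F}$ with trivial stabilizer in $A$; fix such an $\alpha$ and let $\Omega=\{\phi(\alpha):\phi\in A\}$, so $n:=|\Omega|=|A|$. Base-$u$ degree. For a nonconstant $u\in\mathbb{F}[X]$, every $f\in\mathbb{F}[X]$ has a unique expansion $f=\sum_i c_i u^i$ with $\deg c_i<\deg u$; $\deg_u(f):=\max_i\deg(c_i)$, with $\deg(0)=-\infty$. Code. For an integer $D\le n$, $\mathcal{W}_{r,D}=\{f\in\mathbb{F}[X]:\deg f<D,\ \deg_g(f)<r|G|,\ \deg_h(f)<r|H|\}$ and $\mathcal{C}(G,H;r,D)=\{(f(\beta))_{\beta\in\Omega}: f\in\mathcal{W}_{r,D}\}\subseteq\mathbb{F}^{\Omega}$.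 Graph and expander codes. The bipartite coset graph $\mathsf{B}(G,H)$ has left vertices the right cosets $G\phi$, right vertices the right cosets $H\phi$ ($\phi\in A$), and one edge for each $\phi\in A$, joining $G\phi$ to $H\phi$. Identifying $\phi\in A$ with $\phi(\alpha)\in\Omega$, edges are the code coordinates, left vertices are the $G$-orbits in $\Omega$ and right vertices are the $H$-orbits in $\Omega$. The left (resp. right) local code at an orbit $O$ is the Reed--Solomon code of evaluations on $O$ of polynomials of degree $<r|G|$ (resp. $<r|H|$). The Tanner code is the set of all $c\in\mathbb{F}^\Omega$ whose restriction to every $G$-orbit and every $H$-orbit in $\Omega$ lies in the corresponding local code. For general $D\le n$, "family of expander codes" means: $\mathcal{C}$ is a subcode of this Tanner code, and the second largest singular value of the normalized bi-adjacency matrix $\frac{1}{\sqrt{|G||H|}}\big(|G\phi\cap H\psi|\big)_{G\phi,H\psi}$ tends to $0$ as $p\to\infty$. The relative minimum distance is the minimum distance divided by the length. *)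

theory Defs
  imports
    "HOL-Algebra.Polynomial_Divisibility"
    "HOL-Algebra.Group_Action"
    "HOL-Algebra.Bij"
    "HOL-Computational_Algebra.Primes"
    "HOL-Library.Landau_Symbols"
    "HOL-Library.Extended_Real"
    "Jordan_Normal_Form.Char_Poly"
    "Jordan_Normal_Form.Missing_VectorSpace"
begin

section \<open>Asymptotics along the primes\<close>

definition primes_at_top :: "nat filter" where
  "primes_at_top = inf at_top (principal {p. prime p})"

section \<open>Degrees of univariate polynomials\<close>

text \<open>Polynomials over a ring \<open>F\<close> are the elements of \<open>poly_ring F\<close>, i.e. coefficient lists with
  the leading coefficient first; the zero polynomial is the empty list. Since the library degree of
  the zero polynomial is \<open>0\<close>, we use an extended-real-valued degree with \<open>deg 0 = -\<infinity>\<close>.\<close>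

definition pdeg :: "'a list \<Rightarrow> ereal" where
  "pdeg f = (if f = [] then -\<infinity> else ereal (real (Polynomials.degree f)))"

definition base_expansion ::
    "('a, 'b) ring_scheme \<Rightarrow> 'a list \<Rightarrow> 'a list \<Rightarrow> (nat \<Rightarrow> 'a list) \<Rightarrow> bool" where
  "base_expansion F u f c \<longleftrightarrow>
     (\<forall>i. c i \<in> carrier (poly_ring F) \<and> pdeg (c i) < pdeg u) \<and>
     finite {i. c i \<noteq> []} \<and>
     f = (\<Oplus>\<^bsub>poly_ring F\<^esub> i \<in> {i. c i \<noteq> []}.
            c i \<otimes>\<^bsub>poly_ring F\<^esub> (u [^]\<^bsub>poly_ring F\<^esub> i))"

text \<open>The description operator is meaningful for nonconstant \<open>u\<close> over a field, where the
  base-\<open>u\<close> expansion exists and is unique. All but finitely many coefficients vanish, so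
  the maximum is over a finite set.\<close>

definition base_deg :: "('a, 'b) ring_scheme \<Rightarrow> 'a list \<Rightarrow> 'a list \<Rightarrow> ereal" where
  "base_deg F u f = Max (range (\<lambda>i. pdeg ((THE c. base_expansion F u f c) i)))"

section \<open>The groups\<close>

definition g_poly :: "('a, 'b) ring_scheme \<Rightarrow> nat \<Rightarrow> nat \<Rightarrow> 'a list" where
  "g_poly F m p =
     (X\<^bsub>F\<^esub> [^]\<^bsub>poly_ring F\<^esub> (p ^ m)) \<oplus>\<^bsub>poly_ring F\<^esub>
     (X\<^bsub>F\<^esub> [^]\<^bsub>poly_ring F\<^esub> p) \<oplus>\<^bsub>poly_ring F\<^esub> X\<^bsub>F\<^esub>"

definition G_set :: "('a, 'b) ring_scheme \<Rightarrow> nat \<Rightarrow> nat \<Rightarrow> 'a set" where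
  "G_set F m p = {a \<in> carrier F. ring.eval F (g_poly F m p) a = \<zero>\<^bsub>F\<^esub>}"

text \<open>Throughout, \<open>K\<close> is the subfield with \<open>p ^ m\<close> elements of \<open>F\<close>.\<close>

definition H_set :: "('a, 'b) ring_scheme \<Rightarrow> 'a set \<Rightarrow> 'a set" where
  "H_set F K = K - {\<zero>\<^bsub>F\<^esub>}"

definition h_poly :: "('a, 'b) ring_scheme \<Rightarrow> 'a set \<Rightarrow> 'a list" where
  "h_poly F K = X\<^bsub>F\<^esub> [^]\<^bsub>poly_ring F\<^esub> card (H_set F K)"

definition AGL1 :: "('a, 'b) ring_scheme \<Rightarrow> ('a \<Rightarrow> 'a) monoid" where
  "AGL1 F = (BijGroup (carrier F))
     \<lparr>carrier := {(\<lambda>x\<in>carrier F. a \<otimes>\<^bsub>F\<^esub> x \<oplus>\<^bsub>F\<^esub> b) | a b.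
                    a \<in> carrier F - {\<zero>\<^bsub>F\<^esub>} \<and> b \<in> carrier F}\<rparr>"

definition translation_maps :: "('a, 'b) ring_scheme \<Rightarrow> nat \<Rightarrow> nat \<Rightarrow> ('a \<Rightarrow> 'a) set" where
  "translation_maps F m p = (\<lambda>a. \<lambda>x\<in>carrier F. x \<oplus>\<^bsub>F\<^esub> a) ` G_set F m p"

definition scaling_maps :: "('a, 'b) ring_scheme \<Rightarrow> 'a set \<Rightarrow> ('a \<Rightarrow> 'a) set" where
  "scaling_maps F K = (\<lambda>h. \<lambda>x\<in>carrier F. h \<otimes>\<^bsub>F\<^esub> x) ` H_set F K"

definition A_group :: "('a, 'b) ring_scheme \<Rightarrow> nat \<Rightarrow> nat \<Rightarrow> 'a set \<Rightarrow> ('a \<Rightarrow> 'a) monoid" where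
  "A_group F m p K =
     (AGL1 F)\<lparr>carrier := generate (AGL1 F) (translation_maps F m p \<union> scaling_maps F K)\<rparr>"

definition code_length :: "('a, 'b) ring_scheme \<Rightarrow> nat \<Rightarrow> nat \<Rightarrow> 'a set \<Rightarrow> nat" where
  "code_length F m p K = card (carrier (A_group F m p K))"

section \<open>Evaluation set and orbits\<close>

definition Omega :: "('a, 'b) ring_scheme \<Rightarrow> nat \<Rightarrow> nat \<Rightarrow> 'a set \<Rightarrow> 'a \<Rightarrow> 'a set" where
  "Omega F m p K \<alpha> = orbit (A_group F m p K) (\<lambda>\<phi>. \<phi>) \<alpha>"

definition left_orbits :: "('a, 'b) ring_scheme \<Rightarrow> nat \<Rightarrow> nat \<Rightarrow> 'a set \<Rightarrow> 'a \<Rightarrow> 'a set set" where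
  "left_orbits F m p K \<alpha> =
     orbits ((AGL1 F)\<lparr>carrier := translation_maps F m p\<rparr>) (Omega F m p K \<alpha>) (\<lambda>\<phi>. \<phi>)"

definition right_orbits :: "('a, 'b) ring_scheme \<Rightarrow> nat \<Rightarrow> nat \<Rightarrow> 'a set \<Rightarrow> 'a \<Rightarrow> 'a set set" where
  "right_orbits F m p K \<alpha> =
     orbits ((AGL1 F)\<lparr>carrier := scaling_maps F K\<rparr>) (Omega F m p K \<alpha>) (\<lambda>\<phi>. \<phi>)"

section \<open>Codes\<close>

text \<open>A code with coordinate set \<open>S\<close> over \<open>F\<close> is a set of functions in
  \<open>S \<rightarrow>\<^sub>E carrier F\<close>; its length is \<open>card S\<close>.\<close>

definition codeword :: "('a, 'b) ring_scheme \<Rightarrow> 'a set \<Rightarrow> 'a list \<Rightarrow> 'a \<Rightarrow> 'a" where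
  "codeword F S f = (\<lambda>\<beta>\<in>S. ring.eval F f \<beta>)"

definition code_dim :: "('a, 'b) ring_scheme \<Rightarrow> 's set \<Rightarrow> ('s \<Rightarrow> 'a) set \<Rightarrow> nat" where
  "code_dim F S C = vectorspace.dim F ((ring.func_space F S)\<lparr>carrier := C\<rparr>)"

definition code_rate :: "('a, 'b) ring_scheme \<Rightarrow> 's set \<Rightarrow> ('s \<Rightarrow> 'a) set \<Rightarrow> real" where
  "code_rate F S C = real (code_dim F S C) / real (card S)"

definition hamming_dist :: "'s set \<Rightarrow> ('s \<Rightarrow> 'a) \<Rightarrow> ('s \<Rightarrow> 'a) \<Rightarrow> nat" where
  "hamming_dist S x y = card {s \<in> S. x s \<noteq> y s}"

text \<open>By the convention \<open>Inf {} = 0\<close> on \<open>nat\<close>, a code with at most one codeword gets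
  minimum distance \<open>0\<close>.\<close>

definition min_dist :: "'s set \<Rightarrow> ('s \<Rightarrow> 'a) set \<Rightarrow> nat" where
  "min_dist S C = Inf {hamming_dist S x y | x y. x \<in> C \<and> y \<in> C \<and> x \<noteq> y}"

definition rel_min_dist :: "'s set \<Rightarrow> ('s \<Rightarrow> 'a) set \<Rightarrow> real" where
  "rel_min_dist S C = real (min_dist S C) / real (card S)"

definition W_space ::
    "('a, 'b) ring_scheme \<Rightarrow> nat \<Rightarrow> nat \<Rightarrow> 'a set \<Rightarrow> real \<Rightarrow> int \<Rightarrow> 'a list set" where
  "W_space F m p K r D =
     {f \<in> carrier (poly_ring F).
        pdeg f < ereal (real_of_int D) \<and>
        base_deg F (g_poly F m p) f < ereal (r * real (card (G_set F m p))) \<and>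
        base_deg F (h_poly F K) f < ereal (r * real (card (H_set F K)))}"

definition eval_code ::
    "('a, 'b) ring_scheme \<Rightarrow> nat \<Rightarrow> nat \<Rightarrow> 'a set \<Rightarrow> 'a \<Rightarrow> real \<Rightarrow> int \<Rightarrow> ('a \<Rightarrow> 'a) set" where
  "eval_code F m p K \<alpha> r D = codeword F (Omega F m p K \<alpha>) ` W_space F m p K r D"

text \<open>Reed--Solomon code on \<open>S\<close>: evaluations of the polynomials of degree \<open>< k\<close>, for a real
  bound \<open>k\<close>.\<close>

definition rs_code :: "('a, 'b) ring_scheme \<Rightarrow> 'a set \<Rightarrow> real \<Rightarrow> ('a \<Rightarrow> 'a) set" where
  "rs_code F S k = codeword F S ` {f \<in> carrier (poly_ring F). pdeg f < ereal k}"

definition left_code :: "('a, 'b) ring_scheme \<Rightarrow> nat \<Rightarrow> nat \<Rightarrow> real \<Rightarrow> 'a set \<Rightarrow> ('a \<Rightarrow> 'a) set" where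
  "left_code F m p r S = rs_code F S (r * real (card (G_set F m p)))"

definition right_code :: "('a, 'b) ring_scheme \<Rightarrow> 'a set \<Rightarrow> real \<Rightarrow> 'a set \<Rightarrow> ('a \<Rightarrow> 'a) set" where
  "right_code F K r S = rs_code F S (r * real (card (H_set F K)))"

definition tanner_code ::
    "('a, 'b) ring_scheme \<Rightarrow> nat \<Rightarrow> nat \<Rightarrow> 'a set \<Rightarrow> 'a \<Rightarrow> real \<Rightarrow> ('a \<Rightarrow> 'a) set" where
  "tanner_code F m p K \<alpha> r =
     {c \<in> Omega F m p K \<alpha> \<rightarrow>\<^sub>E carrier F.
        (\<forall>S \<in> left_orbits F m p K \<alpha>. restrict c S \<in> left_code F m p r S) \<and>
        (\<forall>S \<in> right_orbits F m p K \<alpha>. restrict c S \<in> right_code F K r S)}"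

section \<open>The coset graph and its singular values\<close>

definition enum_set :: "'c set \<Rightarrow> 'c list" where
  "enum_set S = (SOME xs. set xs = S \<and> distinct xs)"

text \<open>Rows and columns are indexed by right cosets in an arbitrary order, which does not affect
  the singular values. The carrier of \<open>A\<close> consists of maps and the product is composition, so
  \<open>S #>\<^bsub>A\<^esub> \<phi> = {s \<circ> \<phi> | s \<in> S}\<close>.\<close>

definition norm_biadj :: "('c, 'd) monoid_scheme \<Rightarrow> 'c set \<Rightarrow> 'c set \<Rightarrow> real mat" where
  "norm_biadj A S T =
     (let L = enum_set (rcosets\<^bsub>A\<^esub> S); R = enum_set (rcosets\<^bsub>A\<^esub> T)
      in mat (length L) (length R)
           (\<lambda>(i, j). real (card (L ! i \<inter> R ! j)) / sqrt (real (card S) * real (card T))))"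

text \<open>The singular values in nonincreasing order with multiplicity: square roots of the
  eigenvalues of \<open>M * M\<^sup>T\<close>, cut off after \<open>min (dim_row M) (dim_col M)\<close> entries (any
  further eigenvalues of \<open>M * M\<^sup>T\<close> are zero).\<close>

definition singular_values :: "real mat \<Rightarrow> real list" where
  "singular_values M =
     take (min (dim_row M) (dim_col M))
       (rev (sorted_list_of_multiset
          (image_mset sqrt (proots (char_poly (M * transpose_mat M))))))"

definition second_singular_value :: "real mat \<Rightarrow> real" where
  "second_singular_value M = singular_values M ! 1"

definition expander_family ::
    "nat \<Rightarrow> real \<Rightarrow> (nat \<Rightarrow> ('a, 'b) ring_scheme) \<Rightarrow> (nat \<Rightarrow> 'a set) \<Rightarrow> (nat \<Rightarrow> 'a) \<Rightarrow>
     (nat \<Rightarrow> ('a \<Rightarrow> 'a) set) \<Rightarrow> bool" where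
  "expander_family m r F K \<alpha> C \<longleftrightarrow>
     (\<forall>p. prime p \<longrightarrow> C p \<subseteq> tanner_code (F p) m p (K p) (\<alpha> p) r) \<and>
     ((\<lambda>p. second_singular_value
             (norm_biadj (A_group (F p) m p (K p)) (translation_maps (F p) m p) (scaling_maps (F p) (K p))))
        \<longlongrightarrow> 0) primes_at_top"

end

theory Submission
  imports Defs "HOL-Analysis.Convex"
begin

text \<open>Write \<open>q = p ^ m\<close>. On \<open>G\<close> the \<open>q\<close>-th power map is \<open>- x [^] p - x\<close>, which forces a basis of \<open>G\<close> over
  the prime field to stay independent over \<open>K\<close>. Hence the \<open>K\<close>-span \<open>V\<close> of \<open>G\<close> has \<open>q ^ m\<close> elements, \<open>A\<close> is
  \<open>{x \<mapsto> h (x + v) | h \<in> H, v \<in> V}\<close> and \<open>n = (q - 1) q ^ m\<close>.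

  Right cosets of \<open>H\<close> correspond to points of \<open>V\<close>, and moving along two edges of the coset graph is
  translating by a random element of a random line \<open>K a\<close>, \<open>a \<in> G\<close>. Averaging over one line is an
  orthogonal projection; a subspace that does not contain \<open>G\<close> contains at most \<open>q / p\<close> elements of \<open>G\<close>.
  Induction on the codimension of an invariant subspace then bounds the average over all lines on
  mean-zero functions by \<open>m / p\<close>. This bounds the second singular value, and through expander mixing
  it gives the distance \<open>(1 - r)\<^sup>2\<close>.

  For the rate, the products of a power of \<open>X\<close> below \<open>q\<close> with powers \<open>g ^ j\<close>, where
  \<open>j = (\<Sum>k<m. q ^ k (b\<^sub>k + p ^ (m - 1) c\<^sub>k))\<close>, have pairwise distinct degrees and small \<open>g\<close>- and \<open>h\<close>-degrees,
  because \<open>g\<close> is additive and powers of \<open>q\<close> in the exponent of \<open>X\<close> do not affect the \<open>h\<close>-degree.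
  Counting the admissible digits is a lattice point count in a simplex of dimension \<open>2 m + 1\<close>.\<close>

section \<open>Polynomials in positive characteristic\<close>

text \<open>The constant in the rate is the volume of a simplex. Weights below about r q are allowed
  and the weights of the 2m + 1 digits multiply to q^m, so about (r q)^(2m+1) / ((2m+1)! q^m)
  polynomials remain; division by n, about q^(m+1), leaves r^(2m+1) / (2m+1)!. The bound D restricts
  only the most significant digit, to about \<rho> p of its p values at weight p^(m-1) each. This
  cuts off the part of the simplex beyond \<rho> q and produces the term with r - \<rho>. Digits
  base q are split in two because of the middle term X^p of g: raising g to the power p^j costs
  weight p^(j+1), except for j = m - 1, where that term becomes X^q and is cheap again. Two formal
  obstacles shape the rest. Singular values are entries of a sorted list of roots of a
  characteristic polynomial, so bounding a quadratic form is not enough: the root 1 of the constant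
  vector has to be split off exactly once, and the roots have to be counted. Dimensions are compared
  by counting elements over the finite field.\<close>

lemma (in cring) binomial:
  assumes x: "x \<in> carrier R" and y: "y \<in> carrier R"
  shows "(x \<oplus> y) [^] (n::nat) = (\<Oplus>k\<in>{..n}. [(n choose k)] \<cdot> (x [^] k \<otimes> y [^] (n - k)))"
proof (induction n)
  case 0
  then show ?case using x y by simp
next
  case (Suc n)
  let ?t = "\<lambda>n k. [(n choose k)] \<cdot> (x [^] k \<otimes> y [^] (n - k))"
  let ?a = "\<lambda>k. [(n choose k)] \<cdot> (x [^] Suc k \<otimes> y [^] (n - k))"
  let ?b = "\<lambda>k. [(n choose k)] \<cdot> (x [^] k \<otimes> y [^] (Suc n - k))"
  have "(x \<oplus> y) [^] Suc n = (\<Oplus>k\<in>{..n}. ?t n k) \<otimes> x \<oplus> (\<Oplus>k\<in>{..n}. ?t n k) \<otimes> y"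
    using x y by (simp add: Suc.IH r_distr)
  also have "(\<Oplus>k\<in>{..n}. ?t n k) \<otimes> x = (\<Oplus>k\<in>{..n}. ?a k)"
    using x y by (subst finsum_ldistr) (auto intro!: finsum_cong' simp: add_pow_ldistr add_pow_rdistr m_ac)
  also have "(\<Oplus>k\<in>{..n}. ?t n k) \<otimes> y = (\<Oplus>k\<in>{..n}. ?b k)"
    using x y
    by (subst finsum_ldistr) (auto intro!: finsum_cong' simp: add_pow_ldistr add_pow_rdistr m_ac Suc_diff_le)
  also have "(\<Oplus>k\<in>{..n}. ?b k) = (\<Oplus>k\<in>{..Suc n}. ?b k)"
    using x y by (subst finsum_Suc) (auto simp: binomial_eq_0)
  also have "\<dots> = (\<Oplus>k\<in>{..n}. ?b (Suc k)) \<oplus> ?b 0"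
    using x y by (subst finsum_Suc2) auto
  also have "(\<Oplus>k\<in>{..n}. ?a k) \<oplus> \<dots> = (\<Oplus>k\<in>{..n}. ?a k \<oplus> ?b (Suc k)) \<oplus> ?b 0"
    using x y by (subst finsum_addf) (auto simp: a_assoc)
  also have "(\<Oplus>k\<in>{..n}. ?a k \<oplus> ?b (Suc k)) = (\<Oplus>k\<in>{..n}. ?t (Suc n) (Suc k))"
    using x y by (intro finsum_cong') (auto simp: add.nat_pow_mult)
  also have "\<dots> \<oplus> ?b 0 = (\<Oplus>k\<in>{..Suc n}. ?t (Suc n) k)"
    using x y by (subst finsum_Suc2) auto
  finally show ?case .
qed

lemma (in cring) frobenius_add:
  fixes p :: nat
  assumes p: "prime p" and char: "[p] \<cdot> \<one> = \<zero>"
    and x: "x \<in> carrier R" and y: "y \<in> carrier R"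
  shows "(x \<oplus> y) [^] p = x [^] p \<oplus> y [^] p"
proof -
  let ?t = "\<lambda>k. [(p choose k)] \<cdot> (x [^] k \<otimes> y [^] (p - k))"
  \<comment> \<open>With \<open>p = Suc (Suc r)\<close> the two extreme binomial terms can be peeled
    off the sum; all coefficients in between are divisible by \<open>p\<close>.\<close>
  define r where "r = p - 2"
  then have r: "p = Suc (Suc r)" using prime_ge_2_nat[OF p] by simp
  have mult_0: "[(p * j)] \<cdot> z = \<zero>" if "z \<in> carrier R" for j :: nat and z
  proof -
    have "[p] \<cdot> z = ([p] \<cdot> \<one>) \<otimes> z" using that by (simp add: add_pow_ldistr)
    then have "[p] \<cdot> z = \<zero>" using char that by simp
    then show ?thesis using that by (metis add.nat_pow_one add.nat_pow_pow)
  qed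
  have mid: "?t (Suc i) = \<zero>" if "i \<le> r" for i
  proof -
    have "p dvd (p choose Suc i)"
      using p that r by (intro dvd_choose_prime) auto
    then show ?thesis using mult_0 x y by (auto elim!: dvdE)
  qed
  have "(x \<oplus> y) [^] p = (\<Oplus>k\<in>{..Suc (Suc r)}. ?t k)"
    using binomial[OF x y, of p] r by simp
  also have "\<dots> = ?t (Suc (Suc r)) \<oplus> (\<Oplus>k\<in>{..Suc r}. ?t k)"
    using x y by (intro finsum_Suc) auto
  also have "(\<Oplus>k\<in>{..Suc r}. ?t k) = (\<Oplus>k\<in>{..r}. ?t (Suc k)) \<oplus> ?t 0"
    using x y by (intro finsum_Suc2) auto
  also have "(\<Oplus>k\<in>{..r}. ?t (Suc k)) = \<zero>"
    using mid by (intro add.finprod_one_eqI) auto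
  finally show ?thesis using x y r by simp
qed

lemma (in cring) frobenius_pow_add:
  fixes p :: nat
  assumes p: "prime p" and char: "[p] \<cdot> \<one> = \<zero>"
    and x: "x \<in> carrier R" and y: "y \<in> carrier R"
  shows "(x \<oplus> y) [^] (p ^ k) = x [^] (p ^ k) \<oplus> y [^] (p ^ k)"
proof (induction k)
  case 0
  then show ?case using x y by simp
next
  case (Suc k)
  have *: "z [^] (p ^ Suc k) = (z [^] (p ^ k)) [^] p" if "z \<in> carrier R" for z
    using that by (simp add: nat_pow_pow mult.commute)
  show ?case using x y Suc.IH by (simp only: * a_closed frobenius_add[OF p char nat_pow_closed nat_pow_closed])
qed

text \<open>Frobenius additivity is needed for polynomials as well, to factor \<open>g\<close> at a
  root and to expand \<open>g [^] (p ^ k)\<close>; this transfers its hypothesis. The term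
  \<open>normalize [[k] \<cdot> \<one>]\<close> is the list form of the constant k, empty when that
  constant is zero.\<close>

lemma (in domain) poly_ring_char:
  assumes "[(n::nat)] \<cdot> \<one> = \<zero>"
  shows "[n] \<cdot>\<^bsub>poly_ring R\<^esub> \<one>\<^bsub>poly_ring R\<^esub> = \<zero>\<^bsub>poly_ring R\<^esub>"
proof -
  interpret P: domain "poly_ring R" using univ_poly_is_domain[OF carrier_is_subring] .
  have "[k] \<cdot>\<^bsub>poly_ring R\<^esub> \<one>\<^bsub>poly_ring R\<^esub> = normalize [[k] \<cdot> \<one>]" for k :: nat
  proof (induction k)
    case 0
    then show ?case by (simp add: add_pow_def univ_poly_zero)
  next
    case (Suc k)
    have "[Suc k] \<cdot>\<^bsub>poly_ring R\<^esub> \<one>\<^bsub>poly_ring R\<^esub> = poly_add (normalize [[k] \<cdot> \<one>]) [\<one>]"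
      using Suc.IH by (simp add: univ_poly_add univ_poly_one)
    also have "\<dots> = poly_add [[k] \<cdot> \<one>] [\<one>]"
      by (rule poly_add_normalize(1)[symmetric]) auto
    also have "\<dots> = normalize [[Suc k] \<cdot> \<one>]" by simp
    finally show ?case .
  qed
  from this[of n] show ?thesis using assms by (simp add: univ_poly_zero)
qed

lemma card_set_mset_le_size: "card (set_mset M) \<le> size M"
  by (induction M) (auto simp: card_insert_if le_SucI)

lemma (in field) card_roots_le_degree:
  assumes f: "f \<in> carrier (poly_ring R)" "f \<noteq> []" and S: "S \<subseteq> {x \<in> carrier R. eval f x = \<zero>}"
  shows "card S \<le> Polynomials.degree f"
proof -
  have *: "{x \<in> carrier R. eval f x = \<zero>} = set_mset (roots f)"
    using f roots_mem_iff_is_root[OF f(1)] by (auto simp: is_root_def)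
  have "card S \<le> card (set_mset (roots f))" using S * by (intro card_mono) auto
  also have "\<dots> \<le> size (roots f)"
    by (rule card_set_mset_le_size)
  also have "\<dots> \<le> Polynomials.degree f" using size_roots_le_degree[OF f(1)] .
  finally show ?thesis .
qed

lemma (in domain) var_pow_eq:
  "X [^]\<^bsub>poly_ring R\<^esub> (n::nat) = \<one> # replicate n \<zero>"
  using unitary_monom_eq_var_pow[OF carrier_is_subring, of n] by (simp add: monom_def)

text \<open>From here on degree bounds are bounds on list lengths. Length is degree plus one and the
  zero polynomial has length 0, so the value \<open>-\<infinity>\<close> of \<open>pdeg\<close>
  needs no separate case; real bounds are rounded up.\<close>

lemma pdeg_less_iff: "pdeg f < ereal x \<longleftrightarrow> length f \<le> nat \<lceil>x\<rceil>"
proof (cases "f = []")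
  case True
  then show ?thesis by (simp add: pdeg_def)
next
  case False
  then have "pdeg f < ereal x \<longleftrightarrow> real (length f - 1) < x" by (simp add: pdeg_def)
  also have "\<dots> \<longleftrightarrow> int (length f - 1) < \<lceil>x\<rceil>" by (simp add: less_ceiling_iff)
  also have "\<dots> \<longleftrightarrow> length f \<le> nat \<lceil>x\<rceil>" using False by (cases f) (auto simp: nat_le_iff Suc_le_eq zless_nat_eq_int_zless)
  finally show ?thesis .
qed

lemma (in domain) length_add_le:
  "length (f \<oplus>\<^bsub>poly_ring R\<^esub> g) \<le> max (length f) (length g)"
  using poly_add_length_le by (simp add: univ_poly_add)

lemma (in domain) length_mult:
  assumes "f \<in> carrier (poly_ring R)" "g \<in> carrier (poly_ring R)" "f \<noteq> []" "g \<noteq> []"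
  shows "length (f \<otimes>\<^bsub>poly_ring R\<^esub> g) = length f + length g - 1"
proof -
  interpret P: domain "poly_ring R" using univ_poly_is_domain[OF carrier_is_subring] .
  have "f \<otimes>\<^bsub>poly_ring R\<^esub> g \<noteq> []"
    using assms P.integral by (auto simp: univ_poly_zero)
  moreover have "Polynomials.degree (f \<otimes>\<^bsub>poly_ring R\<^esub> g) = Polynomials.degree f + Polynomials.degree g"
    using poly_mult_degree_eq[OF carrier_is_subring] assms by (auto simp: univ_poly_carrier univ_poly_mult)
  ultimately show ?thesis using assms
    by (cases f; cases g; cases "f \<otimes>\<^bsub>poly_ring R\<^esub> g") auto
qed

lemma (in domain) length_mult_le:
  assumes "f \<in> carrier (poly_ring R)" "g \<in> carrier (poly_ring R)"
    "length f \<le> Suc a" "length g \<le> Suc b"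
  shows "length (f \<otimes>\<^bsub>poly_ring R\<^esub> g) \<le> Suc (a + b)"
proof -
  interpret P: domain "poly_ring R" using univ_poly_is_domain[OF carrier_is_subring] .
  show ?thesis
  proof (cases "f = [] \<or> g = []")
    case True
    then have "f \<otimes>\<^bsub>poly_ring R\<^esub> g = []"
      using assms P.l_null P.r_null by (auto simp: univ_poly_zero)
    then show ?thesis by simp
  next
    case False
    then show ?thesis using length_mult[OF assms(1,2)] assms(3,4) by auto
  qed
qed

section \<open>Base expansions\<close>

text \<open>Polynomials with base-\<open>u\<close> digits of length at most \<open>N\<close>, in
  Horner form. In contrast to \<open>base_expansion\<close>, digits may be longer than
  \<open>u\<close>, so sums and products can be formed digitwise without carries.\<close>

inductive_set (in ring) base_filtration :: "'a list \<Rightarrow> nat \<Rightarrow> 'a list set" for u N where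
  zero: "\<zero>\<^bsub>poly_ring R\<^esub> \<in> base_filtration u N"
| step: "c \<oplus>\<^bsub>poly_ring R\<^esub> f \<otimes>\<^bsub>poly_ring R\<^esub> u \<in> base_filtration u N"
  if "c \<in> carrier (poly_ring R)" "length c \<le> N" "f \<in> base_filtration u N"

context field
begin

interpretation P: domain "poly_ring R" using univ_poly_is_domain[OF carrier_is_subring] .

lemma base_filtration_closed:
  assumes "u \<in> carrier (poly_ring R)" "f \<in> base_filtration u N"
  shows "f \<in> carrier (poly_ring R)"
  using assms(2) by induction (use assms(1) in auto)

lemma base_filtration_const:
  assumes "u \<in> carrier (poly_ring R)" "c \<in> carrier (poly_ring R)" "length c \<le> N"
  shows "c \<in> base_filtration u N"
  using base_filtration.step[OF assms(2,3) base_filtration.zero, of u] assms by simp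

lemma base_filtration_base_mult:
  assumes "u \<in> carrier (poly_ring R)" "f \<in> base_filtration u N"
  shows "f \<otimes>\<^bsub>poly_ring R\<^esub> u \<in> base_filtration u N"
proof -
  have "length \<zero>\<^bsub>poly_ring R\<^esub> \<le> N" by (simp add: univ_poly_zero)
  from base_filtration.step[OF P.zero_closed this assms(2)] show ?thesis
    using base_filtration_closed[OF assms] assms(1) by simp
qed

lemma base_filtration_add:
  assumes u: "u \<in> carrier (poly_ring R)"
    and f: "f \<in> base_filtration u N" and g: "g \<in> base_filtration u N"
  shows "f \<oplus>\<^bsub>poly_ring R\<^esub> g \<in> base_filtration u N"
  using f g
proof (induction f arbitrary: g)
  case zero
  then show ?case using base_filtration_closed[OF u zero] by simp
next
  case (step c f)
  note f = base_filtration_closed[OF u step.hyps(3)]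
  show ?case using step.prems
  proof cases
    case zero
    then show ?thesis using base_filtration.step[OF step.hyps] step.hyps f u by simp
  next
    case (step c' g')
    note g = base_filtration_closed[OF u step(4)]
    have "c \<oplus>\<^bsub>poly_ring R\<^esub> f \<otimes>\<^bsub>poly_ring R\<^esub> u \<oplus>\<^bsub>poly_ring R\<^esub> g
        = (c \<oplus>\<^bsub>poly_ring R\<^esub> c') \<oplus>\<^bsub>poly_ring R\<^esub> (f \<oplus>\<^bsub>poly_ring R\<^esub> g') \<otimes>\<^bsub>poly_ring R\<^esub> u"
      using step.hyps step f g u \<open>c \<in> carrier (poly_ring R)\<close> by (simp add: P.l_distr P.a_ac)
    moreover have "length (c \<oplus>\<^bsub>poly_ring R\<^esub> c') \<le> N"
      using length_add_le[of c c'] step \<open>length c \<le> N\<close> by simp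
    ultimately show ?thesis
      using base_filtration.step[of "c \<oplus>\<^bsub>poly_ring R\<^esub> c'" N "f \<oplus>\<^bsub>poly_ring R\<^esub> g'" u]
        step \<open>c \<in> carrier (poly_ring R)\<close> \<open>\<And>g. g \<in> base_filtration u N \<Longrightarrow> f \<oplus>\<^bsub>poly_ring R\<^esub> g \<in> base_filtration u N\<close>
      by simp
  qed
qed

lemma base_filtration_mono:
  assumes "f \<in> base_filtration u N" "N \<le> M"
  shows "f \<in> base_filtration u M"
  using assms(1) by induction (use assms(2) in \<open>auto intro: base_filtration.intros\<close>)

text \<open>The digits of a product are sums of products of digits, of degree at most
  \<open>a + b\<close>. As digits need not stay below \<open>u\<close>, nothing has to be reduced,
  and bounds on base degrees simply add.\<close>

lemma base_filtration_mult:
  assumes u: "u \<in> carrier (poly_ring R)"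
    and f: "f \<in> base_filtration u (Suc a)" and g: "g \<in> base_filtration u (Suc b)"
  shows "f \<otimes>\<^bsub>poly_ring R\<^esub> g \<in> base_filtration u (Suc (a + b))"
proof -
  have const: "c \<otimes>\<^bsub>poly_ring R\<^esub> g \<in> base_filtration u (Suc (a + b))"
    if c: "c \<in> carrier (poly_ring R)" "length c \<le> Suc a" for c
    using g
  proof induction
    case zero
    then show ?case using c base_filtration.zero by simp
  next
    case (step d g)
    note g = base_filtration_closed[OF u step.hyps(3)]
    have "c \<otimes>\<^bsub>poly_ring R\<^esub> (d \<oplus>\<^bsub>poly_ring R\<^esub> g \<otimes>\<^bsub>poly_ring R\<^esub> u)
        = c \<otimes>\<^bsub>poly_ring R\<^esub> d \<oplus>\<^bsub>poly_ring R\<^esub> (c \<otimes>\<^bsub>poly_ring R\<^esub> g) \<otimes>\<^bsub>poly_ring R\<^esub> u"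
      using c step.hyps g u by (simp add: P.r_distr P.m_assoc)
    then show ?case
      using base_filtration.step[OF _ length_mult_le[OF c(1) step.hyps(1) c(2) step.hyps(2)] step.IH]
        c step.hyps(1) by simp
  qed
  note gc = base_filtration_closed[OF u g]
  show ?thesis using f
  proof induction
    case zero
    then show ?case using gc base_filtration.zero by simp
  next
    case (step c f)
    note f = base_filtration_closed[OF u step.hyps(3)]
    have "(c \<oplus>\<^bsub>poly_ring R\<^esub> f \<otimes>\<^bsub>poly_ring R\<^esub> u) \<otimes>\<^bsub>poly_ring R\<^esub> g
        = c \<otimes>\<^bsub>poly_ring R\<^esub> g \<oplus>\<^bsub>poly_ring R\<^esub> (f \<otimes>\<^bsub>poly_ring R\<^esub> g) \<otimes>\<^bsub>poly_ring R\<^esub> u"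
      using step.hyps f gc u by (simp add: P.l_distr P.m_assoc P.m_comm[of u g])
    then show ?case
      using base_filtration_add[OF u const[OF step.hyps(1,2)] base_filtration_base_mult[OF u step.IH]]
      by simp
  qed
qed

text \<open>Existence of base expansions, by repeated division with remainder: the quotient is
  shorter than \<open>f\<close> because \<open>u\<close> is nonconstant.\<close>

lemma base_filtration_all:
  assumes u: "u \<in> carrier (poly_ring R)" "length u \<ge> 2" and f: "f \<in> carrier (poly_ring R)"
  shows "f \<in> base_filtration u (length u - 1)"
  using f
proof (induction "length f" arbitrary: f rule: less_induct)
  case less
  show ?case
  proof (cases "f = []")
    case True
    then show ?thesis using base_filtration.zero by (metis univ_poly_zero)
  next
    case False
    have "u \<noteq> \<zero>\<^bsub>poly_ring R\<^esub>" using u by (auto simp: univ_poly_zero)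
    then obtain q r where qr: "q \<in> carrier (poly_ring R)" "r \<in> carrier (poly_ring R)"
      "f = (u \<otimes>\<^bsub>poly_ring R\<^esub> q) \<oplus>\<^bsub>poly_ring R\<^esub> r" "r = \<zero>\<^bsub>poly_ring R\<^esub> \<or> Polynomials.degree r < Polynomials.degree u"
      using field_long_division_theorem_shell[OF carrier_is_subfield less.prems u(1)] by blast
    have r: "length r \<le> length u - 1" using qr(4) by (auto simp: univ_poly_zero)
    have q: "length q < length f"
    proof (cases "q = []")
      case q: False
      have *: "length (u \<otimes>\<^bsub>poly_ring R\<^esub> q) = length u + length q - 1"
        using u(2) by (intro length_mult u(1) qr(1) q) auto
      have "q \<noteq> [] \<Longrightarrow> length q \<ge> 1" by (cases q) auto
      then have **: "length (u \<otimes>\<^bsub>poly_ring R\<^esub> q) > length r" "length (u \<otimes>\<^bsub>poly_ring R\<^esub> q) > length q"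
        using * r u(2) q by linarith+
      have "polynomial (carrier R) (u \<otimes>\<^bsub>poly_ring R\<^esub> q)" "polynomial (carrier R) r"
        unfolding univ_poly_carrier using u(1) qr(1,2) P.m_closed by blast+
      then have "length f = max (length (u \<otimes>\<^bsub>poly_ring R\<^esub> q)) (length r)"
        unfolding qr(3) univ_poly_add
        using ** by (intro poly_add_length_eq[OF carrier_is_subring]) auto
      then show ?thesis using ** by linarith
    qed (use False in auto)
    have "f = r \<oplus>\<^bsub>poly_ring R\<^esub> q \<otimes>\<^bsub>poly_ring R\<^esub> u"
      using qr u by (simp add: P.m_comm P.a_comm)
    then show ?thesis
      using base_filtration.step[OF qr(2) r less.hyps[OF q qr(1)]] by simp
  qed
qed

lemma division_unique:
  assumes u: "u \<in> carrier (poly_ring R)"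
    and c: "c \<in> carrier (poly_ring R)" "length c < length u" "c' \<in> carrier (poly_ring R)" "length c' < length u"
    and f: "f \<in> carrier (poly_ring R)" "f' \<in> carrier (poly_ring R)"
    and eq: "c \<oplus>\<^bsub>poly_ring R\<^esub> f \<otimes>\<^bsub>poly_ring R\<^esub> u = c' \<oplus>\<^bsub>poly_ring R\<^esub> f' \<otimes>\<^bsub>poly_ring R\<^esub> u"
  shows "c = c'" "f = f'"
proof -
  have eq': "(f \<ominus>\<^bsub>poly_ring R\<^esub> f') \<otimes>\<^bsub>poly_ring R\<^esub> u = c' \<ominus>\<^bsub>poly_ring R\<^esub> c"
  proof -
    let ?A = "f \<otimes>\<^bsub>poly_ring R\<^esub> u" and ?B = "f' \<otimes>\<^bsub>poly_ring R\<^esub> u"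
    have "?A = \<ominus>\<^bsub>poly_ring R\<^esub> c \<oplus>\<^bsub>poly_ring R\<^esub> (c \<oplus>\<^bsub>poly_ring R\<^esub> ?A)"
      using c f u by (simp add: P.r_neg1)
    also have "\<dots> = \<ominus>\<^bsub>poly_ring R\<^esub> c \<oplus>\<^bsub>poly_ring R\<^esub> (c' \<oplus>\<^bsub>poly_ring R\<^esub> ?B)" by (simp add: eq)
    also have "\<dots> \<ominus>\<^bsub>poly_ring R\<^esub> ?B = \<ominus>\<^bsub>poly_ring R\<^esub> c \<oplus>\<^bsub>poly_ring R\<^esub> c'"
      using c f u by (simp add: P.minus_eq P.a_assoc P.r_neg)
    also have "\<dots> = c' \<ominus>\<^bsub>poly_ring R\<^esub> c"
      using c by (simp add: P.minus_eq P.a_comm)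
    finally show ?thesis
      using c f u by (simp add: P.l_distr P.l_minus P.minus_eq)
  qed
  have len: "length (c' \<ominus>\<^bsub>poly_ring R\<^esub> c) < length u"
    using length_add_le[of c' "\<ominus>\<^bsub>poly_ring R\<^esub> c"] c univ_poly_a_inv_length[OF carrier_is_subring c(1)]
    by (simp add: P.minus_eq)
  have "f \<ominus>\<^bsub>poly_ring R\<^esub> f' = []"
  proof (rule ccontr)
    assume ne: "f \<ominus>\<^bsub>poly_ring R\<^esub> f' \<noteq> []"
    from ne have "f \<ominus>\<^bsub>poly_ring R\<^esub> f' \<noteq> []" .
    moreover have "u \<noteq> []" using c(2) by auto
    moreover have "f \<ominus>\<^bsub>poly_ring R\<^esub> f' \<in> carrier (poly_ring R)" using f by simp
    ultimately have "length ((f \<ominus>\<^bsub>poly_ring R\<^esub> f') \<otimes>\<^bsub>poly_ring R\<^esub> u) =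
        length (f \<ominus>\<^bsub>poly_ring R\<^esub> f') + length u - 1"
      using u by (intro length_mult)
    moreover have "0 < length (f \<ominus>\<^bsub>poly_ring R\<^esub> f')" using ne by blast
    ultimately have "length ((f \<ominus>\<^bsub>poly_ring R\<^esub> f') \<otimes>\<^bsub>poly_ring R\<^esub> u) \<ge> length u" by linarith
    then show False using eq' len by simp
  qed
  then have "f \<ominus>\<^bsub>poly_ring R\<^esub> f' = \<zero>\<^bsub>poly_ring R\<^esub>" by (simp only: univ_poly_zero)
  then show "f = f'" using f P.r_right_minus_eq by blast
  then show "c = c'" using eq c f u by simp
qed

lemma horner_sum:
  assumes u: "u \<in> carrier (poly_ring R)" and c: "\<And>i::nat. c i \<in> carrier (poly_ring R)"
  shows "(\<Oplus>\<^bsub>poly_ring R\<^esub>i\<in>{..<Suc n}. c i \<otimes>\<^bsub>poly_ring R\<^esub> u [^]\<^bsub>poly_ring R\<^esub> i) =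
    c 0 \<oplus>\<^bsub>poly_ring R\<^esub> (\<Oplus>\<^bsub>poly_ring R\<^esub>i\<in>{..<n}. c (Suc i) \<otimes>\<^bsub>poly_ring R\<^esub> u [^]\<^bsub>poly_ring R\<^esub> i) \<otimes>\<^bsub>poly_ring R\<^esub> u"
proof (induction n)
  case 0
  then show ?case using u c by (simp add: lessThan_Suc)
next
  case (Suc n)
  have "(\<Oplus>\<^bsub>poly_ring R\<^esub>i\<in>{..<Suc (Suc n)}. c i \<otimes>\<^bsub>poly_ring R\<^esub> u [^]\<^bsub>poly_ring R\<^esub> i) =
      c (Suc n) \<otimes>\<^bsub>poly_ring R\<^esub> u [^]\<^bsub>poly_ring R\<^esub> Suc n \<oplus>\<^bsub>poly_ring R\<^esub>
      (\<Oplus>\<^bsub>poly_ring R\<^esub>i\<in>{..<Suc n}. c i \<otimes>\<^bsub>poly_ring R\<^esub> u [^]\<^bsub>poly_ring R\<^esub> i)"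
    unfolding lessThan_Suc[of "Suc n"] using u c by (subst P.finsum_insert) auto
  moreover have "(\<Oplus>\<^bsub>poly_ring R\<^esub>i\<in>{..<Suc n}. c (Suc i) \<otimes>\<^bsub>poly_ring R\<^esub> u [^]\<^bsub>poly_ring R\<^esub> i) =
      c (Suc n) \<otimes>\<^bsub>poly_ring R\<^esub> u [^]\<^bsub>poly_ring R\<^esub> n \<oplus>\<^bsub>poly_ring R\<^esub>
      (\<Oplus>\<^bsub>poly_ring R\<^esub>i\<in>{..<n}. c (Suc i) \<otimes>\<^bsub>poly_ring R\<^esub> u [^]\<^bsub>poly_ring R\<^esub> i)"
    unfolding lessThan_Suc[of n] using u c by (subst P.finsum_insert) auto
  ultimately show ?case
    unfolding Suc.IH using u c by (simp add: P.l_distr P.m_assoc P.a_ac)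
qed

lemma support_sum:
  assumes u: "u \<in> carrier (poly_ring R)" and c: "\<And>i::nat. c i \<in> carrier (poly_ring R)"
    and n: "\<And>i. i \<ge> n \<Longrightarrow> c i = []"
  shows "(\<Oplus>\<^bsub>poly_ring R\<^esub>i\<in>{i. c i \<noteq> []}. c i \<otimes>\<^bsub>poly_ring R\<^esub> u [^]\<^bsub>poly_ring R\<^esub> i) =
    (\<Oplus>\<^bsub>poly_ring R\<^esub>i\<in>{..<n}. c i \<otimes>\<^bsub>poly_ring R\<^esub> u [^]\<^bsub>poly_ring R\<^esub> i)"
proof (rule P.add.finprod_mono_neutral_cong_left)
  show "{i. c i \<noteq> []} \<subseteq> {..<n}" using n by (metis (mono_tags, lifting) lessThan_iff mem_Collect_eq not_less subsetI)
  fix i assume "i \<in> {..<n} - {i. c i \<noteq> []}"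
  then have "c i = \<zero>\<^bsub>poly_ring R\<^esub>" by (simp add: univ_poly_zero)
  then show "c i \<otimes>\<^bsub>poly_ring R\<^esub> u [^]\<^bsub>poly_ring R\<^esub> i = \<zero>\<^bsub>poly_ring R\<^esub>" using u by simp
qed (use u c in auto)

lemma pdeg_less_pdeg_iff:
  assumes "length u \<ge> 2"
  shows "pdeg c < pdeg u \<longleftrightarrow> length c < length u"
proof -
  have "pdeg u = ereal (real (length u - 1))" using assms by (auto simp: pdeg_def)
  then have "pdeg c < pdeg u \<longleftrightarrow> length c \<le> nat \<lceil>real (length u - 1)\<rceil>"
    by (simp only: pdeg_less_iff)
  then show ?thesis using assms by (simp only: ceiling_of_nat nat_int) linarith
qed

lemma base_expansion_split:
  assumes u: "u \<in> carrier (poly_ring R)" "length u \<ge> 2" and c: "base_expansion R u f c"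
  obtains f' where "f' \<in> carrier (poly_ring R)" "base_expansion R u f' (\<lambda>i. c (Suc i))"
    "f = c 0 \<oplus>\<^bsub>poly_ring R\<^esub> f' \<otimes>\<^bsub>poly_ring R\<^esub> u"
proof -
  have cc: "\<And>i. c i \<in> carrier (poly_ring R)" "\<And>i. pdeg (c i) < pdeg u" and fin: "finite {i. c i \<noteq> []}"
    and f: "f = (\<Oplus>\<^bsub>poly_ring R\<^esub>i\<in>{i. c i \<noteq> []}. c i \<otimes>\<^bsub>poly_ring R\<^esub> u [^]\<^bsub>poly_ring R\<^esub> i)"
    using c by (auto simp: base_expansion_def)
  obtain n where n: "{i. c i \<noteq> []} \<subseteq> {..<n}"
    using finite_nat_iff_bounded fin by auto
  then have n': "c i = []" if "i \<ge> n" for i using that by (auto simp: subset_iff not_le)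
  define f' where "f' = (\<Oplus>\<^bsub>poly_ring R\<^esub>i\<in>{..<n}. c (Suc i) \<otimes>\<^bsub>poly_ring R\<^esub> u [^]\<^bsub>poly_ring R\<^esub> i)"
  have "f = c 0 \<oplus>\<^bsub>poly_ring R\<^esub> f' \<otimes>\<^bsub>poly_ring R\<^esub> u"
  proof -
    have "f = (\<Oplus>\<^bsub>poly_ring R\<^esub>i\<in>{..<Suc n}. c i \<otimes>\<^bsub>poly_ring R\<^esub> u [^]\<^bsub>poly_ring R\<^esub> i)"
      unfolding f
    proof (rule support_sum[of u c "Suc n"])
      show "c i = []" if "Suc n \<le> i" for i using that n' by simp
    qed (fact u(1), fact cc(1))
    also have "\<dots> = c 0 \<oplus>\<^bsub>poly_ring R\<^esub> f' \<otimes>\<^bsub>poly_ring R\<^esub> u"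
      unfolding f'_def by (rule horner_sum[of u c n]) (fact u(1), fact cc(1))
    finally show ?thesis .
  qed
  moreover have "f' = (\<Oplus>\<^bsub>poly_ring R\<^esub>i\<in>{i. c (Suc i) \<noteq> []}. c (Suc i) \<otimes>\<^bsub>poly_ring R\<^esub> u [^]\<^bsub>poly_ring R\<^esub> i)"
    unfolding f'_def using n' by (intro support_sum[OF u(1) cc(1), symmetric]) auto
  moreover have "finite {i. c (Suc i) \<noteq> []}"
  proof (rule finite_subset)
    show "{i. c (Suc i) \<noteq> []} \<subseteq> {..<n}"
      using n' by (metis (mono_tags, lifting) lessThan_iff mem_Collect_eq not_less subsetI le_SucI)
  qed simp
  moreover have "f' \<in> carrier (poly_ring R)"
    unfolding f'_def using cc u by (intro P.finsum_closed) auto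
  ultimately show ?thesis using that[of f'] cc by (auto simp: base_expansion_def)
qed

lemma base_expansion_unique:
  assumes u: "u \<in> carrier (poly_ring R)" "length u \<ge> 2"
    and "base_expansion R u f c" "base_expansion R u f d"
  shows "c = d"
proof
  fix i
  show "c i = d i" using assms(3,4)
  proof (induction i arbitrary: f c d)
    case (0 f c d)
    obtain f1 where 1: "f1 \<in> carrier (poly_ring R)" "f = c 0 \<oplus>\<^bsub>poly_ring R\<^esub> f1 \<otimes>\<^bsub>poly_ring R\<^esub> u"
      using base_expansion_split[OF u 0(1)] by blast
    obtain f2 where 2: "f2 \<in> carrier (poly_ring R)" "f = d 0 \<oplus>\<^bsub>poly_ring R\<^esub> f2 \<otimes>\<^bsub>poly_ring R\<^esub> u"
      using base_expansion_split[OF u 0(2)] by blast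
    have len: "length (c 0) < length u" "length (d 0) < length u"
      and car: "c 0 \<in> carrier (poly_ring R)" "d 0 \<in> carrier (poly_ring R)"
      using 0 pdeg_less_pdeg_iff[OF u(2)] unfolding base_expansion_def by blast+
    show ?case
      by (rule division_unique(1)[OF u(1) car(1) len(1) car(2) len(2) 1(1) 2(1)]) (simp only: 1(2)[symmetric] 2(2)[symmetric])
  next
    case (Suc i f c d)
    obtain f1 where 1: "f1 \<in> carrier (poly_ring R)" "f = c 0 \<oplus>\<^bsub>poly_ring R\<^esub> f1 \<otimes>\<^bsub>poly_ring R\<^esub> u"
      "base_expansion R u f1 (\<lambda>i. c (Suc i))"
      using base_expansion_split[OF u Suc.prems(1)] by blast
    obtain f2 where 2: "f2 \<in> carrier (poly_ring R)" "f = d 0 \<oplus>\<^bsub>poly_ring R\<^esub> f2 \<otimes>\<^bsub>poly_ring R\<^esub> u"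
      "base_expansion R u f2 (\<lambda>i. d (Suc i))"
      using base_expansion_split[OF u Suc.prems(2)] by blast
    have len: "length (c 0) < length u" "length (d 0) < length u"
      and car: "c 0 \<in> carrier (poly_ring R)" "d 0 \<in> carrier (poly_ring R)"
      using Suc.prems pdeg_less_pdeg_iff[OF u(2)] unfolding base_expansion_def by blast+
    have "f1 = f2"
      by (rule division_unique(2)[OF u(1) car(1) len(1) car(2) len(2) 1(1) 2(1)]) (simp only: 1(2)[symmetric] 2(2)[symmetric])
    then show ?case using Suc.IH[OF 1(3)] 2(3) by simp
  qed
qed

lemma base_expansion_Cons:
  assumes u: "u \<in> carrier (poly_ring R)" "length u \<ge> 2"
    and c: "c \<in> carrier (poly_ring R)" "length c < length u"
    and d: "base_expansion R u f d"
  shows "base_expansion R u (c \<oplus>\<^bsub>poly_ring R\<^esub> f \<otimes>\<^bsub>poly_ring R\<^esub> u) (case_nat c d)"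
proof -
  have dd: "\<And>i. d i \<in> carrier (poly_ring R)" "\<And>i. pdeg (d i) < pdeg u" and fin: "finite {i. d i \<noteq> []}"
    and f: "f = (\<Oplus>\<^bsub>poly_ring R\<^esub>i\<in>{i. d i \<noteq> []}. d i \<otimes>\<^bsub>poly_ring R\<^esub> u [^]\<^bsub>poly_ring R\<^esub> i)"
    using d by (auto simp: base_expansion_def)
  obtain n where n: "{i. d i \<noteq> []} \<subseteq> {..<n}"
    using finite_nat_iff_bounded fin by auto
  then have n': "d i = []" if "i \<ge> n" for i using that by (auto simp: subset_iff not_le)
  have cd: "case_nat c d i \<in> carrier (poly_ring R)" for i using c dd by (cases i) auto
  have z: "case_nat c d i = []" if "i \<ge> Suc n" for i using that n' by (cases i) auto
  have "f = (\<Oplus>\<^bsub>poly_ring R\<^esub>i\<in>{..<n}. case_nat c d (Suc i) \<otimes>\<^bsub>poly_ring R\<^esub> u [^]\<^bsub>poly_ring R\<^esub> i)"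
    unfolding f using support_sum[of u d n, OF u(1) dd(1) n'] by simp
  then have "c \<oplus>\<^bsub>poly_ring R\<^esub> f \<otimes>\<^bsub>poly_ring R\<^esub> u =
     (\<Oplus>\<^bsub>poly_ring R\<^esub>i\<in>{..<Suc n}. case_nat c d i \<otimes>\<^bsub>poly_ring R\<^esub> u [^]\<^bsub>poly_ring R\<^esub> i)"
    using horner_sum[of u "case_nat c d" n] u(1) cd by simp
  also have "\<dots> = (\<Oplus>\<^bsub>poly_ring R\<^esub>i\<in>{i. case_nat c d i \<noteq> []}. case_nat c d i \<otimes>\<^bsub>poly_ring R\<^esub> u [^]\<^bsub>poly_ring R\<^esub> i)"
    by (rule support_sum[of u "case_nat c d" "Suc n", symmetric]) (fact u(1), fact cd, fact z)
  finally have "c \<oplus>\<^bsub>poly_ring R\<^esub> f \<otimes>\<^bsub>poly_ring R\<^esub> u =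
    (\<Oplus>\<^bsub>poly_ring R\<^esub>i\<in>{i. case_nat c d i \<noteq> []}. case_nat c d i \<otimes>\<^bsub>poly_ring R\<^esub> u [^]\<^bsub>poly_ring R\<^esub> i)" .
  moreover have "finite {i. case_nat c d i \<noteq> []}"
  proof (rule finite_subset)
    show "{i. case_nat c d i \<noteq> []} \<subseteq> {..<Suc n}"
      using z by (metis (mono_tags, lifting) lessThan_iff mem_Collect_eq not_less subsetI)
  qed simp
  moreover have "pdeg (case_nat c d i) < pdeg u" for i
    using dd c pdeg_less_pdeg_iff[OF u(2)] by (cases i) auto
  ultimately show ?thesis using cd by (auto simp: base_expansion_def)
qed

lemma base_expansion_of_filtration:
  assumes u: "u \<in> carrier (poly_ring R)" "length u \<ge> 2" and N: "N < length u"
    and f: "f \<in> base_filtration u N"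
  shows "\<exists>c. base_expansion R u f c \<and> (\<forall>i. length (c i) \<le> N)"
  using f
proof induction
  case zero
  have "base_expansion R u \<zero>\<^bsub>poly_ring R\<^esub> (\<lambda>i. [])"
    using u pdeg_less_pdeg_iff[OF u(2), of "[]"]
    by (auto simp: base_expansion_def univ_poly_zero_closed)
  then show ?case by auto
next
  case (step c f)
  then obtain d where d: "base_expansion R u f d" "\<forall>i. length (d i) \<le> N" by auto
  have "length (case_nat c d i) \<le> N" for i using d(2) step.hyps(2) by (cases i) auto
  then show ?case
    using base_expansion_Cons[OF u step.hyps(1) _ d(1)] step.hyps(2) N by fastforce
qed

lemma filtration_of_base_expansion:
  assumes u: "u \<in> carrier (poly_ring R)" "length u \<ge> 2"
    and c: "base_expansion R u f c" "\<And>i. length (c i) \<le> N"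
  shows "f \<in> base_filtration u N"
proof -
  obtain n where n: "{i. c i \<noteq> []} \<subseteq> {..<n}"
    using finite_nat_iff_bounded c(1) by (auto simp: base_expansion_def)
  then have n': "\<forall>i\<ge>n. c i = []" by (auto simp: subset_iff not_le)
  then show ?thesis using c
  proof (induction n arbitrary: f c)
    case 0
    then have "f = \<zero>\<^bsub>poly_ring R\<^esub>" by (auto simp: base_expansion_def)
    then show ?case using base_filtration.zero by simp
  next
    case (Suc n)
    obtain f' where f': "f' \<in> carrier (poly_ring R)" "base_expansion R u f' (\<lambda>i. c (Suc i))"
      "f = c 0 \<oplus>\<^bsub>poly_ring R\<^esub> f' \<otimes>\<^bsub>poly_ring R\<^esub> u"
      using base_expansion_split[OF u Suc.prems(2)] by metis
    have "f' \<in> base_filtration u N"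
      using Suc.prems f' by (intro Suc.IH[of "\<lambda>i. c (Suc i)"]) auto
    moreover have "c 0 \<in> carrier (poly_ring R)" using Suc.prems(2) by (auto simp: base_expansion_def)
    ultimately show ?case using base_filtration.step Suc.prems(3) f'(3) by blast
  qed
qed

text \<open>The bound on \<open>x\<close> keeps the allowed digit length below
  \<open>length u\<close>, so the digits of a Horner form are legal and must be those of the unique
  expansion. This is the bridge from the description operator in \<open>base_deg\<close> to
  \<open>base_filtration\<close>.\<close>

lemma base_deg_less_iff:
  assumes u: "u \<in> carrier (poly_ring R)" "length u \<ge> 2" and f: "f \<in> carrier (poly_ring R)"
    and x: "x \<le> real (length u - 1)"
  shows "base_deg R u f < ereal x \<longleftrightarrow> f \<in> base_filtration u (nat \<lceil>x\<rceil>)"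
proof -
  obtain c where c: "base_expansion R u f c"
    using base_expansion_of_filtration[OF u _ base_filtration_all[OF u f]] u(2)
    by fastforce
  then have the: "(THE c. base_expansion R u f c) = c"
    using base_expansion_unique[OF u] by blast
  have fin: "finite (range (\<lambda>i. pdeg (c i)))"
  proof (rule finite_subset)
    show "range (\<lambda>i. pdeg (c i)) \<subseteq> insert (-\<infinity>) ((\<lambda>i. pdeg (c i)) ` {i. c i \<noteq> []})"
      by (auto simp: pdeg_def)
    show "finite (insert (-\<infinity>) ((\<lambda>i. pdeg (c i)) ` {i. c i \<noteq> []}))"
      using c by (auto simp: base_expansion_def)
  qed
  have "base_deg R u f < ereal x \<longleftrightarrow> (\<forall>i. pdeg (c i) < ereal x)"
    unfolding base_deg_def the using fin by (subst Max_less_iff) auto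
  also have "\<dots> \<longleftrightarrow> (\<forall>i. length (c i) \<le> nat \<lceil>x\<rceil>)" by (simp add: pdeg_less_iff)
  also have "\<dots> \<longleftrightarrow> f \<in> base_filtration u (nat \<lceil>x\<rceil>)"
  proof
    assume "\<forall>i. length (c i) \<le> nat \<lceil>x\<rceil>"
    then show "f \<in> base_filtration u (nat \<lceil>x\<rceil>)"
      using filtration_of_base_expansion[OF u c] by simp
  next
    assume *: "f \<in> base_filtration u (nat \<lceil>x\<rceil>)"
    have "\<lceil>x\<rceil> \<le> int (length u - 1)" using x by (simp add: ceiling_le_iff)
    then have "nat \<lceil>x\<rceil> < length u" using u(2) by linarith
    from base_expansion_of_filtration[OF u this *] base_expansion_unique[OF u c]
    show "\<forall>i. length (c i) \<le> nat \<lceil>x\<rceil>" by blast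
  qed
  finally show ?thesis .
qed

text \<open>Where \<open>u\<close> has the constant value \<open>k\<close>, substituting
  \<open>k\<close> for \<open>u\<close> collapses the expansion to a single polynomial no longer
  than the digits. This is why words of the evaluation code restrict to Reed--Solomon words on
  orbits.\<close>

lemma eval_base_filtration:
  assumes u: "u \<in> carrier (poly_ring R)" and f: "f \<in> base_filtration u N"
    and S: "S \<subseteq> carrier R" and k: "k \<in> carrier R" "\<And>x. x \<in> S \<Longrightarrow> eval u x = k"
  shows "\<exists>e\<in>carrier (poly_ring R). length e \<le> N \<and> (\<forall>x\<in>S. eval f x = eval e x)"
  using f
proof induction
  case zero
  then show ?case using P.zero_closed by (intro bexI[of _ "[]"]) (auto simp: univ_poly_zero)
next
  case (step c f)
  then obtain e where e: "e \<in> carrier (poly_ring R)" "length e \<le> N" "\<forall>x\<in>S. eval f x = eval e x" by auto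
  note f = base_filtration_closed[OF u step.hyps(3)]
  have "polynomial (carrier R) (poly_of_const k)"
    unfolding poly_of_const_def using k(1) by (intro normalize_gives_polynomial) simp
  then have kp: "poly_of_const k \<in> carrier (poly_ring R)" "length (poly_of_const k) \<le> Suc 0"
    unfolding univ_poly_carrier by (auto simp: poly_of_const_def)
  let ?e = "c \<oplus>\<^bsub>poly_ring R\<^esub> e \<otimes>\<^bsub>poly_ring R\<^esub> poly_of_const k"
  have "length (e \<otimes>\<^bsub>poly_ring R\<^esub> poly_of_const k) \<le> N"
  proof (cases "e = []")
    case True
    then show ?thesis using P.l_null[OF kp(1)] by (simp add: univ_poly_zero)
  next
    case False
    then show ?thesis using length_mult_le[OF e(1) kp(1) _ kp(2), of "length e - 1"] e(2) by (cases e) auto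
  qed
  then have "length ?e \<le> N" using length_add_le[of c "e \<otimes>\<^bsub>poly_ring R\<^esub> poly_of_const k"] step.hyps(2) by simp
  moreover have "eval (c \<oplus>\<^bsub>poly_ring R\<^esub> f \<otimes>\<^bsub>poly_ring R\<^esub> u) x = eval ?e x" if x: "x \<in> S" for x
  proof -
    have xc: "x \<in> carrier R" using x S by auto
    interpret ev: ring_hom_cring "poly_ring R" R "\<lambda>p. eval p x"
      by (rule eval_cring_hom[OF carrier_is_subring xc])
    have "eval (poly_of_const k) x = k" using k xc by (auto simp: poly_of_const_def)
    then show ?thesis using step.hyps(1) f u e kp k x by simp
  qed
  moreover have "?e \<in> carrier (poly_ring R)" using step.hyps(1) e kp by simp
  ultimately show ?case by (intro bexI[of _ ?e] conjI ballI)
qed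

end

section \<open>Standing assumptions and the roots of g\<close>

locale expander_setup = field F for F (structure) +
  fixes m p :: nat and K :: "'a set"
  assumes m_ge_2: "m \<ge> 2" and prime_p: "prime p" and finite_carrier: "finite (carrier F)"
    and char_p: "[p] \<cdot> \<one> = \<zero>" and splitted_g: "splitted (g_poly F m p)"
    and subfield_K: "subfield K F" and card_K: "card K = p ^ m"
begin

abbreviation "q \<equiv> p ^ m"
abbreviation "G \<equiv> G_set F m p"
abbreviation "H \<equiv> H_set F K"
abbreviation "g \<equiv> g_poly F m p"

sublocale P: domain "poly_ring F" using univ_poly_is_domain[OF carrier_is_subring] .

lemma p_ge_2: "p \<ge> 2" using prime_ge_2_nat[OF prime_p] .
lemma p_less_q: "p < q" using power_strict_increasing[of 1 m p] p_ge_2 m_ge_2 by simp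
lemma pm_pos [simp]: "p > 0" "m > 0" using p_ge_2 m_ge_2 by auto
lemma q_ge_4: "q \<ge> 4"
proof -
  have "2 ^ 2 \<le> p ^ 2" using p_ge_2 by (intro power_mono) auto
  also have "\<dots> \<le> p ^ m" using m_ge_2 p_ge_2 by (intro power_increasing) auto
  finally show ?thesis by simp
qed

lemma K_props:
  "K \<subseteq> carrier F" "\<zero> \<in> K" "\<one> \<in> K" "finite K"
  "\<And>x y. x \<in> K \<Longrightarrow> y \<in> K \<Longrightarrow> x \<otimes> y \<in> K" "\<And>x y. x \<in> K \<Longrightarrow> y \<in> K \<Longrightarrow> x \<oplus> y \<in> K"
  "\<And>x. x \<in> K \<Longrightarrow> \<ominus> x \<in> K"
  using subringE[OF subfieldE(1)[OF subfield_K]] finite_subset[OF _ finite_carrier] by auto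

lemma H_props:
  "H \<subseteq> carrier F" "\<zero> \<notin> H" "\<one> \<in> H" "finite H" "card H = q - 1"
  "\<And>x y. x \<in> H \<Longrightarrow> y \<in> H \<Longrightarrow> x \<otimes> y \<in> H" "\<And>x. x \<in> H \<Longrightarrow> inv x \<in> H" "\<And>x. x \<in> H \<Longrightarrow> x \<in> K"
proof -
  show "\<And>x. x \<in> H \<Longrightarrow> inv x \<in> H"
    using subfield_m_inv(1)[OF subfield_K] by (auto simp: H_set_def)
  show "\<And>x y. x \<in> H \<Longrightarrow> y \<in> H \<Longrightarrow> x \<otimes> y \<in> H"
  proof -
    fix x y assume "x \<in> H" "y \<in> H"
    then have *: "x \<in> K" "y \<in> K" "x \<noteq> \<zero>" "y \<noteq> \<zero>" by (auto simp: H_set_def)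
    then have "x \<in> carrier F" "y \<in> carrier F" using K_props(1) by auto
    then have "x \<otimes> y \<noteq> \<zero>" using * integral_iff by auto
    then show "x \<otimes> y \<in> H" using K_props(5)[OF *(1,2)] by (simp add: H_set_def)
  qed
  show "card H = q - 1" using K_props card_K by (simp add: H_set_def)
qed (use K_props in \<open>auto simp: H_set_def\<close>)

lemma H_inv: assumes "h \<in> H" shows "h \<otimes> inv h = \<one>" "inv h \<otimes> h = \<one>" "inv h \<in> carrier F" "h \<in> carrier F" "h \<noteq> \<zero>"
proof -
  show *: "h \<in> carrier F" "h \<noteq> \<zero>" using assms H_props(1,2) by auto
  then have "h \<in> Units F" by (simp add: field_Units)
  then show "h \<otimes> inv h = \<one>" "inv h \<otimes> h = \<one>" "inv h \<in> carrier F" by simp_all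
qed

lemma frob_add: "x \<in> carrier F \<Longrightarrow> y \<in> carrier F \<Longrightarrow> (x \<oplus> y) [^] (p ^ k) = x [^] (p ^ k) \<oplus> y [^] (p ^ k)"
  by (rule frobenius_pow_add[OF prime_p char_p])

lemma frob_add1: "x \<in> carrier F \<Longrightarrow> y \<in> carrier F \<Longrightarrow> (x \<oplus> y) [^] p = x [^] p \<oplus> y [^] p"
  by (rule frobenius_add[OF prime_p char_p])

lemma frob_minus:
  assumes "x \<in> carrier F" shows "(\<ominus> x) [^] (p ^ k) = \<ominus> (x [^] (p ^ k))"
proof -
  have "(\<ominus> x) [^] (p ^ k) \<oplus> x [^] (p ^ k) = \<zero>"
    using assms frob_add[of "\<ominus> x" x k] p_ge_2 by (simp add: l_neg nat_pow_zero)
  then show ?thesis using assms by (simp add: minus_equality)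
qed

lemma frob_minus1: "x \<in> carrier F \<Longrightarrow> (\<ominus> x) [^] p = \<ominus> (x [^] p)"
  using frob_minus[of x 1] by simp

text \<open>Lagrange's theorem in the multiplicative group of \<open>K\<close>, which has order
  \<open>q - 1\<close>.\<close>

lemma K_pow_q: assumes "c \<in> K" shows "c [^] q = c"
proof (cases "c = \<zero>")
  case True
  then show ?thesis using q_ge_4 by (simp add: nat_pow_zero)
next
  case False
  let ?M = "\<lparr>carrier = H, monoid.mult = (\<otimes>), one = \<one>\<rparr>"
  have M: "group ?M"
  proof (rule groupI)
    show "\<exists>y\<in>carrier ?M. y \<otimes>\<^bsub>?M\<^esub> x = \<one>\<^bsub>?M\<^esub>" if "x \<in> carrier ?M" for x
      using that H_props(7) H_inv(2) by (intro bexI[of _ "inv x"]) auto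
  qed (use H_props H_inv(4) in \<open>auto intro!: m_assoc\<close>)
  have pow: "x [^]\<^bsub>?M\<^esub> (n::nat) = x [^] n" for x n
    by (induction n) (simp_all add: nat_pow_def)
  have "c [^]\<^bsub>?M\<^esub> card H = \<one>"
    using group.pow_order_eq_1[OF M, of c] False assms by (simp add: Coset.order_def H_set_def)
  then have "c [^] (q - 1) = \<one>" using pow H_props by simp
  then have "c [^] (q - 1) \<otimes> c = c" using assms K_props(1) by auto
  moreover have "c [^] q = c [^] (q - 1) \<otimes> c" using q_ge_4 nat_pow_Suc[of c "q - 1"] by simp
  ultimately show ?thesis by simp
qed

lemma K_pow_p: "c \<in> K \<Longrightarrow> c [^] (n::nat) \<in> K"
  by (induction n) (use K_props in auto)

lemma g_carrier: "g \<in> carrier (poly_ring F)"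
  unfolding g_poly_def using var_pow_closed[OF carrier_is_subring] var_closed(1)[OF carrier_is_subring] by simp

lemma g_length: "length g = Suc q"
proof -
  have c: "polynomial (carrier F) (X [^]\<^bsub>poly_ring F\<^esub> (n::nat))" "polynomial (carrier F) X" for n
    using var_pow_closed[OF carrier_is_subring] var_closed(2)[OF carrier_is_subring] by (auto simp: univ_poly_carrier)
  have l: "length (X [^]\<^bsub>poly_ring F\<^esub> (n::nat)) = Suc n" for n by (simp add: var_pow_eq)
  have 1: "length (X [^]\<^bsub>poly_ring F\<^esub> q \<oplus>\<^bsub>poly_ring F\<^esub> X [^]\<^bsub>poly_ring F\<^esub> p) = Suc q"
    unfolding univ_poly_add using c l p_less_q
    by (subst poly_add_length_eq[OF carrier_is_subring]) auto
  have 2: "polynomial (carrier F) (X [^]\<^bsub>poly_ring F\<^esub> q \<oplus>\<^bsub>poly_ring F\<^esub> X [^]\<^bsub>poly_ring F\<^esub> p)"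
    using var_pow_closed[OF carrier_is_subring] by (auto simp: univ_poly_carrier)
  have 3: "length (X::'a list) = 2" by (simp add: var_def)
  show ?thesis unfolding g_poly_def
    using 1 3 q_ge_4 c 2 unfolding univ_poly_add
    by (subst poly_add_length_eq[OF carrier_is_subring]) (auto simp del: poly_add.simps)
qed

lemma eval_hom: "x \<in> carrier F \<Longrightarrow> ring_hom_cring (poly_ring F) F (\<lambda>f. eval f x)"
  by (rule eval_cring_hom[OF carrier_is_subring])

lemma eval_var_pow: "x \<in> carrier F \<Longrightarrow> eval (X [^]\<^bsub>poly_ring F\<^esub> (n::nat)) x = x [^] n"
  using unitary_monom_eq_var_pow[OF carrier_is_subring, of n] eval_monom[of \<one> x n] by simp

lemma ev_nat_pow:
  assumes x: "x \<in> carrier F" and f: "f \<in> carrier (poly_ring F)"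
  shows "eval (f [^]\<^bsub>poly_ring F\<^esub> (n::nat)) x = (eval f x) [^] n"
  by (rule ring_hom_ring.hom_nat_pow[OF eval_ring_hom[OF carrier_is_subring x] f])

lemma eval_g: assumes x: "x \<in> carrier F" shows "eval g x = x [^] q \<oplus> x [^] p \<oplus> x"
proof -
  interpret ev: ring_hom_cring "poly_ring F" F "\<lambda>f. eval f x" by (rule eval_hom[OF x])
  show ?thesis unfolding g_poly_def
    using var_pow_closed[OF carrier_is_subring] var_closed(1)[OF carrier_is_subring] x
    by (simp add: eval_var_pow eval_var)
qed

lemma eval_g_add:
  assumes "x \<in> carrier F" "y \<in> carrier F" shows "eval g (x \<oplus> y) = eval g x \<oplus> eval g y"
  using assms by (simp add: eval_g frob_add frob_add1 a_ac)

lemma G_iff: "a \<in> G \<longleftrightarrow> a \<in> carrier F \<and> a [^] q \<oplus> a [^] p \<oplus> a = \<zero>"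
  unfolding G_set_def using eval_g by auto

lemma G_pow_q: "a \<in> G \<Longrightarrow> a [^] q = \<ominus> (a [^] p \<oplus> a)"
  using G_iff[of a] by (metis a_assoc a_closed minus_equality nat_pow_closed)

lemma G_carrier: "G \<subseteq> carrier F" "finite G"
  using G_iff finite_subset[OF _ finite_carrier] by auto

lemma G_zero: "\<zero> \<in> G"
  using q_ge_4 p_ge_2 by (simp add: G_iff nat_pow_zero)

lemma G_add: "a \<in> G \<Longrightarrow> b \<in> G \<Longrightarrow> a \<oplus> b \<in> G"
  using eval_g_add[of a b] by (auto simp: G_set_def)

lemma G_minus: "a \<in> G \<Longrightarrow> \<ominus> a \<in> G"
proof -
  assume a: "a \<in> G"
  then have ac: "a \<in> carrier F" using G_iff by simp
  have "eval g a \<oplus> eval g (\<ominus> a) = eval g \<zero>" using eval_g_add[of a "\<ominus> a"] ac by (simp add: r_neg)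
  then show "\<ominus> a \<in> G" using a G_zero ac eval_in_carrier[of g] polynomial_incl[of "carrier F" g] g_carrier
    by (auto simp: G_set_def univ_poly_carrier[symmetric])
qed

text \<open>The coefficients of \<open>g\<close> lie in the prime field, so Frobenius maps roots to
  roots.\<close>

lemma G_frob: assumes "a \<in> G" shows "a [^] p \<in> G"
proof -
  have a: "a \<in> carrier F" using assms G_iff by simp
  have "(a [^] q \<oplus> a [^] p \<oplus> a) [^] p = \<zero>" using assms p_ge_2 by (simp add: G_iff nat_pow_zero)
  then show ?thesis using a by (simp add: G_iff frob_add1 nat_pow_pow mult.commute)
qed

text \<open>Separability without derivatives. By additivity g(X) = g(X - a) + g(a) = g(X - a) for a
  root \<open>a\<close>, and this is the product of \<open>?l\<close>, which is X - a, and a factor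
  \<open>?k\<close> with value 1 at \<open>a\<close>. A double root would make \<open>?l\<close>
  divide \<open>?k\<close>.\<close>

lemma card_G: "card G = q"
proof -
  have roots: "set_mset (roots g) = G"
    using roots_mem_iff_is_root[OF g_carrier] g_length by (auto simp: is_root_def G_set_def)
  have "count (roots g) a \<le> 1" if a: "a \<in> G" for a
  proof (rule ccontr)
    assume neg: "\<not> count (roots g) a \<le> 1"
    have ac: "a \<in> carrier F" using a G_iff by simp
    let ?l = "[\<one>, \<ominus> a]" and ?A = "poly_of_const a"
    have l: "?l \<in> carrier (poly_ring F)" using ac by (auto simp: univ_poly_carrier[symmetric] polynomial_def)
    have cst: "poly_of_const \<in> Ring.ring_hom F (poly_ring F)"
      using canonical_embedding_is_hom[OF carrier_is_subring] by simp
    interpret cst: ring_hom_ring F "poly_ring F" poly_of_const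
      by (rule ring_hom_ringI2[OF ring_axioms P.ring_axioms cst])
    have A: "?A \<in> carrier (poly_ring F)" using ac by simp
    have X: "X = ?l \<oplus>\<^bsub>poly_ring F\<^esub> ?A"
      using ac by (auto simp: var_def univ_poly_add poly_of_const_def l_neg)
    note fr = P.frobenius_pow_add[OF prime_p poly_ring_char[OF char_p] l A]
    have fr1: "X [^]\<^bsub>poly_ring F\<^esub> p = ?l [^]\<^bsub>poly_ring F\<^esub> p \<oplus>\<^bsub>poly_ring F\<^esub> ?A [^]\<^bsub>poly_ring F\<^esub> p"
      using fr[of 1] X by simp
    have frm: "X [^]\<^bsub>poly_ring F\<^esub> q = ?l [^]\<^bsub>poly_ring F\<^esub> q \<oplus>\<^bsub>poly_ring F\<^esub> ?A [^]\<^bsub>poly_ring F\<^esub> q"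
      using fr[of m] X by simp
    have "?A [^]\<^bsub>poly_ring F\<^esub> q \<oplus>\<^bsub>poly_ring F\<^esub> ?A [^]\<^bsub>poly_ring F\<^esub> p \<oplus>\<^bsub>poly_ring F\<^esub> ?A = \<zero>\<^bsub>poly_ring F\<^esub>"
      using a ac by (simp add: G_iff flip: cst.hom_nat_pow cst.hom_add)
    moreover have "g = (?l [^]\<^bsub>poly_ring F\<^esub> q \<oplus>\<^bsub>poly_ring F\<^esub> ?l [^]\<^bsub>poly_ring F\<^esub> p \<oplus>\<^bsub>poly_ring F\<^esub> ?l) \<oplus>\<^bsub>poly_ring F\<^esub>
      (?A [^]\<^bsub>poly_ring F\<^esub> q \<oplus>\<^bsub>poly_ring F\<^esub> ?A [^]\<^bsub>poly_ring F\<^esub> p \<oplus>\<^bsub>poly_ring F\<^esub> ?A)"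
    proof -
      have "g = (?l [^]\<^bsub>poly_ring F\<^esub> q \<oplus>\<^bsub>poly_ring F\<^esub> ?A [^]\<^bsub>poly_ring F\<^esub> q) \<oplus>\<^bsub>poly_ring F\<^esub>
        (?l [^]\<^bsub>poly_ring F\<^esub> p \<oplus>\<^bsub>poly_ring F\<^esub> ?A [^]\<^bsub>poly_ring F\<^esub> p) \<oplus>\<^bsub>poly_ring F\<^esub> (?l \<oplus>\<^bsub>poly_ring F\<^esub> ?A)"
        unfolding g_poly_def by (simp only: frm fr1 X[symmetric])
      then show ?thesis using P.nat_pow_closed[OF l] P.nat_pow_closed[OF A] l A
        by (simp only: P.a_ac P.a_closed)
    qed
    ultimately have g: "g = ?l [^]\<^bsub>poly_ring F\<^esub> q \<oplus>\<^bsub>poly_ring F\<^esub> ?l [^]\<^bsub>poly_ring F\<^esub> p \<oplus>\<^bsub>poly_ring F\<^esub> ?l"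
      using l by simp
    let ?k = "?l [^]\<^bsub>poly_ring F\<^esub> (q - 1) \<oplus>\<^bsub>poly_ring F\<^esub> ?l [^]\<^bsub>poly_ring F\<^esub> (p - 1) \<oplus>\<^bsub>poly_ring F\<^esub> \<one>\<^bsub>poly_ring F\<^esub>"
    have pw: "?l [^]\<^bsub>poly_ring F\<^esub> n = ?l \<otimes>\<^bsub>poly_ring F\<^esub> ?l [^]\<^bsub>poly_ring F\<^esub> (n - 1)" if "n \<ge> 1" for n :: nat
      using P.nat_pow_Suc2[OF l, of "n - 1"] that by simp
    have gk: "g = ?l \<otimes>\<^bsub>poly_ring F\<^esub> ?k"
      using l pw[of q] pw[of p] q_ge_4 p_ge_2 g by (simp add: P.r_distr)
    have "([\<one>, \<ominus> a] [^]\<^bsub>poly_ring F\<^esub> (2::nat)) pdivides g"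
      using neg alg_mult_eq_count_roots[OF g_carrier] le_alg_mult_imp_pdivides[OF ac g_carrier, of 2] by simp
    then obtain s where s: "s \<in> carrier (poly_ring F)" "g = ?l [^]\<^bsub>poly_ring F\<^esub> (2::nat) \<otimes>\<^bsub>poly_ring F\<^esub> s"
      unfolding pdivides_def factor_def by auto
    have "?l [^]\<^bsub>poly_ring F\<^esub> (2::nat) = ?l \<otimes>\<^bsub>poly_ring F\<^esub> ?l" using l by (simp add: numeral_2_eq_2)
    then have "?l \<otimes>\<^bsub>poly_ring F\<^esub> ?k = ?l \<otimes>\<^bsub>poly_ring F\<^esub> (?l \<otimes>\<^bsub>poly_ring F\<^esub> s)"
      using gk s l by (simp add: P.m_assoc)
    then have ks: "?k = ?l \<otimes>\<^bsub>poly_ring F\<^esub> s"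
      using l s by (subst (asm) P.m_lcancel) (auto simp: univ_poly_zero)
    interpret ev: ring_hom_cring "poly_ring F" F "\<lambda>f. eval f a" by (rule eval_hom[OF ac])
    have ev_pow: "eval (?l [^]\<^bsub>poly_ring F\<^esub> (n::nat)) a = (eval ?l a) [^] n" for n
      by (rule ev_nat_pow[OF ac l])
    have el: "eval ?l a = \<zero>" using ac by (simp add: r_neg)
    have "eval ?k a = \<zero>" unfolding ks ev.hom_mult[OF l s(1)] el using s(1) by simp
    moreover have "eval ?k a = \<one>"
      using l q_ge_4 p_ge_2 by (simp add: ev_pow el nat_pow_zero del: eval.simps)
    ultimately show False by simp
  qed
  then have "count (roots g) a = count (mset_set G) a" for a
  proof (cases "a \<in> G")
    case True
    then have "count (roots g) a \<noteq> 0" using roots count_eq_zero_iff[of "roots g" a] by blast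
    then have "count (roots g) a = 1" using True \<open>a \<in> G \<Longrightarrow> count (roots g) a \<le> 1\<close> by linarith
    then show ?thesis using True G_carrier by (simp add: count_mset_set)
  next
    case False
    then have "count (roots g) a = 0" using roots count_eq_zero_iff[of "roots g" a] by blast
    then show ?thesis using False by (simp add: count_mset_set)
  qed
  then have "roots g = mset_set G" by (rule multiset_eqI)
  then show ?thesis using splitted_g g_length by (simp add: splitted_def)
qed

section \<open>Linear independence of the roots over \<open>K\<close>\<close>

text \<open>The prime field as the Frobenius-fixed part of \<open>K\<close>: the comparison of
  coefficients in \<open>independent_over_K\<close> delivers exactly the equation x^p = x.\<close>

definition Fp :: "'a set" where "Fp = {c \<in> K. c [^] p = c}"

lemma pow_p_eq_zero: "x \<in> carrier F \<Longrightarrow> x [^] (n::nat) = \<zero> \<Longrightarrow> x = \<zero>"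
proof (induction n)
  case (Suc n)
  then show ?case using integral by fastforce
qed simp

lemma subfield_Fp: "subfield Fp F"
proof (rule subfieldI')
  show "subring Fp F"
  proof (rule subringI)
    show "Fp \<subseteq> carrier F" using K_props(1) by (auto simp: Fp_def)
    show "\<one> \<in> Fp" using K_props by (simp add: Fp_def)
    show "\<ominus> x \<in> Fp" if "x \<in> Fp" for x using that K_props frob_minus1 by (auto simp: Fp_def)
    show "x \<otimes> y \<in> Fp" if "x \<in> Fp" "y \<in> Fp" for x y
      using that K_props nat_pow_distrib[of x y p] by (auto simp: Fp_def)
    show "x \<oplus> y \<in> Fp" if "x \<in> Fp" "y \<in> Fp" for x y
      using that K_props frob_add1[of x y] by (auto simp: Fp_def)
  qed
  fix k assume k: "k \<in> Fp - {\<zero>}"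
  then have kH: "k \<in> H" and kp: "k [^] p = k" by (auto simp: Fp_def H_set_def)
  have "(inv k) [^] p \<otimes> k [^] p = (inv k \<otimes> k) [^] p"
    using H_inv[OF kH] by (intro nat_pow_distrib[symmetric])
  then have "(inv k) [^] p \<otimes> k = \<one>" using H_inv[OF kH] kp by simp
  then have "(inv k) [^] p = inv k"
    using H_inv[OF kH] by (metis inv_unique' m_comm nat_pow_closed inv_char comm_inv_char)
  then show "inv k \<in> Fp" using H_props(7,8) kH by (auto simp: Fp_def)
qed

lemma Fp_props: "Fp \<subseteq> K" "Fp \<subseteq> carrier F" "finite Fp"
  using K_props finite_subset[of Fp K] by (auto simp: Fp_def)

lemma multiples_in_Fp: "[(k::nat)] \<cdot> \<one> \<in> Fp"
  using subringE[OF subfieldE(1)[OF subfield_Fp]] by (induction k) auto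

text \<open>The upper bound counts the roots of X^p - X, the lower bound the multiples of
  one.\<close>

lemma card_Fp: "card Fp = p"
proof (rule antisym)
  let ?f = "X [^]\<^bsub>poly_ring F\<^esub> p \<oplus>\<^bsub>poly_ring F\<^esub> (\<ominus>\<^bsub>poly_ring F\<^esub> X)"
  have c: "X [^]\<^bsub>poly_ring F\<^esub> p \<in> carrier (poly_ring F)" "X \<in> carrier (poly_ring F)"
    using var_pow_closed[OF carrier_is_subring] var_closed(1)[OF carrier_is_subring] by auto
  have len: "length (X [^]\<^bsub>poly_ring F\<^esub> p) = Suc p" "length (\<ominus>\<^bsub>poly_ring F\<^esub> X) = 2"
    using univ_poly_a_inv_length[OF carrier_is_subring c(2)] by (simp add: var_pow_eq, simp add: var_def)
  show "card Fp \<le> p"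
  proof (cases "p = 1")
    case False
    have pp: "polynomial (carrier F) (X [^]\<^bsub>poly_ring F\<^esub> p)" "polynomial (carrier F) (\<ominus>\<^bsub>poly_ring F\<^esub> X)"
      unfolding univ_poly_carrier using c P.a_inv_closed by blast+
    have l: "length ?f = Suc p"
      unfolding univ_poly_add using len p_ge_2
      by (subst poly_add_length_eq[OF carrier_is_subring pp]) auto
    have fc: "?f \<in> carrier (poly_ring F)" using c by simp
    have "Fp \<subseteq> {x \<in> carrier F. eval ?f x = \<zero>}"
    proof
      fix x assume x: "x \<in> Fp"
      then have xc: "x \<in> carrier F" and xp: "x [^] p = x" using K_props by (auto simp: Fp_def)
      interpret ev: ring_hom_cring "poly_ring F" F "\<lambda>f. eval f x" by (rule eval_hom[OF xc])
      have "eval ?f x = x [^] p \<oplus> \<ominus> x"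
        using c xc by (simp only: ev.hom_add ev.hom_a_inv P.a_inv_closed eval_var_pow eval_var)
      then show "x \<in> {x \<in> carrier F. eval ?f x = \<zero>}" using xc xp by (simp add: r_neg)
    qed
    from card_roots_le_degree[OF fc _ this] show ?thesis using l by force
  qed (use p_ge_2 in simp)
  have inj: "inj_on (\<lambda>k. [(k::nat)] \<cdot> \<one>) {..<p}"
  proof (rule linorder_inj_onI')
    fix i j assume ij: "i \<in> {..<p}" "j \<in> {..<p}" "i < j"
    show "[i] \<cdot> \<one> \<noteq> [j] \<cdot> \<one>"
    proof
      assume eq: "[i] \<cdot> \<one> = [j] \<cdot> \<one>"
      have "[i] \<cdot> \<one> \<oplus> [(j - i)] \<cdot> \<one> = [j] \<cdot> \<one>"
        using ij by (simp add: add.nat_pow_mult)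
      then have z: "[(j - i)] \<cdot> \<one> = \<zero>"
      proof -
        have "\<ominus> ([i] \<cdot> \<one>) \<oplus> ([i] \<cdot> \<one> \<oplus> [(j - i)] \<cdot> \<one>) = \<ominus> ([i] \<cdot> \<one>) \<oplus> [i] \<cdot> \<one>"
          using \<open>[i] \<cdot> \<one> \<oplus> [(j - i)] \<cdot> \<one> = [j] \<cdot> \<one>\<close> eq by (simp only:)
        then show ?thesis by (simp only: r_neg1 l_neg add.nat_pow_closed one_closed)
      qed
      \<comment> \<open>Both \<open>j - i\<close> and \<open>p\<close> annihilate one; as they are
        coprime, Bezout would make one equal to zero.\<close>
      have "coprime (j - i) p" using ij prime_p
        by (metis coprime_commute diff_le_self diff_less_mono2 dvd_imp_le lessThan_iff less_imp_diff_less not_le prime_imp_coprime zero_less_diff)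
      then obtain x y where xy: "(j - i) * x = p * y + 1"
        using bezout_nat[of "j - i" p] ij by auto
      have "[((j - i) * x)] \<cdot> \<one> = \<zero>" using z add.nat_pow_pow[of \<one> x "j - i"] by (simp add: mult.commute)
      moreover have "[(p * y + 1)] \<cdot> \<one> = [(p * y)] \<cdot> \<one> \<oplus> \<one>" by simp
      moreover have "[(p * y)] \<cdot> \<one> = \<zero>" using char_p add.nat_pow_pow[of \<one> y p] by (simp add: mult.commute)
      ultimately show False using xy by simp
    qed
  qed
  have "card ((\<lambda>k. [(k::nat)] \<cdot> \<one>) ` {..<p}) \<le> card Fp"
    using multiples_in_Fp Fp_props by (intro card_mono) auto
  then show "p \<le> card Fp" using card_image[OF inj] by simp
qed

lemma card_Span:
  assumes L: "subfield L F" "finite L" and ind: "independent L Us"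
  shows "card (Span L Us) = card L ^ length Us"
proof -
  have c: "set Us \<subseteq> carrier F" using independent_in_carrier[OF ind] .
  let ?A = "{Ks. set Ks \<subseteq> L \<and> length Ks = length Us}"
  have im: "Span L Us = (\<lambda>Ks. combine Ks Us) ` ?A"
    using Span_eq_combine_set_length_version[OF L(1) c] by auto
  have "inj_on (\<lambda>Ks. combine Ks Us) ?A"
  proof (rule inj_onI)
    fix Ks Ls assume "Ks \<in> ?A" "Ls \<in> ?A" "combine Ks Us = combine Ls Us"
    moreover have "combine Ks Us \<in> Span L Us" using \<open>Ks \<in> ?A\<close> im by blast
    ultimately show "Ks = Ls" using unique_decomposition[OF L(1) ind, of "combine Ks Us"] by blast
  qed
  then show ?thesis unfolding im using card_lists_length_eq[OF L(2)] by (simp add: card_image)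
qed

lemma combine_pow_p:
  "set Ks \<subseteq> carrier F \<Longrightarrow> set Us \<subseteq> carrier F \<Longrightarrow>
    (combine Ks Us) [^] p = combine (map (\<lambda>x. x [^] p) Ks) (map (\<lambda>x. x [^] p) Us)"
  by (induction Ks Us rule: combine.induct) (auto simp: frob_add1 nat_pow_distrib nat_pow_zero)

lemma combine_pow_q:
  "set Ks \<subseteq> K \<Longrightarrow> set Us \<subseteq> carrier F \<Longrightarrow>
    (combine Ks Us) [^] q = combine Ks (map (\<lambda>x. x [^] q) Us)"
proof (induction Ks Us rule: combine.induct)
  case (1 k Ks u Us)
  have "set Ks \<subseteq> carrier F" "k \<in> carrier F" using 1(2) K_props by auto
  then show ?case using 1 K_pow_q[of k] by (simp add: frob_add nat_pow_distrib)
qed (auto simp: nat_pow_zero)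

lemma combine_minus_add:
  "set Ks \<subseteq> carrier F \<Longrightarrow> set Us \<subseteq> carrier F \<Longrightarrow> (\<And>u. u \<in> set Us \<Longrightarrow> f u \<in> carrier F) \<Longrightarrow>
    combine Ks (map (\<lambda>u. \<ominus> (f u \<oplus> u)) Us) = \<ominus> (combine Ks (map f Us) \<oplus> combine Ks Us)"
proof (induction Ks Us rule: combine.induct)
  case (1 k Ks u Us)
  have "combine Ks (map f Us) \<in> carrier F" "combine Ks Us \<in> carrier F"
    using 1 by (auto intro!: combine_in_carrier)
  then show ?case using 1 by (simp add: r_minus r_distr minus_add a_ac)
qed auto

text \<open>The \<open>q\<close>-th power leaves coefficients in \<open>K\<close> unchanged. After
  cancelling the original relation, a relation among \<open>p\<close>-th powers with the same,
  unraised coefficients remains.\<close>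

lemma combine_frob_G:
  assumes "set Ks \<subseteq> K" "set Us \<subseteq> G" "u \<in> G" "u = combine Ks Us"
  shows "u [^] p = combine Ks (map (\<lambda>x. x [^] p) Us)"
proof -
  have c: "set Ks \<subseteq> carrier F" "set Us \<subseteq> carrier F" "u \<in> carrier F" using assms K_props G_carrier by auto
  have f: "set (map (\<lambda>x. x [^] p) Us) \<subseteq> carrier F" using c by auto
  have "\<ominus> (u [^] p \<oplus> u) = combine Ks (map (\<lambda>x. x [^] q) Us)"
    using combine_pow_q[OF assms(1) c(2)] assms(3,4) G_pow_q by simp
  also have "map (\<lambda>x. x [^] q) Us = map (\<lambda>x. \<ominus> (x [^] p \<oplus> x)) Us"
    using assms(2) G_pow_q by auto
  also have "combine Ks \<dots> = \<ominus> (combine Ks (map (\<lambda>x. x [^] p) Us) \<oplus> u)"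
    unfolding assms(4) using c by (intro combine_minus_add) auto
  finally have "u [^] p \<oplus> u = combine Ks (map (\<lambda>x. x [^] p) Us) \<oplus> u"
    using c f combine_in_carrier[OF c(1) f] by (metis a_closed minus_minus nat_pow_closed)
  then show ?thesis using c f combine_in_carrier[OF c(1) f] by simp
qed

text \<open>Artin's argument: a relation over \<open>K\<close> among elements of \<open>G\<close> is transported to their \<open>p\<close>-th
  powers both by the \<open>K\<close>-linear map \<open>x \<mapsto> x [^] q\<close>, which is \<open>- x [^] p - x\<close> on \<open>G\<close>, and by the
  Frobenius map; comparing the two forces the coefficients into the prime field.\<close>

lemma independent_over_K:
  assumes "set Us \<subseteq> G" "independent Fp Us"
  shows "independent K Us"
  using assms
proof (induction "length Us" arbitrary: Us)
  case 0
  then show ?case by simp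
next
  case (Suc n)
  then obtain u Vs where Us: "Us = u # Vs" and n: "n = length Vs" by (cases Us) auto
  have uc: "u \<in> carrier F" "u \<in> G" "set Vs \<subseteq> G" using Suc.prems(1) Us G_carrier by auto
  have Vc: "set Vs \<subseteq> carrier F" using uc G_carrier by auto
  have indV: "independent Fp Vs" and uV: "u \<notin> Span Fp Vs"
    using Suc.prems(2) independent_backwards unfolding Us by blast+
  have "u \<notin> Span K Vs"
  proof
    assume "u \<in> Span K Vs"
    then obtain Ks where Ks: "set Ks \<subseteq> K" "length Ks = length Vs" "u = combine Ks Vs"
      using Span_mem_iff_length_version[OF subfield_K Vc] by blast
    let ?Ws = "map (\<lambda>x. x [^] p) Vs" and ?Ls = "map (\<lambda>x. x [^] p) Ks"
    have Wc: "set ?Ws \<subseteq> carrier F" "set ?Ws \<subseteq> G" using Vc uc G_frob by auto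
    \<comment> \<open>Frobenius is injective and fixes the coefficients in \<open>Fp\<close>, so the
      \<open>p\<close>-th powers stay independent. There is one vector fewer than in
      \<open>Us\<close>, so the induction hypothesis lifts this to independence over
      \<open>K\<close>.\<close>
    have "independent Fp ?Ws"
    proof (rule trivial_combine_imp_independent[OF subfield_Fp Wc(1)])
      fix Ls assume Ls: "set Ls \<subseteq> Fp" "combine Ls ?Ws = \<zero>"
      have "map (\<lambda>x. x [^] p) Ls = Ls" using Ls by (intro map_idI) (auto simp: Fp_def)
      moreover have Lc: "set Ls \<subseteq> carrier F" using Ls Fp_props by auto
      ultimately have "(combine Ls Vs) [^] p = \<zero>" using combine_pow_p[OF Lc Vc] Ls by simp
      then have "combine Ls Vs = \<zero>" using pow_p_eq_zero combine_in_carrier[OF Lc Vc] by blast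
      then show "set (take (length ?Ws) Ls) \<subseteq> {\<zero>}"
        using independent_imp_trivial_combine[OF subfield_Fp indV Ls(1)] by simp
    qed
    then have indW: "independent K ?Ws" using Suc.hyps(1)[of ?Ws] n Wc by simp
    have 1: "u [^] p = combine Ks ?Ws" using combine_frob_G[OF Ks(1) uc(3) uc(2) Ks(3)] .
    have Kc: "set Ks \<subseteq> carrier F" using Ks K_props by auto
    have 2: "u [^] p = combine ?Ls ?Ws" using combine_pow_p[OF Kc Vc] Ks(3) by simp
    have "u [^] p \<in> Span K ?Ws"
      using Span_mem_iff_length_version[OF subfield_K Wc(1)] 1 Ks by auto
    then have "\<exists>!Ks. set Ks \<subseteq> K \<and> length Ks = length ?Ws \<and> u [^] p = combine Ks ?Ws"
      using unique_decomposition[OF subfield_K indW] by simp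
    moreover have "set ?Ls \<subseteq> K" using Ks(1) K_pow_p by auto
    ultimately have "?Ls = Ks" using 1 2 Ks by (metis length_map)
    then have "x [^] p = x" if "x \<in> set Ks" for x
      using that by (metis in_set_conv_nth nth_map)
    then have "set Ks \<subseteq> Fp" using Ks(1) by (auto simp: Fp_def)
    then have "u \<in> Span Fp Vs" using Span_mem_iff_length_version[OF subfield_Fp Vc] Ks by blast
    with uV show False ..
  qed
  moreover have "independent K Vs" using Suc.hyps n uc indV by simp
  ultimately show ?case unfolding Us using uc by (intro li_Cons)
qed

lemma subgroup_G: "subgroup G (add_monoid F)"
  using G_carrier G_zero G_add G_minus by (intro add.subgroupI) (auto simp: a_inv_def)

text \<open>Both power maps in \<open>g\<close> are linear over \<open>Fp\<close>, so
  \<open>G\<close> is a vector space over it; its dimension n is read off from p^n = card G =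
  p^m.\<close>

lemma exists_basis_G: "\<exists>Us. set Us \<subseteq> G \<and> independent Fp Us \<and> Span Fp Us = G \<and> length Us = m"
proof -
  have sub: "subalgebra Fp G F"
  proof (intro subalgebra.intro subgroup_G subalgebra_axioms.intro)
    fix k a assume ka: "k \<in> Fp" "a \<in> G"
    then have c: "k \<in> carrier F" "a \<in> carrier F" using Fp_props G_carrier by auto
    have "k [^] p = k" "k [^] q = k" using ka Fp_props K_pow_q by (auto simp: Fp_def)
    then have "(k \<otimes> a) [^] q \<oplus> (k \<otimes> a) [^] p \<oplus> k \<otimes> a = k \<otimes> (a [^] q \<oplus> a [^] p \<oplus> a)"
      using c by (simp add: nat_pow_distrib r_distr)
    then show "k \<otimes> a \<in> G" using ka c by (simp add: G_iff)
  qed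
  obtain gs where gs: "set gs = G" using finite_list[OF G_carrier(2)] by blast
  have gsc: "set gs \<subseteq> carrier F" using gs G_carrier by simp
  have "Span Fp gs = G"
    using subalgebra_Span_incl[OF subfield_Fp sub] Span_base_incl[OF subfield_Fp gsc] gs by auto
  then obtain n where "dimension n Fp G"
    using Span_finite_dimension[OF subfield_Fp gsc] by (auto simp: finite_dimension_def)
  then obtain Us where Us: "set Us \<subseteq> carrier F" "independent Fp Us" "length Us = n" "Span Fp Us = G"
    using exists_base[OF subfield_Fp] by blast
  have "p ^ n = p ^ m" using card_Span[OF subfield_Fp _ Us(2)] Fp_props card_Fp card_G Us by simp
  then have "n = m" using p_ge_2 by simp
  then show ?thesis using Us Span_base_incl[OF subfield_Fp Us(1)] by auto
qed

text \<open>The \<open>K\<close>-span of \<open>G\<close>, taken as an intersection so that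
  \<open>V_minimal\<close> is immediate. Minimality is what the generated group and
  \<open>card_G_inter\<close> rest on; a basis enters only through \<open>V_Span\<close>.\<close>

definition V :: "'a set" where "V = \<Inter>{W. subalgebra K W F \<and> G \<subseteq> W}"

text \<open>A \<open>K\<close>-subspace that contains a prime-field basis of \<open>G\<close>
  contains \<open>G\<close>, so \<open>V\<close> is the span of that basis, which stays independent
  over \<open>K\<close>.\<close>

lemma V_Span: "\<exists>Us. independent K Us \<and> length Us = m \<and> set Us \<subseteq> carrier F \<and> V = Span K Us"
proof -
  obtain Us where Us: "set Us \<subseteq> G" "independent Fp Us" "Span Fp Us = G" "length Us = m"
    using exists_basis_G by blast
  have c: "set Us \<subseteq> carrier F" using Us G_carrier by auto
  have "G \<subseteq> W \<longleftrightarrow> set Us \<subseteq> W" if W: "subalgebra K W F" for W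
  proof
    assume *: "set Us \<subseteq> W"
    have "subalgebra Fp W F"
      using W Fp_props by (auto simp: subalgebra_def subalgebra_axioms_def)
    then show "G \<subseteq> W" using subalgebra_Span_incl[OF subfield_Fp _ *] Us by simp
  qed (use Us in auto)
  then have "V = Span K Us"
    unfolding V_def Span_subalgebra_minimal[OF subfield_K c] by (metis (no_types, lifting))
  then show ?thesis using independent_over_K[OF Us(1,2)] Us c by blast
qed

lemma subalgebra_V: "subalgebra K V F"
  using V_Span Span_is_subalgebra[OF subfield_K] by auto

lemma card_V: "card V = q ^ m"
  using V_Span card_Span[OF subfield_K K_props(4)] card_K by auto

lemma V_props:
  "V \<subseteq> carrier F" "\<zero> \<in> V" "finite V" "G \<subseteq> V"
  "\<And>x y. x \<in> V \<Longrightarrow> y \<in> V \<Longrightarrow> x \<oplus> y \<in> V" "\<And>x. x \<in> V \<Longrightarrow> \<ominus> x \<in> V"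
  "\<And>k x. k \<in> K \<Longrightarrow> x \<in> V \<Longrightarrow> k \<otimes> x \<in> V"
proof -
  interpret V: subalgebra K V F by (rule subalgebra_V)
  show "V \<subseteq> carrier F" "\<zero> \<in> V" "\<And>x y. x \<in> V \<Longrightarrow> y \<in> V \<Longrightarrow> x \<oplus> y \<in> V"
    using V.subset V.one_closed V.m_closed by auto
  show "\<And>x. x \<in> V \<Longrightarrow> \<ominus> x \<in> V" using V.m_inv_closed by (simp add: a_inv_def)
  show "finite V" using finite_subset[OF \<open>V \<subseteq> carrier F\<close> finite_carrier] .
  show "G \<subseteq> V" by (auto simp: V_def)
  show "\<And>k x. k \<in> K \<Longrightarrow> x \<in> V \<Longrightarrow> k \<otimes> x \<in> V" using V.smult_closed by blast
qed

lemma V_minimal: "subalgebra K W F \<Longrightarrow> G \<subseteq> W \<Longrightarrow> V \<subseteq> W"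
  unfolding V_def by blast

section \<open>Averaging over random lines\<close>

definition ip :: "('a \<Rightarrow> real) \<Rightarrow> ('a \<Rightarrow> real) \<Rightarrow> real" where
  "ip Y Z = (\<Sum>v\<in>V. Y v * Z v)"

text \<open>The average runs over all of \<open>K\<close>, zero included, so that it is an average
  over cosets of the subgroup K a and hence a projection. The coset graph provides only the elements
  of \<open>H\<close>; the difference is settled in \<open>quadratic_form_bound\<close>.\<close>

definition line_avg :: "'a \<Rightarrow> ('a \<Rightarrow> real) \<Rightarrow> 'a \<Rightarrow> real" where
  "line_avg a Y v = (\<Sum>h\<in>K. Y (v \<oplus> h \<otimes> a)) / real q"

definition walk :: "('a \<Rightarrow> real) \<Rightarrow> 'a \<Rightarrow> real" where
  "walk Y v = (\<Sum>a\<in>G. line_avg a Y v) / real q"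

lemma ip_commute: "ip Y Z = ip Z Y"
  by (simp add: ip_def mult.commute)

lemma ip_cong: "(\<And>v. v \<in> V \<Longrightarrow> Y v = Y' v) \<Longrightarrow> (\<And>v. v \<in> V \<Longrightarrow> Z v = Z' v) \<Longrightarrow> ip Y Z = ip Y' Z'"
  unfolding ip_def by (intro sum.cong) auto

lemma ip_nonneg: "ip Y Y \<ge> 0"
  unfolding ip_def by (intro sum_nonneg) simp

lemma sum_translate_V:
  assumes u: "u \<in> V" shows "(\<Sum>v\<in>V. f (v \<oplus> u)) = (\<Sum>v\<in>V. f v)"
proof (rule sum.reindex_bij_betw)
  have uc: "u \<in> carrier F" using u V_props by auto
  show "bij_betw (\<lambda>v. v \<oplus> u) V V"
  proof (rule bij_betw_byWitness[where f' = "\<lambda>v. v \<oplus> \<ominus> u"])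
    show "\<forall>v\<in>V. v \<oplus> u \<oplus> \<ominus> u = v" "\<forall>v\<in>V. v \<oplus> \<ominus> u \<oplus> u = v"
      using V_props(1) uc by (auto simp: a_assoc r_neg l_neg subset_iff)
    show "(\<lambda>v. v \<oplus> u) ` V \<subseteq> V" "(\<lambda>v. v \<oplus> \<ominus> u) ` V \<subseteq> V" using V_props(5,6) u by auto
  qed
qed

lemma sum_translate_K:
  assumes u: "u \<in> K" shows "(\<Sum>h\<in>K. f (h \<oplus> u)) = (\<Sum>h\<in>K. f h)"
proof (rule sum.reindex_bij_betw)
  have uc: "u \<in> carrier F" using u K_props by auto
  show "bij_betw (\<lambda>v. v \<oplus> u) K K"
  proof (rule bij_betw_byWitness[where f' = "\<lambda>v. v \<oplus> \<ominus> u"])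
    show "\<forall>v\<in>K. v \<oplus> u \<oplus> \<ominus> u = v" "\<forall>v\<in>K. v \<oplus> \<ominus> u \<oplus> u = v"
      using K_props(1) uc by (auto simp: a_assoc r_neg l_neg subset_iff)
    show "(\<lambda>v. v \<oplus> u) ` K \<subseteq> K" "(\<lambda>v. v \<oplus> \<ominus> u) ` K \<subseteq> K" using K_props(6,7) u by auto
  qed
qed

lemma sum_uminus_K: "(\<Sum>h\<in>K. f (\<ominus> h)) = (\<Sum>h\<in>K. f h)"
proof (rule sum.reindex_bij_betw)
  show "bij_betw (\<lambda>v. \<ominus> v) K K"
    by (rule bij_betw_byWitness[where f' = "\<lambda>v. \<ominus> v"]) (use K_props(1,7) in auto)
qed

text \<open>The adjoint of translation by h a is translation by - h a, and negation permutes
  \<open>K\<close>.\<close>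

lemma line_avg_self_adjoint:
  assumes a: "a \<in> V" shows "ip (line_avg a Y) Z = ip Y (line_avg a Z)"
proof -
  have ac: "a \<in> carrier F" using a V_props by auto
  have "(\<Sum>v\<in>V. Y (v \<oplus> h \<otimes> a) * Z v) = (\<Sum>v\<in>V. Y v * Z (v \<oplus> \<ominus> h \<otimes> a))" if h: "h \<in> K" for h
  proof -
    have hc: "h \<in> carrier F" using h K_props by auto
    have ha: "h \<otimes> a \<in> V" using V_props(7) h a by blast
    have "(\<Sum>v\<in>V. Y v * Z (v \<oplus> \<ominus> h \<otimes> a)) = (\<Sum>v\<in>V. Y (v \<oplus> h \<otimes> a) * Z ((v \<oplus> h \<otimes> a) \<oplus> \<ominus> h \<otimes> a))"
      using sum_translate_V[OF ha, of "\<lambda>v. Y v * Z (v \<oplus> \<ominus> h \<otimes> a)"] by simp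
    also have "\<dots> = (\<Sum>v\<in>V. Y (v \<oplus> h \<otimes> a) * Z v)"
    proof (rule sum.cong[OF refl])
      fix v assume "v \<in> V"
      then have "v \<in> carrier F" using V_props by auto
      then have "(v \<oplus> h \<otimes> a) \<oplus> \<ominus> h \<otimes> a = v" using ac hc by (simp add: a_assoc l_minus r_neg)
      then show "Y (v \<oplus> h \<otimes> a) * Z ((v \<oplus> h \<otimes> a) \<oplus> \<ominus> h \<otimes> a) = Y (v \<oplus> h \<otimes> a) * Z v" by simp
    qed
    finally show ?thesis ..
  qed
  then have "(\<Sum>h\<in>K. \<Sum>v\<in>V. Y (v \<oplus> h \<otimes> a) * Z v) = (\<Sum>h\<in>K. \<Sum>v\<in>V. Y v * Z (v \<oplus> \<ominus> h \<otimes> a))"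
    by (rule sum.cong[OF refl])
  also have "\<dots> = (\<Sum>h\<in>K. \<Sum>v\<in>V. Y v * Z (v \<oplus> h \<otimes> a))"
    by (rule sum_uminus_K[of "\<lambda>h. \<Sum>v\<in>V. Y v * Z (v \<oplus> h \<otimes> a)"])
  finally have *: "(\<Sum>h\<in>K. \<Sum>v\<in>V. Y (v \<oplus> h \<otimes> a) * Z v) = (\<Sum>h\<in>K. \<Sum>v\<in>V. Y v * Z (v \<oplus> h \<otimes> a))" .
  have "ip (line_avg a Y) Z = (\<Sum>h\<in>K. \<Sum>v\<in>V. Y (v \<oplus> h \<otimes> a) * Z v) / real q"
    unfolding ip_def line_avg_def times_divide_eq_left sum_divide_distrib[symmetric] sum_distrib_right
    by (subst sum.swap) (rule refl)
  moreover have "ip Y (line_avg a Z) = (\<Sum>h\<in>K. \<Sum>v\<in>V. Y v * Z (v \<oplus> h \<otimes> a)) / real q"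
    unfolding ip_def line_avg_def times_divide_eq_right sum_divide_distrib[symmetric] sum_distrib_left
    by (subst sum.swap) (rule refl)
  ultimately show ?thesis using * by simp
qed

lemma line_avg_idem:
  assumes a: "a \<in> V" and v: "v \<in> V" shows "line_avg a (line_avg a Y) v = line_avg a Y v"
proof -
  have c: "a \<in> carrier F" "v \<in> carrier F" using a v V_props by auto
  have "(\<Sum>k\<in>K. Y (v \<oplus> h \<otimes> a \<oplus> k \<otimes> a)) = (\<Sum>k\<in>K. Y (v \<oplus> k \<otimes> a))" if h: "h \<in> K" for h
  proof -
    have "(\<Sum>k\<in>K. Y (v \<oplus> h \<otimes> a \<oplus> k \<otimes> a)) = (\<Sum>k\<in>K. Y (v \<oplus> (k \<oplus> h) \<otimes> a))"
    proof (rule sum.cong[OF refl])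
      fix k assume "k \<in> K"
      then have "k \<in> carrier F" "h \<in> carrier F" using h K_props by auto
      then show "Y (v \<oplus> h \<otimes> a \<oplus> k \<otimes> a) = Y (v \<oplus> (k \<oplus> h) \<otimes> a)"
        using c by (simp add: l_distr a_ac)
    qed
    then show ?thesis using sum_translate_K[OF h, of "\<lambda>k. Y (v \<oplus> k \<otimes> a)"] by simp
  qed
  then show ?thesis using card_K by (simp add: line_avg_def)
qed

lemma line_avg_commute:
  assumes a: "a \<in> V" "b \<in> V" and v: "v \<in> V"
  shows "line_avg a (line_avg b Y) v = line_avg b (line_avg a Y) v"
proof -
  have c: "a \<in> carrier F" "b \<in> carrier F" "v \<in> carrier F" using a v V_props by auto
  have "Y (v \<oplus> h \<otimes> a \<oplus> k \<otimes> b) = Y (v \<oplus> k \<otimes> b \<oplus> h \<otimes> a)" if "h \<in> K" "k \<in> K" for h k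
  proof -
    have "h \<in> carrier F" "k \<in> carrier F" using that K_props by auto
    then show ?thesis using c by (simp add: a_ac)
  qed
  then have "(\<Sum>h\<in>K. \<Sum>k\<in>K. Y (v \<oplus> h \<otimes> a \<oplus> k \<otimes> b)) = (\<Sum>h\<in>K. \<Sum>k\<in>K. Y (v \<oplus> k \<otimes> b \<oplus> h \<otimes> a))"
    by simp
  also have "\<dots> = (\<Sum>k\<in>K. \<Sum>h\<in>K. Y (v \<oplus> k \<otimes> b \<oplus> h \<otimes> a))" by (rule sum.swap)
  finally show ?thesis by (simp add: line_avg_def sum_divide_distrib[symmetric])
qed

lemma line_avg_closed: "v \<in> V \<Longrightarrow> a \<in> V \<Longrightarrow> h \<in> K \<Longrightarrow> v \<oplus> h \<otimes> a \<in> V"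
  using V_props(5,7) by blast

lemma ip_walk: "ip (walk Y) Z = (\<Sum>a\<in>G. ip (line_avg a Y) Z) / real q"
  unfolding ip_def walk_def
  by (simp add: sum_distrib_right sum_divide_distrib sum.swap[of _ V G])

lemma line_avg_walk:
  assumes a: "a \<in> V" and v: "v \<in> V" shows "line_avg a (walk Y) v = walk (line_avg a Y) v"
proof -
  have "line_avg a (walk Y) v = (\<Sum>b\<in>G. line_avg a (line_avg b Y) v) / real q"
    unfolding line_avg_def[of a] walk_def
    by (simp add: sum_divide_distrib[symmetric] sum.swap[of _ K G])
  also have "(\<Sum>b\<in>G. line_avg a (line_avg b Y) v) = (\<Sum>b\<in>G. line_avg b (line_avg a Y) v)"
    using a v V_props(4) by (intro sum.cong line_avg_commute) auto
  also have "\<dots> / real q = walk (line_avg a Y) v" by (rule walk_def[symmetric])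
  finally show ?thesis .
qed

text \<open>By minimality of \<open>V\<close> the intersection is a proper subgroup of the
  \<open>p\<close>-group \<open>G\<close>, so its order is a power of \<open>p\<close> strictly
  below \<open>q\<close>.\<close>

lemma card_G_inter:
  assumes W: "subalgebra K W F" and proper: "\<not> V \<subseteq> W"
  shows "p * card (G \<inter> W) \<le> q"
proof -
  interpret W: subalgebra K W F by (rule W)
  have sub: "subgroup (G \<inter> W) (add_monoid F)"
    using add.subgroups_Inter_pair[OF subgroup_G W.subgroup_axioms] .
  have grp: "group ((add_monoid F)\<lparr>carrier := G\<rparr>)"
    using subgroup.subgroup_is_group[OF subgroup_G add.is_group] .
  have "subgroup (G \<inter> W) ((add_monoid F)\<lparr>carrier := G\<rparr>)"
    using add.subgroup_incl[OF sub subgroup_G] by auto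
  from group.lagrange[OF grp this] have "card (G \<inter> W) dvd p ^ m"
    using card_G by (metis Coset.order_def dvd_triv_right partial_object.select_convs(1) partial_object.update_convs(1) partial_object.surjective)
  then obtain i where i: "i \<le> m" "card (G \<inter> W) = p ^ i"
    using divides_primepow_nat[OF prime_p] by blast
  have "\<not> G \<subseteq> W" using V_minimal[OF W] proper by blast
  then have "card (G \<inter> W) < card G" using G_carrier(2) by (intro psubset_card_mono) auto
  then have "i < m" using i card_G p_ge_2 by auto
  then have "p ^ Suc i \<le> p ^ m" using p_ge_2 by (intro power_increasing) auto
  then show ?thesis using i by simp
qed

lemma line_extension_subalgebra:
  assumes W: "subalgebra K W F" and a: "a \<in> carrier F" "a \<notin> W"
  shows "subalgebra K (line_extension K a W) F" "card (line_extension K a W) = q * card W"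
proof -
  interpret W: subalgebra K W F by (rule W)
  have Wc: "W \<subseteq> carrier F" using W.subset by simp
  have sg: "subgroup (line_extension K a W) (add_monoid F)"
    using line_extension_is_subgroup[OF subfield_K W.subgroup_axioms a(1)] .
  show "subalgebra K (line_extension K a W) F"
    using line_extension_smult_closed[OF subfield_K W.smult_closed Wc a(1)] sg
    by (auto simp: subalgebra_def subalgebra_axioms_def)
  have im: "line_extension K a W = (\<lambda>(k, w). k \<otimes> a \<oplus> w) ` (K \<times> W)"
  proof (rule Set.set_eqI)
    show "x \<in> line_extension K a W \<longleftrightarrow> x \<in> (\<lambda>(k, w). k \<otimes> a \<oplus> w) ` (K \<times> W)" for x
      unfolding line_extension_mem_iff by force
  qed
  have "inj_on (\<lambda>(k, w). k \<otimes> a \<oplus> w) (K \<times> W)"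
  proof (rule inj_onI, clarify)
    fix k w k' w' assume *: "k \<in> K" "w \<in> W" "k' \<in> K" "w' \<in> W" "k \<otimes> a \<oplus> w = k' \<otimes> a \<oplus> w'"
    have c: "k \<in> carrier F" "k' \<in> carrier F" "w \<in> carrier F" "w' \<in> carrier F" using * K_props(1) Wc by auto
    have "(k \<ominus> k') \<otimes> a = w' \<ominus> w"
    proof -
      have "(k \<ominus> k') \<otimes> a = (k \<otimes> a \<oplus> w) \<oplus> (\<ominus> (k' \<otimes> a) \<oplus> \<ominus> w)"
        using c a by (simp add: minus_eq l_distr l_minus a_ac r_neg1 r_neg2 r_neg)
      also have "\<dots> = w' \<ominus> w" unfolding *(5)
        using c a by (simp add: minus_eq a_ac r_neg1 r_neg2 r_neg)
      finally show ?thesis .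
    qed
    moreover have "w' \<ominus> w \<in> W" using * W.m_closed W.m_inv_closed by (simp add: minus_eq a_inv_def)
    ultimately have d: "(k \<ominus> k') \<otimes> a \<in> W" by simp
    have kk: "k \<ominus> k' \<in> K" using * K_props(6,7) by (simp add: minus_eq)
    have "k \<ominus> k' = \<zero>"
    proof (rule ccontr)
      assume "k \<ominus> k' \<noteq> \<zero>"
      then have kH: "k \<ominus> k' \<in> H" using kk by (simp add: H_set_def)
      have "inv (k \<ominus> k') \<otimes> ((k \<ominus> k') \<otimes> a) \<in> W"
        using d W.smult_closed H_props(7,8)[OF kH] H_props(8) H_props(7) kH by blast
      then have "a \<in> W" using H_inv[OF kH] a by (simp flip: m_assoc)
      then show False using a by simp
    qed
    then have "k = k'" using c by simp
    then show "k = k' \<and> w = w'" using *(5) c a by simp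
  qed
  then show "card (line_extension K a W) = q * card W"
    unfolding im by (simp add: card_image card_cartesian_product card_K)
qed

lemma sum_line_avg:
  assumes "a \<in> V" shows "(\<Sum>v\<in>V. line_avg a Y v) = (\<Sum>v\<in>V. Y v)"
proof -
  have "ip (line_avg a Y) (\<lambda>_. 1) = ip Y (line_avg a (\<lambda>_. 1))"
    by (rule line_avg_self_adjoint[OF assms])
  then show ?thesis using card_K p_ge_2 by (simp add: ip_def line_avg_def)
qed

text \<open>The part k a of the translation is absorbed by shifting the summation index in
  \<open>K\<close>, the part in \<open>W\<close> by the invariance of \<open>Y\<close>.\<close>

lemma line_avg_invariant:
  assumes W: "subalgebra K W F" "W \<subseteq> V" and inv: "\<And>v w. v \<in> V \<Longrightarrow> w \<in> W \<Longrightarrow> Y (v \<oplus> w) = Y v"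
    and a: "a \<in> V" and v: "v \<in> V" and u: "u \<in> line_extension K a W"
  shows "line_avg a Y (v \<oplus> u) = line_avg a Y v"
proof -
  obtain k w where kw: "k \<in> K" "w \<in> W" "u = k \<otimes> a \<oplus> w" using u by (auto simp: line_extension_mem_iff)
  have c: "v \<in> carrier F" "a \<in> carrier F" "k \<in> carrier F" "w \<in> carrier F" using kw W a v V_props K_props by auto
  have "(\<Sum>h\<in>K. Y (v \<oplus> u \<oplus> h \<otimes> a)) = (\<Sum>h\<in>K. Y (v \<oplus> (h \<oplus> k) \<otimes> a))"
  proof (rule sum.cong[OF refl])
    fix h assume h: "h \<in> K"
    have hc: "h \<in> carrier F" using h K_props by auto
    have "v \<oplus> u \<oplus> h \<otimes> a = (v \<oplus> (h \<oplus> k) \<otimes> a) \<oplus> w" using c hc kw(3) by (simp add: l_distr a_ac)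
    moreover have "v \<oplus> (h \<oplus> k) \<otimes> a \<in> V" using line_avg_closed[OF v a] K_props(6) h kw by blast
    ultimately show "Y (v \<oplus> u \<oplus> h \<otimes> a) = Y (v \<oplus> (h \<oplus> k) \<otimes> a)" using inv kw by simp
  qed
  then show ?thesis using sum_translate_K[OF kw(1), of "\<lambda>h. Y (v \<oplus> h \<otimes> a)"] by (simp add: line_avg_def)
qed

text \<open>Each \<open>line_avg a\<close> is an orthogonal projection, and all of them commute. On a function that is
  already invariant under \<open>W\<close>, the projections with \<open>a \<in> W\<close> act trivially but are few, and the other
  ones produce a function invariant under a larger subspace.\<close>

lemma walk_contraction_aux:
  assumes "subalgebra K W F" "W \<subseteq> V" "\<And>v w. v \<in> V \<Longrightarrow> w \<in> W \<Longrightarrow> Y (v \<oplus> w) = Y v"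
    and "(\<Sum>v\<in>V. Y v) = 0" and "card V \<le> q ^ j * card W"
  shows "ip (walk Y) Y \<le> real j / real p * ip Y Y"
  using assms
proof (induction j arbitrary: W Y)
  \<comment> \<open>Settles every case in which \<open>W\<close> is all of \<open>V\<close>: an
    invariant function is constant, and with sum zero it vanishes.\<close>
  have const: "ip (walk Y) Y = 0 \<and> ip Y Y = 0"
    if Y: "\<And>v w. v \<in> V \<Longrightarrow> w \<in> V \<Longrightarrow> Y (v \<oplus> w) = Y v" "(\<Sum>v\<in>V. Y v) = 0" for Y
  proof -
    have "Y v = Y \<zero>" if "v \<in> V" for v
      using Y(1)[OF V_props(2) that] that V_props(1) by (auto simp: subset_iff)
    then have "(\<Sum>v\<in>V. Y v) = real (card V) * Y \<zero>" by simp
    moreover have "card V > 0" using V_props(2,3) by (auto simp: card_gt_0_iff)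
    ultimately have "Y \<zero> = 0" using Y(2) by simp
    then show ?thesis using \<open>\<And>v. v \<in> V \<Longrightarrow> Y v = Y \<zero>\<close> by (simp add: ip_def)
  qed
  {
    case (0 W Y)
    have "W = V" using 0 V_props(3) by (intro card_subset_eq) (auto simp: card_mono antisym)
    then show ?case using const[of Y] 0 by simp
  next
    case (Suc j W Y)
    show ?case
    proof (cases "V \<subseteq> W")
      case True
      then have "W = V" using Suc.prems by auto
      then show ?thesis using const[of Y] Suc.prems by simp
    next
      case False
      define x where "x = ip (walk Y) Y"
      have GV: "a \<in> V" if "a \<in> G" for a using that V_props by auto
      have sq: "ip (line_avg a Y) Y = ip (line_avg a Y) (line_avg a Y)" if "a \<in> G" for a
      proof -
        have "ip (line_avg a (line_avg a Y)) Y = ip (line_avg a Y) Y"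
          using line_avg_idem[OF GV[OF that]] by (intro ip_cong) auto
        then show ?thesis using line_avg_self_adjoint[OF GV[OF that], of "line_avg a Y" Y] by simp
      qed
      have x: "x = (\<Sum>a\<in>G. ip (line_avg a Y) (line_avg a Y)) / real q"
        unfolding x_def ip_walk using sq by simp
      have x0: "x \<ge> 0" unfolding x by (intro divide_nonneg_nonneg sum_nonneg ip_nonneg) auto
      \<comment> \<open>\<open>line_avg a\<close> is a self-adjoint idempotent commuting with
        \<open>walk\<close>, so it can be put on both sides of the inner product.\<close>
      have swap: "ip (line_avg a Y) (walk Y) = ip (walk (line_avg a Y)) (line_avg a Y)" if a: "a \<in> G" for a
      proof -
        have "ip (line_avg a Y) (walk Y) = ip (line_avg a (line_avg a Y)) (walk Y)"
          using line_avg_idem[OF GV[OF a]] by (intro ip_cong) auto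
        also have "\<dots> = ip (line_avg a Y) (line_avg a (walk Y))" by (rule line_avg_self_adjoint[OF GV[OF a]])
        also have "\<dots> = ip (line_avg a Y) (walk (line_avg a Y))"
          using line_avg_walk[OF GV[OF a]] by (intro ip_cong) auto
        finally show ?thesis by (simp add: ip_commute)
      qed
      have in_W: "ip (line_avg a Y) (walk Y) = x" if a: "a \<in> G \<inter> W" for a
      proof -
        have "line_avg a Y v = Y v" if v: "v \<in> V" for v
        proof -
          have "Y (v \<oplus> h \<otimes> a) = Y v" if "h \<in> K" for h
            using Suc.prems(3)[OF v] subalgebra.smult_closed[OF Suc.prems(1)] that a by auto
          then show ?thesis using card_K p_ge_2 by (simp add: line_avg_def)
        qed
        then have "ip (line_avg a Y) (walk Y) = ip Y (walk Y)" by (intro ip_cong) auto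
        then show ?thesis by (simp add: x_def ip_commute)
      qed
      \<comment> \<open>\<open>line_avg a Y\<close> is invariant under K a + W, which has
        \<open>q\<close> times as many elements as \<open>W\<close>, so the induction hypothesis for
        \<open>j\<close> applies to it.\<close>
      have not_W: "ip (line_avg a Y) (walk Y) \<le> real j / real p * ip (line_avg a Y) (line_avg a Y)"
        if a: "a \<in> G - W" for a
      proof -
        have aV: "a \<in> V" and ac: "a \<in> carrier F" using a GV V_props by auto
        have ext: "subalgebra K (line_extension K a W) F" "card (line_extension K a W) = q * card W"
          using line_extension_subalgebra[OF Suc.prems(1) ac] a by auto
        have "line_extension K a W \<subseteq> V"
          using Suc.prems(2) aV by (auto simp: line_extension_mem_iff intro!: V_props(5,7))
        moreover have "card V \<le> q ^ j * card (line_extension K a W)"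
          using Suc.prems(5) ext by (simp add: mult_ac)
        ultimately show ?thesis unfolding swap[OF DiffD1[OF a]]
          using line_avg_invariant[OF Suc.prems(1,2,3) aV] sum_line_avg[OF aV, of Y] Suc.prems(4)
          by (intro Suc.IH[OF ext(1)]) auto
      qed
      \<comment> \<open>Instead of \<open>x\<close> itself, the squared norm of
        \<open>walk Y\<close> is split over \<open>G\<close>. The elements in \<open>W\<close>
        contribute \<open>x\<close> each and make up at most 1 / p of \<open>G\<close>; all others
        together contribute at most j / p times \<open>x\<close> to the average.\<close>
      have "ip (walk Y) (walk Y) = (\<Sum>a\<in>G. ip (line_avg a Y) (walk Y)) / real q" by (rule ip_walk)
      also have "(\<Sum>a\<in>G. ip (line_avg a Y) (walk Y)) =
          (\<Sum>a\<in>G \<inter> W. ip (line_avg a Y) (walk Y)) + (\<Sum>a\<in>G - W. ip (line_avg a Y) (walk Y))"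
        using G_carrier(2) by (intro sum.Int_Diff)
      also have "\<dots> \<le> real (card (G \<inter> W)) * x + real j / real p * (\<Sum>a\<in>G. ip (line_avg a Y) (line_avg a Y))"
      proof (intro add_mono)
        show "(\<Sum>a\<in>G \<inter> W. ip (line_avg a Y) (walk Y)) \<le> real (card (G \<inter> W)) * x"
          using in_W by simp
        have "(\<Sum>a\<in>G - W. ip (line_avg a Y) (walk Y)) \<le>
            (\<Sum>a\<in>G - W. real j / real p * ip (line_avg a Y) (line_avg a Y))"
          by (intro sum_mono not_W)
        also have "\<dots> \<le> (\<Sum>a\<in>G. real j / real p * ip (line_avg a Y) (line_avg a Y))"
          using G_carrier(2) ip_nonneg by (intro sum_mono2) auto
        finally show "(\<Sum>a\<in>G - W. ip (line_avg a Y) (walk Y)) \<le>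
            real j / real p * (\<Sum>a\<in>G. ip (line_avg a Y) (line_avg a Y))"
          by (simp add: sum_distrib_left)
      qed
      also have "\<dots> / real q = (real (card (G \<inter> W)) / real q + real j / real p) * x"
        unfolding x using p_ge_2 by (simp add: field_simps)
      also have "\<dots> \<le> (1 / real p + real j / real p) * x"
      proof -
        have "real p * real (card (G \<inter> W)) \<le> real q"
          using card_G_inter[OF Suc.prems(1) False] by (metis of_nat_le_iff of_nat_mult)
        then have "real (card (G \<inter> W)) / real q \<le> 1 / real p" using p_ge_2 by (simp add: field_simps)
        then show ?thesis using x0 by (intro mult_right_mono) auto
      qed
      also have "1 / real p + real j / real p = real (Suc j) / real p" by (simp add: add_divide_distrib)
      finally have ww: "ip (walk Y) (walk Y) \<le> real (Suc j) / real p * x" using p_ge_2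
        by (simp add: divide_right_mono)
      \<comment> \<open>Cauchy--Schwarz converts the bound on the squared norm of
        \<open>walk Y\<close>, which is (j + 1) / p times \<open>x\<close>, into a bound on
        \<open>x\<close>, once a factor \<open>x\<close> is cancelled.\<close>
      have "x\<^sup>2 \<le> ip (walk Y) (walk Y) * ip Y Y"
        unfolding x_def ip_def using Cauchy_Schwarz_ineq_sum[of "walk Y" Y V] by (simp add: power2_eq_square)
      also have "\<dots> \<le> (real (Suc j) / real p * x) * ip Y Y"
        using ww ip_nonneg by (intro mult_right_mono) auto
      finally have "x * x \<le> x * (real (Suc j) / real p * ip Y Y)" by (simp add: power2_eq_square mult_ac)
      then have "x \<le> real (Suc j) / real p * ip Y Y" if "x \<noteq> 0"
        using that x0 by (simp only: mult_le_cancel_left)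
      moreover have "0 \<le> real (Suc j) / real p * ip Y Y"
        using ip_nonneg[of Y] by (intro mult_nonneg_nonneg) auto
      ultimately show ?thesis unfolding x_def[symmetric] by (cases "x = 0") auto
    qed
  }
qed

text \<open>The contraction is started at the zero subspace, where invariance is automatic and the
  codimension is m. Passing from \<open>K\<close> to \<open>H\<close> drops the summand h = 0, which
  is a sum of squares and so only helps.\<close>

theorem quadratic_form_bound:
  assumes "(\<Sum>v\<in>V. Y v) = 0"
  shows "(\<Sum>h\<in>H. \<Sum>v\<in>V. \<Sum>a\<in>G. Y v * Y (v \<oplus> h \<otimes> a)) \<le> real m / real p * (real q)\<^sup>2 * (\<Sum>v\<in>V. (Y v)\<^sup>2)"
proof -
  have sub: "subalgebra K {\<zero>} F"
    using K_props(1) add.triv_subgroup by (auto simp: subalgebra_def subalgebra_axioms_def)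
  have "ip (walk Y) Y \<le> real m / real p * ip Y Y"
    using assms V_props(1,2) card_V
    by (intro walk_contraction_aux[OF sub]) (auto simp: subset_iff)
  moreover have "(real q)\<^sup>2 * ip (walk Y) Y = (\<Sum>h\<in>K. \<Sum>v\<in>V. \<Sum>a\<in>G. Y v * Y (v \<oplus> h \<otimes> a))"
  proof -
    define Q where "Q = real q"
    have Q: "Q \<noteq> 0" using p_ge_2 by (simp add: Q_def)
    have "Q\<^sup>2 * ip (walk Y) Y = (\<Sum>v\<in>V. Y v * (\<Sum>a\<in>G. \<Sum>h\<in>K. Y (v \<oplus> h \<otimes> a)))"
      unfolding ip_def walk_def line_avg_def Q_def[symmetric] sum_divide_distrib[symmetric] sum_distrib_left
      using Q by (intro sum.cong) (auto simp: power2_eq_square sum_distrib_left[symmetric])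
    also have "\<dots> = (\<Sum>v\<in>V. \<Sum>h\<in>K. \<Sum>a\<in>G. Y v * Y (v \<oplus> h \<otimes> a))"
      by (simp add: sum_distrib_left sum.swap[of _ G K])
    finally show ?thesis by (simp add: sum.swap[of _ V K] Q_def)
  qed
  moreover have "(\<Sum>h\<in>K. \<Sum>v\<in>V. \<Sum>a\<in>G. Y v * Y (v \<oplus> h \<otimes> a)) =
      (\<Sum>v\<in>V. \<Sum>a\<in>G. Y v * Y (v \<oplus> \<zero> \<otimes> a)) + (\<Sum>h\<in>H. \<Sum>v\<in>V. \<Sum>a\<in>G. Y v * Y (v \<oplus> h \<otimes> a))"
    using K_props(2,4) unfolding H_set_def by (subst sum.remove[of K \<zero>]) auto
  moreover have "(\<Sum>v\<in>V. \<Sum>a\<in>G. Y v * Y (v \<oplus> \<zero> \<otimes> a)) \<ge> 0"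
  proof (intro sum_nonneg)
    fix v a assume "v \<in> V" "a \<in> G"
    then have "v \<in> carrier F" "a \<in> carrier F" using V_props G_carrier by auto
    then show "0 \<le> Y v * Y (v \<oplus> \<zero> \<otimes> a)" by simp
  qed
  ultimately have "(\<Sum>h\<in>H. \<Sum>v\<in>V. \<Sum>a\<in>G. Y v * Y (v \<oplus> h \<otimes> a)) \<le> (real q)\<^sup>2 * ip (walk Y) Y" by linarith
  also have "\<dots> \<le> (real q)\<^sup>2 * (real m / real p * ip Y Y)"
    using \<open>ip (walk Y) Y \<le> _\<close> by (intro mult_left_mono) auto
  finally show ?thesis by (simp add: ip_def power2_eq_square mult_ac)
qed

section \<open>The affine group\<close>

definition aff :: "'a \<Rightarrow> 'a \<Rightarrow> 'a \<Rightarrow> 'a" where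
  "aff a b = (\<lambda>x\<in>carrier F. a \<otimes> x \<oplus> b)"

abbreviation "AGL \<equiv> AGL1 F"
abbreviation "A \<equiv> A_group F m p K"

lemma field_inv: assumes "a \<in> carrier F" "a \<noteq> \<zero>"
  shows "inv a \<in> carrier F" "inv a \<noteq> \<zero>" "a \<otimes> inv a = \<one>" "inv a \<otimes> a = \<one>"
proof -
  have u: "a \<in> Units F" using assms field_Units by simp
  then show "inv a \<in> carrier F" "a \<otimes> inv a = \<one>" "inv a \<otimes> a = \<one>" by simp_all
  then show "inv a \<noteq> \<zero>" using assms by auto
qed

lemma aff_Bij: assumes "a \<in> carrier F" "a \<noteq> \<zero>" "b \<in> carrier F" shows "aff a b \<in> Bij (carrier F)"
proof -
  note i = field_inv[OF assms(1,2)]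
  have "bij_betw (aff a b) (carrier F) (carrier F)"
  proof (rule bij_betw_byWitness[where f' = "\<lambda>y. inv a \<otimes> (y \<oplus> \<ominus> b)"])
    show "\<forall>x\<in>carrier F. inv a \<otimes> (aff a b x \<oplus> \<ominus> b) = x"
    proof
      fix x assume x: "x \<in> carrier F"
      then have "aff a b x \<oplus> \<ominus> b = a \<otimes> x" using assms by (simp add: aff_def a_assoc r_neg)
      then show "inv a \<otimes> (aff a b x \<oplus> \<ominus> b) = x" using assms i x by (simp flip: m_assoc)
    qed
    show "\<forall>y\<in>carrier F. aff a b (inv a \<otimes> (y \<oplus> \<ominus> b)) = y"
    proof
      fix y assume y: "y \<in> carrier F"
      then have "a \<otimes> (inv a \<otimes> (y \<oplus> \<ominus> b)) = y \<oplus> \<ominus> b" using assms i by (simp flip: m_assoc)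
      then show "aff a b (inv a \<otimes> (y \<oplus> \<ominus> b)) = y" using assms i y by (simp add: aff_def a_assoc l_neg)
    qed
  qed (use assms i in \<open>auto simp: aff_def\<close>)
  then show ?thesis by (auto simp: Bij_def aff_def)
qed

lemma carrier_AGL: "carrier AGL = {aff a b | a b. a \<in> carrier F - {\<zero>} \<and> b \<in> carrier F}"
  by (simp add: AGL1_def aff_def)

lemma aff_in_AGL: "a \<in> carrier F \<Longrightarrow> a \<noteq> \<zero> \<Longrightarrow> b \<in> carrier F \<Longrightarrow> aff a b \<in> carrier AGL"
  unfolding carrier_AGL by (intro CollectI exI[of _ a] exI[of _ b]) simp

lemma aff_mult:
  assumes "a \<in> carrier F" "a \<noteq> \<zero>" "b \<in> carrier F" "c \<in> carrier F" "c \<noteq> \<zero>" "d \<in> carrier F"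
  shows "aff a b \<otimes>\<^bsub>AGL\<^esub> aff c d = aff (a \<otimes> c) (a \<otimes> d \<oplus> b)"
proof -
  have "aff a b \<otimes>\<^bsub>AGL\<^esub> aff c d = compose (carrier F) (aff a b) (aff c d)"
    using aff_Bij assms by (simp add: AGL1_def BijGroup_def)
  also have "\<dots> = aff (a \<otimes> c) (a \<otimes> d \<oplus> b)"
    using assms by (auto simp: compose_def aff_def restrict_def fun_eq_iff r_distr m_assoc a_assoc)
  finally show ?thesis .
qed

lemma aff_one: "\<one>\<^bsub>AGL\<^esub> = aff \<one> \<zero>"
  by (auto simp: AGL1_def BijGroup_def aff_def)

lemma aff_inj:
  assumes "a \<in> carrier F" "b \<in> carrier F" "c \<in> carrier F" "d \<in> carrier F" and eq: "aff a b = aff c d"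
  shows "a = c" "b = d"
proof -
  have "aff a b \<zero> = aff c d \<zero>" using eq by simp
  then show bd: "b = d" using assms by (simp add: aff_def)
  have "aff a b \<one> = aff c d \<one>" using eq by simp
  then show "a = c" using assms bd by (simp add: aff_def)
qed

lemma group_AGL: "group AGL"
proof (rule groupI)
  show "x \<otimes>\<^bsub>AGL\<^esub> y \<in> carrier AGL" if "x \<in> carrier AGL" "y \<in> carrier AGL" for x y
  proof -
    obtain a b c d where *: "x = aff a b" "a \<in> carrier F" "a \<noteq> \<zero>" "b \<in> carrier F"
      "y = aff c d" "c \<in> carrier F" "c \<noteq> \<zero>" "d \<in> carrier F"
      using \<open>x \<in> carrier AGL\<close> \<open>y \<in> carrier AGL\<close> unfolding carrier_AGL by auto
    have "a \<otimes> c \<in> carrier F - {\<zero>}" "a \<otimes> d \<oplus> b \<in> carrier F" using * by (auto simp: integral_iff)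
    then show ?thesis unfolding carrier_AGL using * by (auto simp: aff_mult)
  qed
  show "\<one>\<^bsub>AGL\<^esub> \<in> carrier AGL" unfolding aff_one by (intro aff_in_AGL) auto
  show "x \<otimes>\<^bsub>AGL\<^esub> y \<otimes>\<^bsub>AGL\<^esub> z = x \<otimes>\<^bsub>AGL\<^esub> (y \<otimes>\<^bsub>AGL\<^esub> z)"
    if "x \<in> carrier AGL" "y \<in> carrier AGL" "z \<in> carrier AGL" for x y z
    using that unfolding carrier_AGL by (auto simp: aff_mult integral_iff m_assoc r_distr a_assoc)
  show "\<one>\<^bsub>AGL\<^esub> \<otimes>\<^bsub>AGL\<^esub> x = x" if "x \<in> carrier AGL" for x
    using that unfolding carrier_AGL aff_one by (auto simp: aff_mult)
  show "\<exists>y\<in>carrier AGL. y \<otimes>\<^bsub>AGL\<^esub> x = \<one>\<^bsub>AGL\<^esub>" if x: "x \<in> carrier AGL" for x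
  proof -
    obtain a b where ab: "x = aff a b" "a \<in> carrier F" "a \<noteq> \<zero>" "b \<in> carrier F"
      using x unfolding carrier_AGL by auto
    note i = field_inv[OF ab(2,3)]
    have "aff (inv a) (\<ominus> (inv a \<otimes> b)) \<otimes>\<^bsub>AGL\<^esub> x = \<one>\<^bsub>AGL\<^esub>"
      using ab i by (simp add: aff_mult aff_one r_neg)
    moreover have "aff (inv a) (\<ominus> (inv a \<otimes> b)) \<in> carrier AGL" using ab i by (intro aff_in_AGL) auto
    ultimately show ?thesis by blast
  qed
qed

definition A_set :: "('a \<Rightarrow> 'a) set" where
  "A_set = {aff h v | h v. h \<in> H \<and> v \<in> V}"

lemma aff_in_A: "h \<in> H \<Longrightarrow> v \<in> V \<Longrightarrow> aff h v \<in> A_set"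
  unfolding A_set_def by (intro CollectI exI[of _ h] exI[of _ v]) simp

lemma HV: "h \<in> H \<Longrightarrow> h \<in> carrier F" "h \<in> H \<Longrightarrow> h \<noteq> \<zero>" "v \<in> V \<Longrightarrow> v \<in> carrier F" "a \<in> G \<Longrightarrow> a \<in> carrier F" "a \<in> G \<Longrightarrow> a \<in> V"
  "h \<in> H \<Longrightarrow> v \<in> V \<Longrightarrow> h \<otimes> v \<in> V"
  using H_props V_props G_carrier by auto

lemma aff_inv: assumes "a \<in> carrier F" "a \<noteq> \<zero>" "b \<in> carrier F"
  shows "inv\<^bsub>AGL\<^esub> (aff a b) = aff (inv a) (\<ominus> (inv a \<otimes> b))"
proof -
  note i = field_inv[OF assms(1,2)]
  interpret AGL: group AGL by (rule group_AGL)
  show ?thesis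
  proof (rule AGL.inv_equality)
    show "aff (inv a) (\<ominus> (inv a \<otimes> b)) \<otimes>\<^bsub>AGL\<^esub> aff a b = \<one>\<^bsub>AGL\<^esub>"
      using assms i by (simp add: aff_mult aff_one r_neg)
    show "aff a b \<in> carrier AGL" "aff (inv a) (\<ominus> (inv a \<otimes> b)) \<in> carrier AGL"
      using assms i by (auto intro!: aff_in_AGL)
  qed
qed

lemma subgroup_A_set: "subgroup A_set AGL"
proof -
  interpret AGL: group AGL by (rule group_AGL)
  show ?thesis
  proof (rule AGL.subgroupI)
    show "A_set \<subseteq> carrier AGL" unfolding A_set_def using HV by (auto intro!: aff_in_AGL)
    show "A_set \<noteq> {}" using aff_in_A[OF H_props(3) V_props(2)] by auto
    show "inv\<^bsub>AGL\<^esub> x \<in> A_set" if "x \<in> A_set" for x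
    proof -
      obtain h v where hv: "x = aff h v" "h \<in> H" "v \<in> V" using \<open>x \<in> A_set\<close> unfolding A_set_def by auto
      have "\<ominus> (inv h \<otimes> v) \<in> V" using hv H_props V_props by auto
      then show ?thesis unfolding hv(1) using aff_inv[of h v] hv HV H_props(7) by (auto intro!: aff_in_A)
    qed
    show "x \<otimes>\<^bsub>AGL\<^esub> y \<in> A_set" if "x \<in> A_set" "y \<in> A_set" for x y
    proof -
      obtain h v k w where hv: "x = aff h v" "h \<in> H" "v \<in> V" "y = aff k w" "k \<in> H" "w \<in> V"
        using \<open>x \<in> A_set\<close> \<open>y \<in> A_set\<close> unfolding A_set_def by auto
      have "x \<otimes>\<^bsub>AGL\<^esub> y = aff (h \<otimes> k) (h \<otimes> w \<oplus> v)" using hv HV by (simp add: aff_mult)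
      moreover have "h \<otimes> k \<in> H" "h \<otimes> w \<oplus> v \<in> V"
        using H_props(6)[OF hv(2,5)] V_props(5)[OF HV(6)[OF hv(2,6)] hv(3)] by auto
      ultimately show ?thesis by (auto intro!: aff_in_A)
    qed
  qed
qed

lemma translation_maps_eq: "translation_maps F m p = aff \<one> ` G"
  unfolding translation_maps_def aff_def using G_carrier by (intro image_cong) (auto intro!: restrict_ext)

lemma scaling_maps_eq: "scaling_maps F K = (\<lambda>h. aff h \<zero>) ` H"
  unfolding scaling_maps_def aff_def using H_props by (intro image_cong) (auto intro!: restrict_ext simp: subset_iff)

text \<open>Conjugating the translation by v with the scaling by k gives the translation by k v.
  Hence the vectors in \<open>V\<close> whose translations are generated form a
  \<open>K\<close>-subspace containing \<open>G\<close>, which by minimality is all of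
  \<open>V\<close>.\<close>

lemma carrier_A: "carrier A = A_set"
proof -
  interpret AGL: group AGL by (rule group_AGL)
  let ?S = "translation_maps F m p \<union> scaling_maps F K"
  let ?T = "generate AGL ?S"
  have S: "?S \<subseteq> A_set"
    unfolding translation_maps_eq scaling_maps_eq using H_props(3) V_props(2,4) by (auto intro!: aff_in_A)
  then have S': "?S \<subseteq> carrier AGL" using subgroup.subset[OF subgroup_A_set] by blast
  have "?T \<subseteq> A_set" using AGL.generate_subgroup_incl[OF S subgroup_A_set] .
  moreover have "A_set \<subseteq> ?T"
  proof -
    interpret T: subgroup ?T AGL using AGL.generate_is_subgroup[OF S'] .
    have sc: "aff h \<zero> \<in> ?T" if "h \<in> H" for h
      using that by (intro generate.incl) (auto simp: scaling_maps_eq)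
    define W where "W = {v \<in> V. aff \<one> v \<in> ?T}"
    have sg: "subgroup W (add_monoid F)"
    proof (rule add.subgroupI)
      show "W \<subseteq> carrier F" using V_props by (auto simp: W_def)
      show "W \<noteq> {}" using V_props(2) T.one_closed aff_one by (auto simp: W_def)
      show "\<ominus> v \<in> W" if "v \<in> W" for v
      proof -
        have v: "v \<in> V" "v \<in> carrier F" "aff \<one> v \<in> ?T" using that V_props by (auto simp: W_def)
        have "inv\<^bsub>AGL\<^esub> (aff \<one> v) = aff \<one> (\<ominus> v)" using aff_inv[of \<one> v] v by simp
        then have "aff \<one> (\<ominus> v) \<in> ?T" using T.m_inv_closed[OF v(3)] by simp
        then show ?thesis using v V_props by (simp add: W_def)
      qed
      show "v \<oplus> w \<in> W" if "v \<in> W" "w \<in> W" for v w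
      proof -
        have v: "v \<in> V" "v \<in> carrier F" "aff \<one> v \<in> ?T" "w \<in> V" "w \<in> carrier F" "aff \<one> w \<in> ?T"
          using that V_props by (auto simp: W_def)
        have "aff \<one> w \<otimes>\<^bsub>AGL\<^esub> aff \<one> v = aff \<one> (v \<oplus> w)" using v by (simp add: aff_mult)
        then have "aff \<one> (v \<oplus> w) \<in> ?T" using T.m_closed[OF v(6,3)] by simp
        then show ?thesis using v V_props by (simp add: W_def)
      qed
    qed
    have "subalgebra K W F"
    proof (intro subalgebra.intro sg subalgebra_axioms.intro)
      fix k v assume kv: "k \<in> K" "v \<in> W"
      then have v: "v \<in> V" "v \<in> carrier F" "aff \<one> v \<in> ?T" using V_props by (auto simp: W_def)
      show "k \<otimes> v \<in> W"
      proof (cases "k = \<zero>")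
        case True
        then show ?thesis using v V_props(2) T.one_closed aff_one by (simp add: W_def)
      next
        case False
        then have k: "k \<in> H" using kv by (simp add: H_set_def)
        note i = H_inv[OF k]
        have "aff k \<zero> \<otimes>\<^bsub>AGL\<^esub> aff \<one> v \<otimes>\<^bsub>AGL\<^esub> aff (inv k) \<zero> = aff \<one> (k \<otimes> v)"
          using i v H_props(7)[OF k] HV by (simp add: aff_mult integral_iff)
        then have "aff \<one> (k \<otimes> v) \<in> ?T"
          using T.m_closed[OF T.m_closed[OF sc[OF k] v(3)] sc[OF H_props(7)[OF k]]] by simp
        then show ?thesis using v kv V_props(7) by (simp add: W_def)
      qed
    qed
    moreover have "G \<subseteq> W"
      using V_props(4) by (auto simp: W_def translation_maps_eq intro!: generate.incl)
    ultimately have VW: "V \<subseteq> W" by (rule V_minimal)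
    show ?thesis
    proof
      fix x assume "x \<in> A_set"
      then obtain h v where hv: "x = aff h v" "h \<in> H" "v \<in> V" unfolding A_set_def by auto
      have "x = aff \<one> v \<otimes>\<^bsub>AGL\<^esub> aff h \<zero>" using hv HV by (simp add: aff_mult)
      moreover have "aff \<one> v \<in> ?T" using VW hv by (auto simp: W_def)
      ultimately show "x \<in> ?T" using T.m_closed sc hv by simp
    qed
  qed
  ultimately show ?thesis by (simp add: A_group_def)
qed

lemma A_ops: "mult A = mult AGL" "\<one>\<^bsub>A\<^esub> = aff \<one> \<zero>"
  using aff_one by (simp_all add: A_group_def)

lemma group_A: "group A"
proof -
  interpret AGL: group AGL by (rule group_AGL)
  have "A = AGL\<lparr>carrier := A_set\<rparr>" using carrier_A by (simp add: A_group_def)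
  then show ?thesis using subgroup.subgroup_is_group[OF subgroup_A_set group_AGL] by simp
qed

text \<open>The parametrisation \<open>x \<mapsto> h (x + v)\<close> makes \<open>v\<close> an invariant of the right coset of \<open>H\<close>.\<close>

definition par :: "'a \<times> 'a \<Rightarrow> 'a \<Rightarrow> 'a" where
  "par z = aff (fst z) (fst z \<otimes> snd z)"

lemma par_image: "par ` (H \<times> V) = A_set"
proof
  show "par ` (H \<times> V) \<subseteq> A_set" unfolding par_def using HV(6) by (auto intro!: aff_in_A)
  show "A_set \<subseteq> par ` (H \<times> V)"
  proof
    fix x assume "x \<in> A_set"
    then obtain h v where hv: "x = aff h v" "h \<in> H" "v \<in> V" unfolding A_set_def by auto
    have "h \<otimes> (inv h \<otimes> v) = v" using H_inv[OF hv(2)] HV hv by (simp flip: m_assoc)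
    then have "x = par (h, inv h \<otimes> v)" using hv by (simp add: par_def)
    moreover have "inv h \<otimes> v \<in> V" using hv H_props V_props by auto
    ultimately show "x \<in> par ` (H \<times> V)" using hv by blast
  qed
qed

lemma par_inj: "inj_on par (H \<times> V)"
proof (rule inj_onI, clarify)
  fix h v k w assume *: "h \<in> H" "v \<in> V" "k \<in> H" "w \<in> V" "par (h, v) = par (k, w)"
  have c: "h \<in> carrier F" "v \<in> carrier F" "k \<in> carrier F" "w \<in> carrier F" "h \<noteq> \<zero>" using * HV by auto
  have "h = k" "h \<otimes> v = k \<otimes> w"
    using aff_inj[of h "h \<otimes> v" k "k \<otimes> w"] * c by (auto simp: par_def)
  then show "h = k \<and> v = w" using c m_lcancel by auto
qed

lemma card_A: "card A_set = (q - 1) * q ^ m"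
  using card_image[OF par_inj] by (simp add: par_image card_cartesian_product H_props(5) card_V)

lemma code_length_eq: "code_length F m p K = (q - 1) * q ^ m"
  by (simp add: code_length_def carrier_A card_A)

lemma translate_par:
  assumes "a \<in> G" "h \<in> H" "v \<in> V"
  shows "aff \<one> a \<otimes>\<^bsub>AGL\<^esub> par (h, v) = par (h, v \<oplus> inv h \<otimes> a)"
proof -
  have "h \<otimes> (inv h \<otimes> a) = a" using H_inv[OF assms(2)] HV assms by (simp flip: m_assoc)
  then show ?thesis using assms HV H_inv[OF assms(2)] by (simp add: par_def aff_mult r_distr)
qed

lemma scale_par:
  assumes "k \<in> H" "h \<in> H" "v \<in> V"
  shows "aff k \<zero> \<otimes>\<^bsub>AGL\<^esub> par (h, v) = par (k \<otimes> h, v)"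
  using assms HV by (simp add: par_def aff_mult m_assoc)

lemma card_translation_maps: "card (translation_maps F m p) = q"
proof -
  have "inj_on (aff \<one>) G" using aff_inj(2)[of \<one> _ \<one>] HV by (auto intro!: inj_onI)
  then show ?thesis by (simp add: translation_maps_eq card_image card_G)
qed

lemma card_scaling_maps: "card (scaling_maps F K) = q - 1"
proof -
  have "inj_on (\<lambda>h. aff h \<zero>) H" using aff_inj(1)[of _ \<zero> _ \<zero>] HV by (auto intro!: inj_onI)
  then show ?thesis by (simp add: scaling_maps_eq card_image H_props)
qed

lemma subgroup_translation: "subgroup (translation_maps F m p) A"
proof -
  interpret A: group A by (rule group_A)
  show ?thesis
  proof (rule A.subgroupI)
    show "translation_maps F m p \<subseteq> carrier A"
      unfolding carrier_A translation_maps_eq using HV H_props(3) by (auto intro!: aff_in_A)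
    show "translation_maps F m p \<noteq> {}" using G_zero by (auto simp: translation_maps_eq)
    show "x \<otimes>\<^bsub>A\<^esub> y \<in> translation_maps F m p" if "x \<in> translation_maps F m p" "y \<in> translation_maps F m p" for x y
      using that G_add by (auto simp: translation_maps_eq A_ops aff_mult HV)
    show "inv\<^bsub>A\<^esub> x \<in> translation_maps F m p" if "x \<in> translation_maps F m p" for x
    proof -
      obtain a where a: "x = aff \<one> a" "a \<in> G"
        using \<open>x \<in> translation_maps F m p\<close> by (auto simp: translation_maps_eq)
      have "inv\<^bsub>A\<^esub> x = aff \<one> (\<ominus> a)"
      proof (rule A.inv_equality)
        show "aff \<one> (\<ominus> a) \<otimes>\<^bsub>A\<^esub> x = \<one>\<^bsub>A\<^esub>" using a HV by (simp add: A_ops aff_mult r_neg)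
        show "x \<in> carrier A" "aff \<one> (\<ominus> a) \<in> carrier A"
          unfolding carrier_A using a HV H_props(3) G_minus by (auto intro!: aff_in_A)
      qed
      then show ?thesis using a G_minus by (auto simp: translation_maps_eq)
    qed
  qed
qed

lemma subgroup_scaling: "subgroup (scaling_maps F K) A"
proof -
  interpret A: group A by (rule group_A)
  show ?thesis
  proof (rule A.subgroupI)
    show "scaling_maps F K \<subseteq> carrier A"
      unfolding carrier_A scaling_maps_eq using V_props(2) by (auto intro!: aff_in_A)
    show "scaling_maps F K \<noteq> {}" using H_props by (auto simp: scaling_maps_eq)
    show "x \<otimes>\<^bsub>A\<^esub> y \<in> scaling_maps F K" if "x \<in> scaling_maps F K" "y \<in> scaling_maps F K" for x y
      using that H_props by (auto simp: scaling_maps_eq A_ops aff_mult HV)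
    show "inv\<^bsub>A\<^esub> x \<in> scaling_maps F K" if "x \<in> scaling_maps F K" for x
    proof -
      obtain h where h: "x = aff h \<zero>" "h \<in> H"
        using \<open>x \<in> scaling_maps F K\<close> by (auto simp: scaling_maps_eq)
      have "inv\<^bsub>A\<^esub> x = aff (inv h) \<zero>"
      proof (rule A.inv_equality)
        show "aff (inv h) \<zero> \<otimes>\<^bsub>A\<^esub> x = \<one>\<^bsub>A\<^esub>"
          using h HV H_inv[OF h(2)] H_props(7) by (simp add: A_ops aff_mult)
        show "x \<in> carrier A" "aff (inv h) \<zero> \<in> carrier A"
          unfolding carrier_A using h V_props(2) H_props(7) by (auto intro!: aff_in_A)
      qed
      then show ?thesis using h H_props by (auto simp: scaling_maps_eq)
    qed
  qed
qed

text \<open>In the coordinates of \<open>par\<close>, a right coset of \<open>G\<close> keeps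
  \<open>h\<close> and moves \<open>v\<close> by the vectors inv h a. As \<open>h\<close> runs over
  \<open>H\<close>, these displacements sweep out the nonzero multiples of each root.\<close>

definition left_class :: "'a \<Rightarrow> 'a \<Rightarrow> ('a \<times> 'a) set" where
  "left_class h v = (\<lambda>a. (h, v \<oplus> inv h \<otimes> a)) ` G"

lemma translation_coset: "h \<in> H \<Longrightarrow> v \<in> V \<Longrightarrow> translation_maps F m p #>\<^bsub>A\<^esub> par (h, v) = par ` left_class h v"
  unfolding r_coset_def translation_maps_eq left_class_def using translate_par by (auto simp: A_ops)

lemma scaling_coset: "h \<in> H \<Longrightarrow> v \<in> V \<Longrightarrow> scaling_maps F K #>\<^bsub>A\<^esub> par (h, v) = par ` (H \<times> {v})"
proof -
  assume hv: "h \<in> H" "v \<in> V"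
  have "scaling_maps F K #>\<^bsub>A\<^esub> par (h, v) = (\<lambda>k. par (k \<otimes> h, v)) ` H"
    unfolding r_coset_def scaling_maps_eq using scale_par hv by (auto simp: A_ops)
  also have "\<dots> = (\<lambda>k. par (k, v)) ` ((\<lambda>k. k \<otimes> h) ` H)" by (simp add: image_image)
  also have "(\<lambda>k. k \<otimes> h) ` H = H"
  proof
    show "(\<lambda>k. k \<otimes> h) ` H \<subseteq> H" using H_props hv by auto
    show "H \<subseteq> (\<lambda>k. k \<otimes> h) ` H"
    proof
      fix k assume k: "k \<in> H"
      have "(k \<otimes> inv h) \<otimes> h = k" using H_inv[OF hv(1)] HV k by (simp add: m_assoc)
      moreover have "k \<otimes> inv h \<in> H" using H_props hv k by simp
      ultimately show "k \<in> (\<lambda>k. k \<otimes> h) ` H" by force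
    qed
  qed
  also have "(\<lambda>k. par (k, v)) ` H = par ` (H \<times> {v})" by auto
  finally show ?thesis .
qed

lemma rcosets_par: "rcosets\<^bsub>A\<^esub> S = (\<lambda>z. S #>\<^bsub>A\<^esub> par z) ` (H \<times> V)"
  unfolding RCOSETS_def carrier_A par_image[symmetric] by blast

lemma rcosets_scaling: "rcosets\<^bsub>A\<^esub> (scaling_maps F K) = (\<lambda>v. par ` (H \<times> {v})) ` V"
proof -
  have "rcosets\<^bsub>A\<^esub> (scaling_maps F K) = (\<lambda>z. par ` (H \<times> {snd z})) ` (H \<times> V)"
    unfolding rcosets_par using scaling_coset by (intro image_cong) auto
  also have "\<dots> = (\<lambda>v. par ` (H \<times> {v})) ` snd ` (H \<times> V)" by (simp only: image_image)
  also have "snd ` (H \<times> V) = V" using H_props(3) by (subst snd_image_times) auto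
  finally show ?thesis .
qed

end

section \<open>The second singular value of a matrix with constant row sums\<close>

text \<open>The all-ones vector is an eigenvector for 1. In the basis consisting of it and of all
  unit vectors but the first (the columns of \<open>P\<close>), \<open>S\<close> becomes block
  triangular with diagonal blocks 1 and \<open>D\<close>. Exactly one factor X - 1 is split off,
  whatever the multiplicity of the root 1.\<close>

lemma char_poly_deflate:
  fixes S :: "real mat"
  assumes S: "S \<in> carrier_mat (Suc n) (Suc n)"
    and row: "\<And>i. i < Suc n \<Longrightarrow> (\<Sum>j<Suc n. S $$ (i, j)) = 1"
  defines "D \<equiv> mat n n (\<lambda>(i, j). S $$ (Suc i, Suc j) - S $$ (0, Suc j))"
  shows "char_poly S = [:-1, 1:] * char_poly D"
proof -
  let ?N = "Suc n"
  define P where "P = mat ?N ?N (\<lambda>(i, j). if j = 0 then 1 else if i = j then 1 else (0::real))"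
  define Q where "Q = mat ?N ?N (\<lambda>(i, j). if i = j then 1 else if j = 0 then -1 else (0::real))"
  define B where "B = four_block_mat (mat 1 1 (\<lambda>_. 1)) (mat 1 n (\<lambda>(i, j). S $$ (0, Suc j))) (0\<^sub>m n 1) D"
  have car: "P \<in> carrier_mat ?N ?N" "Q \<in> carrier_mat ?N ?N" "D \<in> carrier_mat n n"
    unfolding P_def Q_def D_def by (rule mat_carrier)+
  have "B \<in> carrier_mat (1 + n) (1 + n)"
    unfolding B_def using car(3) by (intro four_block_carrier_mat) auto
  then have car: "P \<in> carrier_mat ?N ?N" "Q \<in> carrier_mat ?N ?N" "D \<in> carrier_mat n n" "B \<in> carrier_mat ?N ?N"
    using car by auto
  have Bij: "B $$ (i, j) = (if i = 0 then if j = 0 then 1 else S $$ (0, j)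
      else if j = 0 then 0 else S $$ (i, j) - S $$ (0, j))" if "i < ?N" "j < ?N" for i j
    using that by (cases i; cases j) (auto simp: B_def D_def)
  have sum_split: "(\<Sum>k<?N. f k) = f 0 + (\<Sum>k<n. f (Suc k))" for f :: "nat \<Rightarrow> real"
    by (rule sum.lessThan_Suc_shift)
  have Pm: "(P * C) $$ (i, j) = C $$ (0, j) + (if i = 0 then 0 else C $$ (i, j))"
    if C: "C \<in> carrier_mat ?N ?N" and ij: "i < ?N" "j < ?N" for C i j
  proof -
    have "(P * C) $$ (i, j) = (\<Sum>k<?N. P $$ (i, k) * C $$ (k, j))"
      using C car ij by (simp add: scalar_prod_def atLeast0LessThan)
    also have "\<dots> = C $$ (0, j) + (\<Sum>k<n. (if i = Suc k then C $$ (i, j) else 0))"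
      unfolding sum_split using ij by (intro arg_cong2[where f = "(+)"] sum.cong) (auto simp: P_def)
    also have "(\<Sum>k<n. (if i = Suc k then C $$ (i, j) else 0)) = (if i = 0 then 0 else C $$ (i, j))"
      using ij by (cases i) (auto simp: sum.delta')
    finally show ?thesis .
  qed
  have PQ: "P * Q = 1\<^sub>m ?N"
  proof (rule eq_matI)
    fix i j assume "i < dim_row (1\<^sub>m ?N :: real mat)" "j < dim_col (1\<^sub>m ?N :: real mat)"
    then have ij: "i < ?N" "j < ?N" by auto
    show "(P * Q) $$ (i, j) = 1\<^sub>m ?N $$ (i, j)"
      unfolding Pm[OF car(2) ij] using ij by (auto simp: Q_def)
  qed (use car in auto)
  have QP: "Q * P = 1\<^sub>m ?N"
    using mat_mult_left_right_inverse[OF car(1,2) PQ] .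
  have "S * P = P * B"
  proof (rule eq_matI)
    fix i j assume "i < dim_row (P * B)" "j < dim_col (P * B)"
    then have ij: "i < ?N" "j < ?N" using car by auto
    have "(S * P) $$ (i, j) = (\<Sum>k<?N. S $$ (i, k) * P $$ (k, j))"
      using S car ij by (simp add: scalar_prod_def atLeast0LessThan)
    also have "\<dots> = (\<Sum>k<?N. if j = 0 then S $$ (i, k) else if k = j then S $$ (i, j) else 0)"
      using ij by (intro sum.cong) (auto simp: P_def)
    also have "\<dots> = (if j = 0 then 1 else S $$ (i, j))"
      using row[OF ij(1)] ij by (cases "j = 0") (auto simp: sum.delta)
    also have "\<dots> = (P * B) $$ (i, j)"
      unfolding Pm[OF car(4) ij] using ij by (auto simp: Bij)
    finally show "(S * P) $$ (i, j) = (P * B) $$ (i, j)" .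
  qed (use car S in auto)
  then have "P * B * Q = S * (P * Q)" using assoc_mult_mat[OF S car(1,2)] by simp
  then have "S = P * B * Q" using S PQ by simp
  then have "similar_mat S B"
    using S car PQ QP by (intro similar_matI[of S B P Q ?N]) auto
  then have "char_poly S = char_poly B" by (rule char_poly_similar)
  also have "\<dots> = char_poly (mat 1 1 (\<lambda>_. 1::real)) * char_poly D"
    unfolding B_def by (rule char_poly_four_block_zeros_col) (use car in auto)
  also have "char_poly (mat 1 1 (\<lambda>_. 1::real)) = [:-1, 1:]"
    by (simp add: char_poly_def char_poly_matrix_def det_single)
  finally show ?thesis .
qed

text \<open>A left eigenvector of \<open>D\<close> is completed by the first coordinate that makes
  the sum zero. The equation for column 0 follows from the others: since row sums are one, all
  columns together contribute the sum of \<open>x\<close>, which is zero.\<close>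

lemma deflate_eigenvector:
  fixes S :: "real mat"
  assumes S: "S \<in> carrier_mat (Suc n) (Suc n)"
    and row: "\<And>i. i < Suc n \<Longrightarrow> (\<Sum>j<Suc n. S $$ (i, j)) = 1"
  defines "D \<equiv> mat n n (\<lambda>(i, j). S $$ (Suc i, Suc j) - S $$ (0, Suc j))"
  assumes \<mu>: "poly (char_poly D) \<mu> = 0"
  obtains x where "(\<Sum>i<Suc n. x i) = 0" "(\<Sum>i<Suc n. (x i)\<^sup>2) > 0"
    "\<And>j. j < Suc n \<Longrightarrow> (\<Sum>i<Suc n. x i * S $$ (i, j)) = \<mu> * x j"
proof -
  have D: "D \<in> carrier_mat n n" by (simp add: D_def)
  have "eigenvalue (transpose_mat D) \<mu>"
    using eigenvalue_root_char_poly[of "transpose_mat D" n \<mu>] D \<mu> char_poly_transpose_mat[OF D] by simp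
  then obtain u where u: "u \<in> carrier_vec n" "u \<noteq> 0\<^sub>v n" "transpose_mat D *\<^sub>v u = \<mu> \<cdot>\<^sub>v u"
    using D unfolding eigenvalue_def eigenvector_def by auto
  define x where "x i = (case i of 0 \<Rightarrow> - (\<Sum>i<n. u $ i) | Suc i \<Rightarrow> u $ i)" for i
  have split: "(\<Sum>k<Suc n. f k) = f 0 + (\<Sum>k<n. f (Suc k))" for f :: "nat \<Rightarrow> real"
    by (rule sum.lessThan_Suc_shift)
  have sum0: "(\<Sum>i<Suc n. x i) = 0" by (simp only: split) (simp add: x_def)
  obtain i where i: "i < n" "u $ i \<noteq> 0" using u(1,2) by (metis carrier_vecD eq_vecI index_zero_vec)
  have pos: "(\<Sum>i<Suc n. (x i)\<^sup>2) > 0"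
  proof (rule sum_pos2[of _ "Suc i"])
    show "0 < (x (Suc i))\<^sup>2" using i by (simp add: x_def)
  qed (use i in auto)
  have ev_Suc: "(\<Sum>i<Suc n. x i * S $$ (i, Suc j)) = \<mu> * x (Suc j)" if j: "j < n" for j
  proof -
    have "(\<Sum>i<n. D $$ (i, j) * u $ i) = (transpose_mat D *\<^sub>v u) $ j"
      using D u(1) j by (simp add: scalar_prod_def atLeast0LessThan mult_mat_vec_def)
    also have "\<dots> = \<mu> * u $ j" using u j by simp
    finally have "(\<Sum>i<n. (S $$ (Suc i, Suc j) - S $$ (0, Suc j)) * u $ i) = \<mu> * u $ j"
      using j by (simp add: D_def)
    then show ?thesis unfolding split
      by (simp add: x_def sum_subtractf algebra_simps sum_distrib_right)
  qed
  have "(\<Sum>j<Suc n. \<Sum>i<Suc n. x i * S $$ (i, j)) = (\<Sum>i<Suc n. x i * (\<Sum>j<Suc n. S $$ (i, j)))"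
    unfolding sum_distrib_left by (rule sum.swap)
  also have "\<dots> = 0" using row sum0 by simp
  finally have "(\<Sum>i<Suc n. x i * S $$ (i, 0)) + (\<Sum>j<n. \<Sum>i<Suc n. x i * S $$ (i, Suc j)) = 0"
    by (simp only: split)
  then have "(\<Sum>i<Suc n. x i * S $$ (i, 0)) = - (\<Sum>j<n. \<mu> * x (Suc j))"
    using ev_Suc by simp
  also have "\<dots> = \<mu> * x 0" by (simp add: x_def sum_distrib_left)
  finally have ev_0: "(\<Sum>i<Suc n. x i * S $$ (i, 0)) = \<mu> * x 0" .
  have "(\<Sum>i<Suc n. x i * S $$ (i, j)) = \<mu> * x j" if "j < Suc n" for j
    using that ev_0 ev_Suc by (cases j) auto
  then show ?thesis using that sum0 pos by blast
qed

text \<open>Guarantees that the list behind \<open>singular_values\<close> is long enough for its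
  entry at index 1. For an eigenvector \<open>w\<close> of the complexified matrix, the Hermitian
  form has the value \<open>a\<close> times a positive number; symmetry makes that value its own
  conjugate, so \<open>a\<close> is real.\<close>

lemma symmetric_real_rooted:
  fixes S :: "real mat"
  assumes S: "S \<in> carrier_mat n n" and sym: "\<And>i j. i < n \<Longrightarrow> j < n \<Longrightarrow> S $$ (i, j) = S $$ (j, i)"
  shows "size (proots (char_poly S)) = n"
proof -
  let ?C = "map_mat complex_of_real S"
  have C: "?C \<in> carrier_mat n n" using S by simp
  obtain as where as: "char_poly ?C = (\<Prod>a\<leftarrow>as. [:- a, 1:])" "length as = n"
    using char_poly_factorized[OF C] by blast
  have real: "complex_of_real (Re a) = a" if a: "a \<in> set as" for a
  proof -
    have "poly (char_poly ?C) a = 0"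
      unfolding as(1) poly_prod_list prod_list_zero_iff using a by force
    then have "eigenvalue ?C a" using eigenvalue_root_char_poly[OF C] by simp
    then obtain w where w: "w \<in> carrier_vec n" "w \<noteq> 0\<^sub>v n" "?C *\<^sub>v w = a \<cdot>\<^sub>v w"
      using C unfolding eigenvalue_def eigenvector_def by auto
    have ev: "(\<Sum>j<n. complex_of_real (S $$ (i, j)) * w $ j) = a * w $ i" if i: "i < n" for i
    proof -
      have "(\<Sum>j<n. complex_of_real (S $$ (i, j)) * w $ j) = (?C *\<^sub>v w) $ i"
        using S w(1) i by (simp add: scalar_prod_def atLeast0LessThan mult_mat_vec_def)
      then show ?thesis using w i by simp
    qed
    define T where "T = (\<Sum>i<n. \<Sum>j<n. cnj (w $ i) * (complex_of_real (S $$ (i, j)) * w $ j))"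
    define R where "R = (\<Sum>i<n. (cmod (w $ i))\<^sup>2)"
    have "T = (\<Sum>i<n. cnj (w $ i) * (a * w $ i))"
      unfolding T_def sum_distrib_left[symmetric] using ev by simp
    also have "\<dots> = a * complex_of_real R"
    proof -
      have "cnj z * (a * z) = a * complex_of_real ((cmod z)\<^sup>2)" for z
        unfolding complex_norm_square by (simp add: mult_ac)
      then show ?thesis unfolding R_def of_real_sum sum_distrib_left by (intro sum.cong refl)
    qed
    finally have T: "T = a * complex_of_real R" .
    have "cnj T = (\<Sum>i<n. \<Sum>j<n. w $ i * (complex_of_real (S $$ (i, j)) * cnj (w $ j)))"
      by (simp add: T_def)
    also have "\<dots> = (\<Sum>j<n. \<Sum>i<n. w $ i * (complex_of_real (S $$ (i, j)) * cnj (w $ j)))"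
      by (rule sum.swap)
    also have "\<dots> = T" unfolding T_def by (intro sum.cong) (auto simp: sym mult_ac)
    finally have "cnj T = T" .
    moreover have "R > 0"
    proof -
      obtain i where "i < n" "w $ i \<noteq> 0" using w(1,2) by (metis carrier_vecD eq_vecI index_zero_vec)
      then show ?thesis unfolding R_def by (intro sum_pos2[of _ i]) auto
    qed
    ultimately have "cnj a = a" using T by simp
    then show ?thesis by (metis Reals_cnj_iff of_real_Re)
  qed
  interpret oh: map_poly_inj_idom_hom complex_of_real ..
  let ?bs = "map Re as"
  have "map_poly complex_of_real (char_poly S) = (\<Prod>a\<leftarrow>as. [:- a, 1:])"
    using as(1) of_real_hom.char_poly_hom[OF S, where ?'a = complex] by simp
  also have "\<dots> = map_poly complex_of_real (\<Prod>b\<leftarrow>?bs. [:- b, 1:])"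
    using real by (simp add: oh.hom_prod_list o_def cong: map_cong)
  finally have "char_poly S = (\<Prod>b\<leftarrow>?bs. [:- b, 1:])" by (simp only: oh.eq_iff)
  then have "proots (char_poly S) = (\<Sum>p\<leftarrow>map (\<lambda>b. [:- b, 1:]) ?bs. proots p)"
    by (subst proots_prod_list[symmetric]) (auto simp: o_def)
  also have "\<dots> = mset ?bs" by (induction as) auto
  finally show ?thesis using as(2) by simp
qed

text \<open>The condition \<open>\<kappa> * \<kappa>' = 1\<close> makes all row sums of M M^T equal
  to 1. After one root 1 is split off, every remaining root \<mu> has a mean-zero eigenvector x.
  With y = M^T x the squared norm of y is \<mu> times that of x, and Cauchy--Schwarz against M y
  carries the assumed bound over to \<mu>.\<close>

lemma second_singular_value_bounds:
  fixes M :: "real mat"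
  assumes M: "M \<in> carrier_mat N N'" and N: "N \<ge> 2" "N' \<ge> 2"
    and row: "\<And>i. i < N \<Longrightarrow> (\<Sum>k<N'. M $$ (i, k)) = \<kappa>"
    and col: "\<And>k. k < N' \<Longrightarrow> (\<Sum>i<N. M $$ (i, k)) = \<kappa>'" and \<kappa>: "\<kappa> * \<kappa>' = 1"
    and c: "c \<ge> 0"
    and bound: "\<And>y. (\<Sum>k<N'. y k) = 0 \<Longrightarrow>
      (\<Sum>i<N. (\<Sum>k<N'. M $$ (i, k) * y k)\<^sup>2) \<le> c\<^sup>2 * (\<Sum>k<N'. (y k)\<^sup>2)"
  shows "0 \<le> second_singular_value M" "second_singular_value M \<le> c"
proof -
  define S where "S = M * transpose_mat M"
  have S: "S \<in> carrier_mat N N" using M by (simp add: S_def)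
  have Sij: "S $$ (i, j) = (\<Sum>k<N'. M $$ (i, k) * M $$ (j, k))" if "i < N" "j < N" for i j
    using M that by (simp add: S_def scalar_prod_def atLeast0LessThan)
  obtain n where n: "N = Suc n" using N by (cases N) auto
  have rowS: "(\<Sum>j<Suc n. S $$ (i, j)) = 1" if i: "i < Suc n" for i
  proof -
    have "(\<Sum>j<N. S $$ (i, j)) = (\<Sum>j<N. \<Sum>k<N'. M $$ (i, k) * M $$ (j, k))"
      using i n by (intro sum.cong) (auto simp: Sij)
    also have "\<dots> = (\<Sum>k<N'. M $$ (i, k) * (\<Sum>j<N. M $$ (j, k)))"
      unfolding sum_distrib_left by (rule sum.swap)
    also have "\<dots> = \<kappa> * \<kappa>'" using col row i n by (simp flip: sum_distrib_right)
    finally show ?thesis using n \<kappa> by simp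
  qed
  define D where "D = mat n n (\<lambda>(i, j). S $$ (Suc i, Suc j) - S $$ (0, Suc j))"
  have D: "D \<in> carrier_mat n n" by (simp add: D_def)
  have S': "S \<in> carrier_mat (Suc n) (Suc n)" using S n by simp
  have cp: "char_poly S = [:-1, 1:] * char_poly D"
    unfolding D_def by (rule char_poly_deflate[OF S' rowS])
  have cD0: "char_poly D \<noteq> 0" using degree_monic_char_poly[OF D] by auto
  have \<mu>: "0 \<le> \<mu> \<and> \<mu> \<le> c\<^sup>2" if "\<mu> \<in># proots (char_poly D)" for \<mu>
  proof -
    have "poly (char_poly D) \<mu> = 0" using that cD0 by (simp add: set_count_proots)
    then obtain x where x: "(\<Sum>i<N. x i) = 0" "(\<Sum>i<N. (x i)\<^sup>2) > 0"
      "\<And>j. j < N \<Longrightarrow> (\<Sum>i<N. x i * S $$ (i, j)) = \<mu> * x j"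
      using deflate_eigenvector[OF S' rowS] unfolding D_def n by blast
    define y where "y k = (\<Sum>i<N. M $$ (i, k) * x i)" for k
    have sy: "(\<Sum>k<N'. y k) = 0"
    proof -
      have "(\<Sum>k<N'. y k) = (\<Sum>i<N. (\<Sum>k<N'. M $$ (i, k)) * x i)"
        unfolding y_def sum_distrib_right by (rule sum.swap)
      also have "\<dots> = \<kappa> * (\<Sum>i<N. x i)" using row by (simp add: sum_distrib_left)
      finally show ?thesis using x by simp
    qed
    have yy: "(\<Sum>k<N'. (y k)\<^sup>2) = \<mu> * (\<Sum>i<N. (x i)\<^sup>2)"
    proof -
      have "(\<Sum>k<N'. (y k)\<^sup>2) = (\<Sum>k<N'. \<Sum>j<N. \<Sum>i<N. x j * (x i * (M $$ (i, k) * M $$ (j, k))))"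
        unfolding y_def power2_eq_square sum_product
        by (subst sum.swap) (intro sum.cong refl, simp add: mult_ac)
      also have "\<dots> = (\<Sum>j<N. \<Sum>k<N'. \<Sum>i<N. x j * (x i * (M $$ (i, k) * M $$ (j, k))))" by (rule sum.swap)
      also have "\<dots> = (\<Sum>j<N. \<Sum>i<N. \<Sum>k<N'. x j * (x i * (M $$ (i, k) * M $$ (j, k))))"
        by (intro sum.cong refl sum.swap)
      also have "\<dots> = (\<Sum>j<N. x j * (\<Sum>i<N. x i * S $$ (i, j)))"
        by (intro sum.cong refl) (simp add: Sij sum_distrib_left)
      also have "\<dots> = \<mu> * (\<Sum>i<N. (x i)\<^sup>2)" using x(3) by (simp add: sum_distrib_left power2_eq_square mult_ac)
      finally show ?thesis .
    qed
    have yMx: "(\<Sum>k<N'. (y k)\<^sup>2) = (\<Sum>i<N. x i * (\<Sum>k<N'. M $$ (i, k) * y k))"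
    proof -
      have "(\<Sum>k<N'. (y k)\<^sup>2) = (\<Sum>k<N'. \<Sum>i<N. x i * (M $$ (i, k) * y k))"
      proof -
        have "y k * z = (\<Sum>i<N. x i * (M $$ (i, k) * z))" for k z
          unfolding y_def sum_distrib_right by (simp add: mult_ac)
        then show ?thesis unfolding power2_eq_square by (intro sum.cong refl)
      qed
      also have "\<dots> = (\<Sum>i<N. \<Sum>k<N'. x i * (M $$ (i, k) * y k))" by (rule sum.swap)
      finally show ?thesis by (simp add: sum_distrib_left)
    qed
    let ?X = "\<Sum>i<N. (x i)\<^sup>2" and ?Y = "\<Sum>k<N'. (y k)\<^sup>2"
    have Y0: "?Y \<ge> 0" by (intro sum_nonneg) simp
    have "?Y\<^sup>2 \<le> ?X * (\<Sum>i<N. (\<Sum>k<N'. M $$ (i, k) * y k)\<^sup>2)"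
      unfolding yMx by (rule Cauchy_Schwarz_ineq_sum)
    also have "\<dots> \<le> ?X * (c\<^sup>2 * ?Y)" using bound[OF sy] x(2) by (intro mult_left_mono) auto
    finally have "?Y * ?Y \<le> ?Y * (c\<^sup>2 * ?X)" by (simp add: power2_eq_square mult_ac)
    then have "?Y \<le> c\<^sup>2 * ?X" using Y0 x(2) by (cases "?Y = 0") (auto simp: mult_le_cancel_left)
    then show ?thesis using yy x(2) Y0 by (auto simp: zero_le_mult_iff)
  qed
  define L where "L = rev (sorted_list_of_multiset (image_mset sqrt (proots (char_poly S))))"
  have pS: "proots (char_poly S) = add_mset 1 (proots (char_poly D))"
    unfolding cp using cD0 by (subst proots_mult) auto
  have mL: "mset L = add_mset 1 (image_mset sqrt (proots (char_poly D)))"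
    by (simp add: L_def pS)
  have "size (proots (char_poly S)) = N"
    by (rule symmetric_real_rooted[OF S]) (simp add: Sij mult.commute)
  then have len: "length L = N" by (metis L_def length_rev mset_sorted_list_of_multiset size_image_mset size_mset)
  have dims: "dim_row M = N" "dim_col M = N'" using M by auto
  have "second_singular_value M = take (min N N') L ! 1"
    by (simp add: second_singular_value_def singular_values_def L_def S_def dims)
  then have eq: "second_singular_value M = L ! 1" using N by simp
  have "L ! 1 \<in># mset L" using len N by (metis Suc_1 Suc_le_lessD nth_mem_mset)
  then have "L ! 1 = 1 \<or> (\<exists>\<mu>. \<mu> \<in># proots (char_poly D) \<and> L ! 1 = sqrt \<mu>)" unfolding mL by auto
  then show "0 \<le> second_singular_value M" unfolding eq using \<mu> by auto
  \<comment> \<open>The list is decreasing, so if entry 1 exceeded \<open>c\<close>, entry 0 would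
    too; but only the single root that was split off can exceed \<open>c\<close>.\<close>
  show "second_singular_value M \<le> c" unfolding eq
  proof (rule ccontr)
    assume "\<not> L ! 1 \<le> c"
    then have 1: "L ! 1 > c" by simp
    have "sorted (rev L)" by (simp add: L_def)
    then have "L ! 1 \<le> L ! 0" using len N by (intro sorted_rev_nth_mono) auto
    then have 0: "L ! 0 > c" using 1 by simp
    obtain a b rest where L: "L = a # b # rest"
      using len N by (cases L; cases "tl L") auto
    have "size (filter_mset (\<lambda>x. x > c) (mset L)) \<ge> 2" using 0 1 L by simp
    moreover have z: "filter_mset (\<lambda>x. x > c) (image_mset sqrt (proots (char_poly D))) = {#}"
    proof -
      have "sqrt \<mu> \<le> c" if "\<mu> \<in># proots (char_poly D)" for \<mu>
        using \<mu>[OF that] c by (intro real_le_lsqrt) auto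
      then show ?thesis by (fastforce simp: not_less)
    qed
    then have "size (filter_mset (\<lambda>x. x > c) (mset L)) \<le> 1"
      unfolding mL filter_mset_add_mset z by simp
    ultimately show False by simp
  qed
qed

section \<open>Enumerations and partitions into cosets\<close>

lemma enum_set: assumes "finite S" shows "set (enum_set S) = S" "distinct (enum_set S)"
proof -
  have "\<exists>xs. set xs = S \<and> distinct xs" using finite_distinct_list[OF assms] by blast
  from someI_ex[OF this] show "set (enum_set S) = S" "distinct (enum_set S)"
    unfolding enum_set_def by auto
qed

lemma bij_betw_enum_set: "finite S \<Longrightarrow> bij_betw (\<lambda>k. enum_set S ! k) {..<card S} S"
  using enum_set[of S] bij_betw_nth[of "enum_set S" "{..<card S}" S] distinct_card[of "enum_set S"] by simp

lemma sum_partition: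
  fixes f :: "'c \<Rightarrow> real"
  assumes "finite P" "finite Z" "\<And>C. C \<in> P \<Longrightarrow> finite C" "Z \<subseteq> \<Union>P" "\<And>C D. C \<in> P \<Longrightarrow> D \<in> P \<Longrightarrow> C \<noteq> D \<Longrightarrow> C \<inter> D = {}"
  shows "(\<Sum>C\<in>P. \<Sum>\<phi>\<in>Z \<inter> C. f \<phi>) = (\<Sum>\<phi>\<in>Z. f \<phi>)"
proof -
  have "Z = (\<Union>C\<in>P. Z \<inter> C)" using assms(4) by auto
  then have "(\<Sum>\<phi>\<in>Z. f \<phi>) = (\<Sum>\<phi>\<in>(\<Union>C\<in>P. Z \<inter> C). f \<phi>)" by simp
  also have "\<dots> = (\<Sum>C\<in>P. \<Sum>\<phi>\<in>Z \<inter> C. f \<phi>)"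
  proof (rule sum.UNION_disjoint)
    show "\<forall>C\<in>P. \<forall>D\<in>P. C \<noteq> D \<longrightarrow> Z \<inter> C \<inter> (Z \<inter> D) = {}"
    proof (intro ballI impI)
      fix C D assume "C \<in> P" "D \<in> P" "C \<noteq> D"
      then have "C \<inter> D = {}" by (rule assms(5))
      then show "Z \<inter> C \<inter> (Z \<inter> D) = {}" by auto
    qed
  qed (use assms(1,2) in auto)
  finally show ?thesis ..
qed

lemma (in group) rcosets_facts:
  assumes S: "subgroup S G" and fin: "finite (carrier G)"
  shows "finite (rcosets S)" "\<And>C. C \<in> rcosets S \<Longrightarrow> finite C" "\<And>C. C \<in> rcosets S \<Longrightarrow> C \<subseteq> carrier G"
    "\<Union>(rcosets S) = carrier G" "\<And>C D. C \<in> rcosets S \<Longrightarrow> D \<in> rcosets S \<Longrightarrow> C \<noteq> D \<Longrightarrow> C \<inter> D = {}"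
    "\<And>C. C \<in> rcosets S \<Longrightarrow> card C = card S" "\<And>C x. C \<in> rcosets S \<Longrightarrow> x \<in> C \<Longrightarrow> S #> x = C"
proof -
  show sub: "\<And>C. C \<in> rcosets S \<Longrightarrow> C \<subseteq> carrier G"
    using rcosets_part_G[OF S] by blast
  show "\<Union>(rcosets S) = carrier G" by (rule rcosets_part_G[OF S])
  show "finite (rcosets S)" using fin by (simp add: RCOSETS_def)
  show "\<And>C. C \<in> rcosets S \<Longrightarrow> finite C" using sub fin finite_subset by blast
  show "\<And>C D. C \<in> rcosets S \<Longrightarrow> D \<in> rcosets S \<Longrightarrow> C \<noteq> D \<Longrightarrow> C \<inter> D = {}"
    using rcos_disjoint[OF S] by (auto simp: pairwise_def disjnt_def)
  show "\<And>C. C \<in> rcosets S \<Longrightarrow> card C = card S"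
    using card_rcosets_equal[OF _ subgroup.subset[OF S]] by (metis)
  show "S #> x = C" if "C \<in> rcosets S" "x \<in> C" for C x
  proof -
    obtain a where a: "a \<in> carrier G" "C = S #> a" using \<open>C \<in> rcosets S\<close> by (auto simp: RCOSETS_def)
    then show ?thesis using repr_independence[OF _ a(1) S] that(2) by simp
  qed
qed

section \<open>Spectral gap, mixing and support density in the coset graph\<close>

context expander_setup
begin

abbreviation "TT \<equiv> translation_maps F m p"
abbreviation "SS \<equiv> scaling_maps F K"

lemma finite_A: "finite (carrier A)"
  using finite_imageI[of "H \<times> V" par] H_props V_props by (simp add: carrier_A flip: par_image)

lemma card_rcosets:
  "card (rcosets\<^bsub>A\<^esub> TT) = (q - 1) * q ^ (m - 1)" "card (rcosets\<^bsub>A\<^esub> SS) = q ^ m"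
proof -
  have o: "Coset.order A = (q - 1) * q ^ m" by (simp add: Coset.order_def carrier_A card_A)
  have q0: "q \<noteq> 0" "q - 1 \<noteq> 0" using q_ge_4 by linarith+
  have "card (rcosets\<^bsub>A\<^esub> TT) * q = ((q - 1) * q ^ (m - 1)) * q"
    using group.lagrange[OF group_A subgroup_translation] o card_translation_maps m_ge_2
    by (simp add: power_eq_if[of q m] mult_ac)
  then show "card (rcosets\<^bsub>A\<^esub> TT) = (q - 1) * q ^ (m - 1)"
    using mult_right_cancel[OF q0(1)] by blast
  have "card (rcosets\<^bsub>A\<^esub> SS) * (q - 1) = q ^ m * (q - 1)"
    using group.lagrange[OF group_A subgroup_scaling] o card_scaling_maps by (simp add: mult_ac)
  then show "card (rcosets\<^bsub>A\<^esub> SS) = q ^ m"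
    using mult_right_cancel[OF q0(2)] by blast
qed

lemma sum_H_inv: "(\<Sum>h\<in>H. f (inv h)) = (\<Sum>h\<in>H. f h)"
proof (rule sum.reindex_bij_betw)
  have "inv (inv h) = h" if "h \<in> H" for h
    using field_inv HV that field_Units by (intro Units_inv_inv) auto
  then show "bij_betw (\<lambda>h. inv h) H H"
    using H_props(7) by (intro bij_betw_byWitness[where f' = "\<lambda>h. inv h"]) auto
qed

text \<open>The square of a coset sum runs over pairs in a common right coset of \<open>G\<close>.
  As \<open>y\<close> depends on \<open>v\<close> only, such a pair contributes through v and v +
  inv h a; since inversion permutes \<open>H\<close>, the total is the quadratic form bounded
  above.\<close>

lemma coset_sum_bound:
  assumes yh: "\<And>h v. h \<in> H \<Longrightarrow> v \<in> V \<Longrightarrow> y (par (h, v)) = Y v" and Y0: "(\<Sum>v\<in>V. Y v) = 0"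
  shows "(\<Sum>C\<in>rcosets\<^bsub>A\<^esub> TT. (\<Sum>\<phi>\<in>C. y \<phi>)\<^sup>2) \<le> real m / real p * (real q)\<^sup>2 * (\<Sum>v\<in>V. (Y v)\<^sup>2)"
proof -
  note c = group.rcosets_facts[OF group_A subgroup_translation finite_A]
  define s where "s \<phi> = (\<Sum>\<psi>\<in>TT #>\<^bsub>A\<^esub> \<phi>. y \<psi>)" for \<phi>
  have "(\<Sum>C\<in>rcosets\<^bsub>A\<^esub> TT. (\<Sum>\<phi>\<in>C. y \<phi>)\<^sup>2) = (\<Sum>C\<in>rcosets\<^bsub>A\<^esub> TT. \<Sum>\<phi>\<in>carrier A \<inter> C. y \<phi> * s \<phi>)"
  proof (rule sum.cong[OF refl])
    fix C assume C: "C \<in> rcosets\<^bsub>A\<^esub> TT"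
    then have *: "carrier A \<inter> C = C" using c(3) by blast
    have "(\<Sum>\<phi>\<in>C. y \<phi> * s \<phi>) = (\<Sum>\<phi>\<in>C. y \<phi> * (\<Sum>\<psi>\<in>C. y \<psi>))"
      using c(7)[OF C] by (intro sum.cong) (auto simp: s_def)
    then show "(\<Sum>\<phi>\<in>C. y \<phi>)\<^sup>2 = (\<Sum>\<phi>\<in>carrier A \<inter> C. y \<phi> * s \<phi>)"
      unfolding * by (simp add: sum_distrib_right power2_eq_square)
  qed
  also have "\<dots> = (\<Sum>\<phi>\<in>carrier A. y \<phi> * s \<phi>)"
    using c finite_A by (intro sum_partition) auto
  also have "\<dots> = (\<Sum>z\<in>H \<times> V. y (par z) * s (par z))"
    unfolding carrier_A par_image[symmetric] by (rule sum.reindex[OF par_inj, unfolded o_def])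
  also have "\<dots> = (\<Sum>(h, v)\<in>H \<times> V. \<Sum>a\<in>G. Y v * Y (v \<oplus> inv h \<otimes> a))"
  proof (rule sum.cong[OF refl], clarify)
    fix h v assume hv: "h \<in> H" "v \<in> V"
    have inj: "inj_on (\<lambda>a. (h, v \<oplus> inv h \<otimes> a)) G"
    proof (rule inj_onI)
      fix a b assume *: "a \<in> G" "b \<in> G" "(h, v \<oplus> inv h \<otimes> a) = (h, v \<oplus> inv h \<otimes> b)"
      then show "a = b" using HV hv H_inv[OF hv(1)] field_inv[of h]
        by (metis Pair_inject add.l_cancel m_closed m_lcancel)
    qed
    have sub: "left_class h v \<subseteq> H \<times> V"
      unfolding left_class_def using hv HV(5,6) H_props(7) V_props(5) by auto
    have "s (par (h, v)) = (\<Sum>z\<in>left_class h v. y (par z))"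
      unfolding s_def translation_coset[OF hv] using inj_on_subset[OF par_inj sub] by (rule sum.reindex[unfolded o_def])
    also have "\<dots> = (\<Sum>a\<in>G. y (par (h, v \<oplus> inv h \<otimes> a)))"
      unfolding left_class_def using inj by (rule sum.reindex[unfolded o_def])
    also have "\<dots> = (\<Sum>a\<in>G. Y (v \<oplus> inv h \<otimes> a))"
      using hv HV(5,6) H_props(7) V_props(5) by (intro sum.cong refl yh) auto
    finally show "y (par (h, v)) * s (par (h, v)) = (\<Sum>a\<in>G. Y v * Y (v \<oplus> inv h \<otimes> a))"
      using yh[OF hv] by (simp add: sum_distrib_left)
  qed
  also have "\<dots> = (\<Sum>h\<in>H. \<Sum>v\<in>V. \<Sum>a\<in>G. Y v * Y (v \<oplus> inv h \<otimes> a))"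
    by (rule sum.cartesian_product[symmetric])
  also have "\<dots> = (\<Sum>h\<in>H. \<Sum>v\<in>V. \<Sum>a\<in>G. Y v * Y (v \<oplus> h \<otimes> a))"
    by (rule sum_H_inv[of "\<lambda>h. \<Sum>v\<in>V. \<Sum>a\<in>G. Y v * Y (v \<oplus> h \<otimes> a)"])
  also note quadratic_form_bound[OF Y0]
  finally show ?thesis .
qed

lemma scaling_class_inj: "inj_on (\<lambda>v. par ` (H \<times> {v})) V"
proof (rule inj_onI)
  fix v w assume *: "v \<in> V" "w \<in> V" "par ` (H \<times> {v}) = par ` (H \<times> {w})"
  have "par (\<one>, v) \<in> par ` (H \<times> {w})" unfolding *(3)[symmetric] using H_props(3) by auto
  then obtain h where h: "h \<in> H" "par (\<one>, v) = par (h, w)" by auto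
  then show "v = w" using inj_onD[OF par_inj, of "(\<one>, v)" "(h, w)"] * H_props(3) by auto
qed

text \<open>The normalisation divides by q (q - 1), whereas the quadratic form is bounded by m / p
  times q^2. The quotient q / (q - 1) is at most 2, which is the 2 under the root.\<close>

theorem coset_graph_expansion:
  "0 \<le> second_singular_value (norm_biadj A TT SS)"
  "second_singular_value (norm_biadj A TT SS) \<le> sqrt (2 * real m / real p)"
proof -
  note cT = group.rcosets_facts[OF group_A subgroup_translation finite_A]
  note cS = group.rcosets_facts[OF group_A subgroup_scaling finite_A]
  let ?PT = "rcosets\<^bsub>A\<^esub> TT" and ?PS = "rcosets\<^bsub>A\<^esub> SS"
  define L where "L = enum_set ?PT"
  define R where "R = enum_set ?PS"
  define N where "N = card ?PT"
  define N' where "N' = card ?PS"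
  define d where "d = sqrt (real (card TT) * real (card SS))"
  define M where "M = norm_biadj A TT SS"
  have "real 4 \<le> real q" using q_ge_4 by (simp only: of_nat_le_iff)
  then have q1: "real q - 1 > 0" "real (q - 1) = real q - 1" "q - 1 > 0"
  proof -
    have "1 \<le> q" using q_ge_4 by linarith
    then show "real (q - 1) = real q - 1" by (simp only: of_nat_diff of_nat_1)
    show "q - 1 > 0" using q_ge_4 by linarith
  qed linarith
  have d2: "d\<^sup>2 = real q * (real q - 1)" "d > 0"
    using q1 by (simp_all add: d_def card_translation_maps card_scaling_maps)
  have len: "length L = N" "length R = N'"
    using distinct_card[OF enum_set(2)[OF cT(1)]] distinct_card[OF enum_set(2)[OF cS(1)]]
      enum_set(1)[OF cT(1)] enum_set(1)[OF cS(1)] by (auto simp: L_def R_def N_def N'_def)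
  have bL: "bij_betw (\<lambda>k. L ! k) {..<N} ?PT" and bR: "bij_betw (\<lambda>k. R ! k) {..<N'} ?PS"
    using bij_betw_enum_set[OF cT(1)] bij_betw_enum_set[OF cS(1)] by (simp_all add: L_def R_def N_def N'_def)
  have Li: "L ! i \<in> ?PT" if "i < N" for i using bL that by (auto simp: bij_betw_def)
  have Rk: "R ! k \<in> ?PS" if "k < N'" for k using bR that by (auto simp: bij_betw_def)
  have M_eq: "M = mat N N' (\<lambda>(i, j). real (card (L ! i \<inter> R ! j)) / d)"
    unfolding M_def norm_biadj_def Let_def using len by (simp add: L_def R_def d_def)
  have Mc: "M \<in> carrier_mat N N'" by (simp add: M_eq)
  have Mik: "M $$ (i, k) = real (card (L ! i \<inter> R ! k)) / d" if "i < N" "k < N'" for i k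
    using that by (simp add: M_eq)
  have sumR: "(\<Sum>k<N'. f (R ! k)) = (\<Sum>C\<in>?PS. f C)" for f :: "_ \<Rightarrow> real"
    by (rule sum.reindex_bij_betw[OF bR])
  have sumL: "(\<Sum>k<N. f (L ! k)) = (\<Sum>C\<in>?PT. f C)" for f :: "_ \<Rightarrow> real"
    by (rule sum.reindex_bij_betw[OF bL])
  have cardR: "(\<Sum>C\<in>?PS. real (card (Z \<inter> C))) = real (card Z)" if "Z \<subseteq> carrier A" for Z
  proof -
    have "(\<Sum>C\<in>?PS. \<Sum>\<phi>\<in>Z \<inter> C. 1::real) = (\<Sum>\<phi>\<in>Z. 1)"
      using cS that finite_A finite_subset by (intro sum_partition) auto
    then show ?thesis by simp
  qed
  have cardL: "(\<Sum>C\<in>?PT. real (card (Z \<inter> C))) = real (card Z)" if "Z \<subseteq> carrier A" for Z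
  proof -
    have "(\<Sum>C\<in>?PT. \<Sum>\<phi>\<in>Z \<inter> C. 1::real) = (\<Sum>\<phi>\<in>Z. 1)"
      using cT that finite_A finite_subset by (intro sum_partition) auto
    then show ?thesis by simp
  qed
  have row: "(\<Sum>k<N'. M $$ (i, k)) = real (card TT) / d" if i: "i < N" for i
    using sumR[of "\<lambda>C. real (card (L ! i \<inter> C)) / d"] Mik[OF i] cardR[OF cT(3)[OF Li[OF i]]] cT(6)[OF Li[OF i]]
    by (simp flip: sum_divide_distrib)
  have col: "(\<Sum>i<N. M $$ (i, k)) = real (card SS) / d" if k: "k < N'" for k
    using sumL[of "\<lambda>C. real (card (R ! k \<inter> C)) / d"] Mik[OF _ k] cardL[OF cS(3)[OF Rk[OF k]]] cS(6)[OF Rk[OF k]]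
    by (simp add: Int_commute flip: sum_divide_distrib)
  have \<kappa>: "real (card TT) / d * (real (card SS) / d) = 1"
    using d2 q1 by (simp add: card_translation_maps card_scaling_maps power2_eq_square field_simps)
  have N2: "N \<ge> 2" "N' \<ge> 2"
  proof -
    have "q \<le> q ^ m" using q_ge_4 by (intro self_le_power) auto
    then have 2: "2 \<le> q ^ m" using q_ge_4 by linarith
    have "1 \<le> q ^ (m - 1)" using p_ge_2 by (intro one_le_power) linarith
    moreover have "2 \<le> q - 1" using q_ge_4 by linarith
    ultimately have "2 * 1 \<le> (q - 1) * q ^ (m - 1)" by (intro mult_le_mono)
    with 2 have "(q - 1) * q ^ (m - 1) \<ge> 2" "q ^ m \<ge> 2" by linarith+
    then show "N \<ge> 2" "N' \<ge> 2" unfolding N_def N'_def card_rcosets by auto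
  qed
  have bound: "(\<Sum>i<N. (\<Sum>k<N'. M $$ (i, k) * y k)\<^sup>2) \<le> (sqrt (2 * real m / real p))\<^sup>2 * (\<Sum>k<N'. (y k)\<^sup>2)"
    if y: "(\<Sum>k<N'. y k) = 0" for y
  proof -
    \<comment> \<open>A vector on the right vertices is pulled back to a function \<open>w\<close>
      on the group that is constant on right cosets of \<open>H\<close>; \<open>idx\<close> undoes
      the arbitrary enumeration of these cosets.\<close>
    define idx where "idx = inv_into {..<N'} (\<lambda>k. R ! k)"
    have idx: "idx (R ! k) = k" if "k < N'" for k
      unfolding idx_def using bR that by (intro inv_into_f_f) (auto simp: bij_betw_def)
    define w where "w \<phi> = y (idx (SS #>\<^bsub>A\<^esub> \<phi>))" for \<phi>
    define Y where "Y v = y (idx (par ` (H \<times> {v})))" for v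
    have wY: "w (par (h, v)) = Y v" if "h \<in> H" "v \<in> V" for h v
      unfolding w_def Y_def scaling_coset[OF that] ..
    have sumY: "(\<Sum>v\<in>V. f (Y v)) = (\<Sum>k<N'. f (y k))" for f :: "real \<Rightarrow> real"
    proof -
      have "(\<Sum>k<N'. f (y k)) = (\<Sum>k<N'. f (y (idx (R ! k))))" using idx by simp
      also have "\<dots> = (\<Sum>C\<in>?PS. f (y (idx C)))" by (rule sumR)
      also have "\<dots> = (\<Sum>v\<in>V. f (Y v))"
        unfolding rcosets_scaling Y_def by (rule sum.reindex[OF scaling_class_inj, unfolded o_def])
      finally show ?thesis ..
    qed
    have inner: "(\<Sum>k<N'. M $$ (i, k) * y k) = (\<Sum>\<phi>\<in>L ! i. w \<phi>) / d" if i: "i < N" for i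
    proof -
      have "(\<Sum>k<N'. M $$ (i, k) * y k) = (\<Sum>k<N'. (\<Sum>\<phi>\<in>L ! i \<inter> R ! k. w \<phi>) / d)"
      proof (rule sum.cong[OF refl])
        fix k assume "k \<in> {..<N'}"
        then have k: "k < N'" by simp
        have "w \<phi> = y k" if "\<phi> \<in> R ! k" for \<phi>
          unfolding w_def cS(7)[OF Rk[OF k] that] idx[OF k] ..
        then have "(\<Sum>\<phi>\<in>L ! i \<inter> R ! k. w \<phi>) = real (card (L ! i \<inter> R ! k)) * y k" by simp
        then show "M $$ (i, k) * y k = (\<Sum>\<phi>\<in>L ! i \<inter> R ! k. w \<phi>) / d" using Mik[OF i k] by simp
      qed
      also have "\<dots> = (\<Sum>C\<in>?PS. \<Sum>\<phi>\<in>L ! i \<inter> C. w \<phi>) / d"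
        using sumR[of "\<lambda>C. (\<Sum>\<phi>\<in>L ! i \<inter> C. w \<phi>) / d"] by (simp add: sum_divide_distrib)
      also have "(\<Sum>C\<in>?PS. \<Sum>\<phi>\<in>L ! i \<inter> C. w \<phi>) = (\<Sum>\<phi>\<in>L ! i. w \<phi>)"
        using cS cT(2,3)[OF Li[OF i]] by (intro sum_partition) auto
      finally show ?thesis .
    qed
    have "(\<Sum>i<N. (\<Sum>k<N'. M $$ (i, k) * y k)\<^sup>2) = (\<Sum>i<N. (\<Sum>\<phi>\<in>L ! i. w \<phi>)\<^sup>2) / d\<^sup>2"
      unfolding sum_divide_distrib[of _ "{..<N}"]
      by (intro sum.cong refl) (simp only: lessThan_iff inner power_divide)
    also have "(\<Sum>i<N. (\<Sum>\<phi>\<in>L ! i. w \<phi>)\<^sup>2) = (\<Sum>C\<in>?PT. (\<Sum>\<phi>\<in>C. w \<phi>)\<^sup>2)"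
      by (rule sumL)
    also have "\<dots> / d\<^sup>2 \<le> (real m / real p * (real q)\<^sup>2 * (\<Sum>v\<in>V. (Y v)\<^sup>2)) / d\<^sup>2"
      using coset_sum_bound[of w Y, OF wY] sumY[of "\<lambda>x. x"] y by (intro divide_right_mono) auto
    also have "\<dots> = (real m / real p) * (real q / (real q - 1)) * (\<Sum>v\<in>V. (Y v)\<^sup>2)"
    proof -
      have "(a * b\<^sup>2 * c) / (b * (b - 1)) = a * (b / (b - 1)) * c" if "b - 1 > 0" for a b c :: real
        using that by (simp add: power2_eq_square)
      then show ?thesis unfolding d2(1) using q1(1) by blast
    qed
    also have "\<dots> \<le> (real m / real p) * 2 * (\<Sum>v\<in>V. (Y v)\<^sup>2)"
    proof (intro mult_right_mono mult_left_mono)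
      show "real q / (real q - 1) \<le> 2" using \<open>real 4 \<le> real q\<close> q1(1) by (simp add: field_simps del: of_nat_power)
    qed (auto intro!: sum_nonneg)
    also have "(\<Sum>v\<in>V. (Y v)\<^sup>2) = (\<Sum>k<N'. (y k)\<^sup>2)" by (rule sumY)
    finally show ?thesis by (simp add: mult_ac)
  qed
  show "0 \<le> second_singular_value (norm_biadj A TT SS)"
    "second_singular_value (norm_biadj A TT SS) \<le> sqrt (2 * real m / real p)"
    unfolding M_def[symmetric]
    using second_singular_value_bounds[OF Mc N2 row col \<kappa> _ bound] by auto
qed

lemma q_real: "4 \<le> real q" "real (q - 1) = real q - 1" "real q > 1" "real q - 1 > 0" "real q \<le> 2 * (real q - 1)" "real q > 0"
proof -
  have "1 \<le> q" using q_ge_4 by linarith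
  then show "real (q - 1) = real q - 1" by (simp only: of_nat_diff of_nat_1)
  have "real 4 \<le> real q" using q_ge_4 by (simp only: of_nat_le_iff)
  then show *: "4 \<le> real q" by (simp only: of_nat_numeral)
  have "x > 1 \<and> x - 1 > 0 \<and> x \<le> 2 * (x - 1) \<and> x > 0" if "4 \<le> x" for x :: real using that by auto
  from this[OF *] show "real q > 1" "real q - 1 > 0" "real q \<le> 2 * (real q - 1)" "real q > 0" by blast+
qed

definition nn :: real where "nn = real ((q - 1) * q ^ m)"

lemma nn: "nn = (real q - 1) * real q ^ m" "nn > 0"
proof -
  show *: "nn = (real q - 1) * real q ^ m" unfolding nn_def of_nat_mult q_real(2) by simp
  show "nn > 0" unfolding * using q_real(4,6) by (intro mult_pos_pos zero_less_power)
qed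

text \<open>Cauchy--Schwarz over the right cosets of \<open>G\<close> that make up \<open>B\<close>,
  for the indicator of \<open>T\<close> minus its density \<open>t\<close>. As \<open>T\<close> is a
  union of right cosets of \<open>H\<close>, this function depends on \<open>v\<close> only and has
  mean zero, so \<open>coset_sum_bound\<close> applies. The factor 2 again bounds q / (q -
  1).\<close>

theorem expander_mixing:
  assumes B: "B \<subseteq> carrier A" "\<And>C. C \<in> rcosets\<^bsub>A\<^esub> TT \<Longrightarrow> C \<inter> B \<noteq> {} \<Longrightarrow> C \<subseteq> B"
    and T: "T \<subseteq> carrier A" "\<And>C. C \<in> rcosets\<^bsub>A\<^esub> SS \<Longrightarrow> C \<inter> T \<noteq> {} \<Longrightarrow> C \<subseteq> T"
  shows "real (card (B \<inter> T)) \<le> real (card B) * real (card T) / nn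
    + sqrt (2 * real m / real p) * sqrt (real (card B) * real (card T))"
proof -
  note cT = group.rcosets_facts[OF group_A subgroup_translation finite_A]
  note cS = group.rcosets_facts[OF group_A subgroup_scaling finite_A]
  have finB: "finite B" and finT: "finite T" using B(1) T(1) finite_A finite_subset by auto
  define t where "t = real (card T) / nn"
  define y where "y \<phi> = (if \<phi> \<in> T then 1 else 0) - t" for \<phi>
  define I where "I v = (if par (\<one>, v) \<in> T then 1 else (0::real))" for v
  define Y where "Y v = I v - t" for v
  have mem: "par (h, v) \<in> T \<longleftrightarrow> par (\<one>, v) \<in> T" if hv: "h \<in> H" "v \<in> V" for h v
  proof -
    have C: "par ` (H \<times> {v}) \<in> rcosets\<^bsub>A\<^esub> SS" unfolding rcosets_scaling using hv by blast
    have "par (h, v) \<in> par ` (H \<times> {v})" "par (\<one>, v) \<in> par ` (H \<times> {v})" using hv H_props(3) by auto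
    then show ?thesis using T(2)[OF C] by blast
  qed
  have yY: "y (par (h, v)) = Y v" if "h \<in> H" "v \<in> V" for h v
    using mem[OF that] by (simp add: y_def Y_def I_def)
  have cardT: "real (card T) = (real q - 1) * (\<Sum>v\<in>V. I v)"
  proof -
    have "real (card T) = (\<Sum>\<phi>\<in>carrier A. if \<phi> \<in> T then 1 else 0)"
      using T(1) finite_A by (simp add: sum.If_cases Int_absorb1)
    also have "\<dots> = (\<Sum>z\<in>H \<times> V. if par z \<in> T then 1 else 0)"
      unfolding carrier_A par_image[symmetric] by (rule sum.reindex[OF par_inj, unfolded o_def])
    also have "\<dots> = (\<Sum>(h, v)\<in>H \<times> V. I v)" using mem by (intro sum.cong) (auto simp: I_def)
    also have "\<dots> = (\<Sum>h\<in>H. \<Sum>v\<in>V. I v)" by (rule sum.cartesian_product[symmetric])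
    finally show ?thesis using H_props(5) q_real(2) by (simp only: sum_constant)
  qed
  have cV: "real (card V) = real q ^ m" by (simp only: card_V of_nat_power)
  note q1 = q_real(4)
  have qm0: "real q ^ m > 0" using q_real(6) by (rule zero_less_power)
  have tV: "t * real (card V) = (\<Sum>v\<in>V. I v)"
  proof -
    have "t = (\<Sum>v\<in>V. I v) / real q ^ m"
      unfolding t_def cardT nn(1) using q1 by (rule mult_divide_mult_cancel_left[OF less_imp_neq[THEN not_sym]])
    then show ?thesis unfolding cV using qm0 by (simp only:) simp
  qed
  have Y0: "(\<Sum>v\<in>V. Y v) = 0"
    unfolding Y_def sum_subtractf using tV by (simp add: mult.commute)
  have t0: "t \<ge> 0" unfolding t_def using nn(2) by simp
  \<comment> \<open>Centring an indicator does not increase its sum of squares, because the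
    deviations sum to zero.\<close>
  have YY: "(real q - 1) * (\<Sum>v\<in>V. (Y v)\<^sup>2) \<le> real (card T)"
  proof -
    have "(\<Sum>v\<in>V. (Y v)\<^sup>2) = (\<Sum>v\<in>V. I v - t * (I v + Y v))"
      by (intro sum.cong) (auto simp: Y_def I_def power2_eq_square algebra_simps)
    also have "\<dots> = (\<Sum>v\<in>V. I v) - t * ((\<Sum>v\<in>V. I v) + (\<Sum>v\<in>V. Y v))"
      by (simp only: sum_subtractf sum.distrib sum_distrib_left[symmetric])
    also have "\<dots> \<le> (\<Sum>v\<in>V. I v)"
      using t0 Y0 by (simp add: I_def sum_nonneg)
    finally show ?thesis unfolding cardT using q1 by (intro mult_left_mono) auto
  qed
  define P where "P = {C \<in> rcosets\<^bsub>A\<^esub> TT. C \<inter> B \<noteq> {}}"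
  have P: "P \<subseteq> rcosets\<^bsub>A\<^esub> TT" "finite P" "B = \<Union>P"
  proof -
    show "P \<subseteq> rcosets\<^bsub>A\<^esub> TT" by (auto simp: P_def)
    then show "finite P" using cT(1) finite_subset by blast
    show "B = \<Union>P"
    proof
      show "B \<subseteq> \<Union>P" using B(1) cT(4) by (fastforce simp: P_def)
      show "\<Union>P \<subseteq> B" using B(2) by (auto simp: P_def)
    qed
  qed
  have part: "(\<Sum>\<phi>\<in>B. f \<phi>) = (\<Sum>C\<in>P. \<Sum>\<phi>\<in>C. f \<phi>)" for f :: "_ \<Rightarrow> real"
  proof -
    have "(\<Sum>\<phi>\<in>B. f \<phi>) = (\<Sum>C\<in>P. \<Sum>\<phi>\<in>B \<inter> C. f \<phi>)"
    proof (rule sum_partition[symmetric])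
      show "finite C" if "C \<in> P" for C using that P(1) cT(2) by blast
      show "C \<inter> D = {}" if "C \<in> P" "D \<in> P" "C \<noteq> D" for C D using that P(1) cT(5) by blast
    qed (use P finB in auto)
    also have "\<dots> = (\<Sum>C\<in>P. \<Sum>\<phi>\<in>C. f \<phi>)"
      using P(3) by (intro sum.cong) auto
    finally show ?thesis .
  qed
  have cardB: "real (card B) = real (card P) * real q"
  proof -
    have "real (card B) = (\<Sum>C\<in>P. real (card C))" using part[of "\<lambda>_. 1"] by simp
    also have "\<dots> = (\<Sum>C\<in>P. real q)" using P(1) cT(6) card_translation_maps by (intro sum.cong) auto
    finally show ?thesis by simp
  qed
  have sy: "(\<Sum>\<phi>\<in>B. y \<phi>) = real (card (B \<inter> T)) - real (card B) * t"
    unfolding y_def sum_subtractf using finB by (simp add: sum.If_cases Int_def)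
  have "(\<Sum>\<phi>\<in>B. y \<phi>)\<^sup>2 = (\<Sum>C\<in>P. 1 * (\<Sum>\<phi>\<in>C. y \<phi>))\<^sup>2" by (simp add: part)
  also have "\<dots> \<le> (\<Sum>C\<in>P. 1\<^sup>2) * (\<Sum>C\<in>P. (\<Sum>\<phi>\<in>C. y \<phi>)\<^sup>2)" by (rule Cauchy_Schwarz_ineq_sum)
  also have "\<dots> \<le> real (card P) * (real m / real p * (real q)\<^sup>2 * (\<Sum>v\<in>V. (Y v)\<^sup>2))"
  proof -
    have "(\<Sum>C\<in>P. (\<Sum>\<phi>\<in>C. y \<phi>)\<^sup>2) \<le> (\<Sum>C\<in>rcosets\<^bsub>A\<^esub> TT. (\<Sum>\<phi>\<in>C. y \<phi>)\<^sup>2)"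
      using P(1) cT(1) by (intro sum_mono2) auto
    also have "\<dots> \<le> real m / real p * (real q)\<^sup>2 * (\<Sum>v\<in>V. (Y v)\<^sup>2)"
      using coset_sum_bound[of y Y, OF yY Y0] .
    finally have "(\<Sum>C\<in>P. (\<Sum>\<phi>\<in>C. y \<phi>)\<^sup>2) \<le> real m / real p * (real q)\<^sup>2 * (\<Sum>v\<in>V. (Y v)\<^sup>2)" .
    moreover have "(\<Sum>C\<in>P. 1\<^sup>2) = real (card P)" by simp
    ultimately show ?thesis by (simp only:) (rule mult_left_mono, assumption, simp)
  qed
  also have "\<dots> = (real m / real p) * real (card B) * (real q * (\<Sum>v\<in>V. (Y v)\<^sup>2))"
    unfolding cardB by (simp add: power2_eq_square mult_ac)
  also have "\<dots> \<le> (real m / real p) * real (card B) * (2 * real (card T))"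
  proof (intro mult_left_mono)
    have "real q * (\<Sum>v\<in>V. (Y v)\<^sup>2) \<le> (2 * (real q - 1)) * (\<Sum>v\<in>V. (Y v)\<^sup>2)"
    proof (rule mult_right_mono)
      show "real q \<le> 2 * (real q - 1)" by (rule q_real(5))
    qed (simp add: sum_nonneg)
    then show "real q * (\<Sum>v\<in>V. (Y v)\<^sup>2) \<le> 2 * real (card T)" using YY by linarith
  qed auto
  also have "\<dots> = (2 * real m / real p) * (real (card B) * real (card T))" by simp
  finally have "\<bar>\<Sum>\<phi>\<in>B. y \<phi>\<bar> \<le> sqrt ((2 * real m / real p) * (real (card B) * real (card T)))"
    by (intro real_le_rsqrt) simp
  then show ?thesis unfolding sy t_def real_sqrt_mult[of "2 * real m / real p"] by (simp add: abs_le_iff)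
qed

text \<open>Enlarge \<open>Z\<close> to the union of the cosets it meets, once for \<open>G\<close>
  and once for \<open>H\<close>. Each union exceeds \<open>Z\<close> by a factor of at most 1 / (1 -
  r), while mixing prevents two such unions of low density from having an intersection as large as
  \<open>Z\<close>.\<close>

theorem support_density:
  assumes Z: "Z \<subseteq> carrier A" "Z \<noteq> {}" and r: "0 < r" "r < (1::real)"
    and left: "\<And>C. C \<in> rcosets\<^bsub>A\<^esub> TT \<Longrightarrow> C \<inter> Z \<noteq> {} \<Longrightarrow> real (card (Z \<inter> C)) \<ge> (1 - r) * real (card C)"
    and right: "\<And>C. C \<in> rcosets\<^bsub>A\<^esub> SS \<Longrightarrow> C \<inter> Z \<noteq> {} \<Longrightarrow> real (card (Z \<inter> C)) \<ge> (1 - r) * real (card C)"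
  shows "real (card Z) / nn \<ge> (1 - r)\<^sup>2 - sqrt (2 * real m / real p)"
proof -
  define sat where "sat S = \<Union>{C \<in> rcosets\<^bsub>A\<^esub> S. C \<inter> Z \<noteq> {}}" for S
  have sat: "sat S \<subseteq> carrier A" "Z \<subseteq> sat S" "\<And>C. C \<in> rcosets\<^bsub>A\<^esub> S \<Longrightarrow> C \<inter> sat S \<noteq> {} \<Longrightarrow> C \<subseteq> sat S"
    "real (card Z) \<ge> (1 - r) * real (card (sat S))"
    if S: "subgroup S A" and *: "\<And>C. C \<in> rcosets\<^bsub>A\<^esub> S \<Longrightarrow> C \<inter> Z \<noteq> {} \<Longrightarrow> real (card (Z \<inter> C)) \<ge> (1 - r) * real (card C)"
    for S
  proof -
    note c = group.rcosets_facts[OF group_A S finite_A]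
    let ?P = "{C \<in> rcosets\<^bsub>A\<^esub> S. C \<inter> Z \<noteq> {}}"
    show 1: "sat S \<subseteq> carrier A" unfolding sat_def using c(3) by blast
    show 2: "Z \<subseteq> sat S" unfolding sat_def using Z(1) c(4) by fastforce
    show "C \<subseteq> sat S" if C: "C \<in> rcosets\<^bsub>A\<^esub> S" "C \<inter> sat S \<noteq> {}" for C
    proof -
      obtain D where D: "D \<in> ?P" "C \<inter> D \<noteq> {}" using C(2) unfolding sat_def by blast
      then have "C = D" using c(5)[OF C(1), of D] by blast
      then show ?thesis using D(1) unfolding sat_def by blast
    qed
    have part: "(\<Sum>C\<in>?P. \<Sum>\<phi>\<in>U \<inter> C. f \<phi>) = (\<Sum>\<phi>\<in>U. f \<phi>)" if "U \<subseteq> sat S" for U and f :: "_ \<Rightarrow> real"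
    proof (rule sum_partition)
      show "finite ?P" using c(1) by simp
      show "finite U" by (rule finite_subset[OF subset_trans[OF that 1] finite_A])
      show "U \<subseteq> \<Union>?P" using that unfolding sat_def .
      show "finite C" if "C \<in> ?P" for C using that c(2) by simp
      show "C \<inter> D = {}" if "C \<in> ?P" "D \<in> ?P" "C \<noteq> D" for C D using that c(5) by simp
    qed
    have "real (card (sat S)) = (\<Sum>C\<in>?P. real (card C))"
    proof -
      have "real (card (sat S)) = (\<Sum>C\<in>?P. real (card (sat S \<inter> C)))"
        using part[OF subset_refl, of "\<lambda>_. 1"] by simp
      also have "\<dots> = (\<Sum>C\<in>?P. real (card C))"
      proof (rule sum.cong[OF refl])
        fix C assume "C \<in> ?P"
        then have "sat S \<inter> C = C" unfolding sat_def by blast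
        then show "real (card (sat S \<inter> C)) = real (card C)" by simp
      qed
      finally show ?thesis .
    qed
    then have "(1 - r) * real (card (sat S)) = (\<Sum>C\<in>?P. (1 - r) * real (card C))"
      by (simp add: sum_distrib_left)
    also have "\<dots> \<le> (\<Sum>C\<in>?P. real (card (Z \<inter> C)))" using * by (intro sum_mono) auto
    also have "\<dots> = real (card Z)" using part[OF 2, of "\<lambda>_. 1"] by simp
    finally show "real (card Z) \<ge> (1 - r) * real (card (sat S))" .
  qed
  note B = sat[OF subgroup_translation left] and T = sat[OF subgroup_scaling right]
  have fin: "finite (sat TT)" "finite (sat SS)"
    using finite_subset[OF B(1) finite_A] finite_subset[OF T(1) finite_A] by auto
  define l where "l = sqrt (2 * real m / real p)"
  define z s t where "z = real (card Z) / nn" and "s = real (card (sat TT)) / nn" and "t = real (card (sat SS)) / nn"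
  have l0: "l \<ge> 0" by (simp add: l_def)
  have zpos: "z > 0"
    using Z finite_subset[OF Z(1) finite_A] nn(2) by (simp add: z_def card_gt_0_iff)
  have zs: "z \<ge> (1 - r) * s" "z \<ge> (1 - r) * t"
    using B(4) T(4) nn(2) by (simp_all add: z_def s_def t_def divide_right_mono)
  have zz: "z \<le> s" "z \<le> t"
  proof -
    have "card Z \<le> card (sat TT)" "card Z \<le> card (sat SS)"
      using B(2) T(2) fin by (auto intro!: card_mono)
    then show "z \<le> s" "z \<le> t" using nn(2) by (simp_all add: z_def s_def t_def divide_right_mono)
  qed
  have mix: "z \<le> s * t + l * sqrt (s * t)"
  proof -
    have "real (card Z) \<le> real (card (sat TT \<inter> sat SS))"
      using B(2) T(2) fin by (auto intro!: card_mono)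
    also have "\<dots> \<le> real (card (sat TT)) * real (card (sat SS)) / nn
        + l * sqrt (real (card (sat TT)) * real (card (sat SS)))"
      unfolding l_def by (rule expander_mixing[OF B(1,3) T(1,3)])
    finally have "z \<le> (real (card (sat TT)) * real (card (sat SS)) / nn
        + l * sqrt (real (card (sat TT)) * real (card (sat SS)))) / nn"
      unfolding z_def using nn(2) by (intro divide_right_mono) auto
    also have "\<dots> = s * t + l * (sqrt (real (card (sat TT)) * real (card (sat SS))) / nn)"
      by (simp add: s_def t_def add_divide_distrib)
    also have "sqrt (real (card (sat TT)) * real (card (sat SS))) / nn = sqrt (s * t)"
      using nn(2) by (simp add: s_def t_def real_sqrt_divide real_sqrt_mult)
    finally show ?thesis .
  qed
  \<comment> \<open>Here \<open>a\<close> is the larger and \<open>b\<close> the smaller density.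
    Mixing gives (1 - r) a \<le> z \<le> (b + l) a, hence b \<ge> 1 - r - l, and z \<ge> (1 - r) b
    finishes.\<close>
  have key: "z \<ge> (1 - r) * (1 - r - l)" if ab: "a \<ge> b" "b > 0" "z \<ge> (1 - r) * a" "z \<ge> (1 - r) * b"
    and mix: "z \<le> a * b + l * sqrt (a * b)" for a b
  proof -
    have "sqrt (a * b) \<le> sqrt (a * a)" using ab by (intro real_sqrt_le_mono mult_left_mono) auto
    then have "sqrt (a * b) \<le> a" using ab by simp
    then have "l * sqrt (a * b) \<le> l * a" using l0 by (intro mult_left_mono)
    then have "(1 - r) * a \<le> (b + l) * a" using mix ab(3) by (simp add: algebra_simps)
    then have "1 - r - l \<le> b" using ab by (simp add: mult_le_cancel_right)
    then have "(1 - r) * (1 - r - l) \<le> (1 - r) * b" using r by (intro mult_left_mono) auto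
    then show ?thesis using ab(4) by linarith
  qed
  have "z \<ge> (1 - r) * (1 - r - l)"
  proof (cases "s \<ge> t")
    case True
    then show ?thesis using key[of t s] zs zz zpos mix by auto
  next
    case False
    then show ?thesis using key[of s t] zs zz zpos mix by (auto simp: mult.commute)
  qed
  moreover have "(1 - r) * (1 - r - l) \<ge> (1 - r)\<^sup>2 - l"
  proof -
    have "(1 - r) * l \<le> 1 * l" using r l0 by (intro mult_right_mono) auto
    then show ?thesis by (simp add: power2_eq_square algebra_simps)
  qed
  ultimately show ?thesis unfolding z_def l_def by linarith
qed

end

section \<open>Linear codes from spaces of polynomials\<close>

text \<open>All dimension estimates below are made by counting: over a finite field the dimension is
  the exponent of the cardinality.\<close>

lemma (in vectorspace) card_carrier_eq:
  assumes "finite (carrier K)" "finite (carrier V)"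
  shows "card (carrier V) = card (carrier K) ^ dim"
proof -
  have "span (carrier V) = carrier V"
    using in_own_span[of "carrier V"] span_is_subset2[of "carrier V"] by auto
  then have fd: "fin_dim" unfolding fin_dim_def using assms(2) by blast
  obtain B where B: "finite B" "basis B" using finite_basis_exists[OF fd] by blast
  have BV: "B \<subseteq> carrier V" using B(2) by (simp add: basis_def)
  have ex: "\<forall>v. v \<in> carrier V \<longrightarrow> (\<exists>!a. a \<in> B \<rightarrow>\<^sub>E carrier K \<and> lincomb a B = v)"
    using basis_criterion[OF B(1) BV] B(2) by simp
  have "bij_betw (\<lambda>a. lincomb a B) (B \<rightarrow>\<^sub>E carrier K) (carrier V)"
    unfolding bij_betw_def
  proof
    have cl: "lincomb a B \<in> carrier V" if "a \<in> B \<rightarrow>\<^sub>E carrier K" for a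
      using that B(1) BV by (intro lincomb_closed) auto
    show "inj_on (\<lambda>a. lincomb a B) (B \<rightarrow>\<^sub>E carrier K)"
    proof (rule inj_onI)
      fix a b assume *: "a \<in> B \<rightarrow>\<^sub>E carrier K" "b \<in> B \<rightarrow>\<^sub>E carrier K" "lincomb a B = lincomb b B"
      have "\<exists>!c. c \<in> B \<rightarrow>\<^sub>E carrier K \<and> lincomb c B = lincomb a B" using ex cl[OF *(1)] by simp
      then show "a = b" by (rule alt_ex1E) (use * in simp)
    qed
    show "(\<lambda>a. lincomb a B) ` (B \<rightarrow>\<^sub>E carrier K) = carrier V"
    proof
      show "(\<lambda>a. lincomb a B) ` (B \<rightarrow>\<^sub>E carrier K) \<subseteq> carrier V" using cl by auto
      show "carrier V \<subseteq> (\<lambda>a. lincomb a B) ` (B \<rightarrow>\<^sub>E carrier K)"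
      proof
        fix v assume "v \<in> carrier V"
        then have "\<exists>!a. a \<in> B \<rightarrow>\<^sub>E carrier K \<and> lincomb a B = v" using ex by simp
        then show "v \<in> (\<lambda>a. lincomb a B) ` (B \<rightarrow>\<^sub>E carrier K)" by (elim ex1E) auto
      qed
    qed
  qed
  then have "card (carrier V) = card (B \<rightarrow>\<^sub>E carrier K)" by (simp add: bij_betw_same_card)
  also have "\<dots> = card (carrier K) ^ dim" using B by (simp add: card_funcsetE dim_basis)
  finally show ?thesis .
qed

context field
begin

interpretation P: domain "poly_ring R" using univ_poly_is_domain[OF carrier_is_subring] .

text \<open>Multiplication by constant polynomials stands in for the scalar action, so that no
  separate module structure on the polynomial ring has to be set up.\<close>

definition poly_subspace :: "'a list set \<Rightarrow> bool" where
  "poly_subspace W \<longleftrightarrow> W \<subseteq> carrier (poly_ring R) \<and> \<zero>\<^bsub>poly_ring R\<^esub> \<in> W \<and>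
     (\<forall>f\<in>W. \<forall>g\<in>W. f \<oplus>\<^bsub>poly_ring R\<^esub> g \<in> W) \<and>
     (\<forall>c\<in>carrier R. \<forall>f\<in>W. poly_of_const c \<otimes>\<^bsub>poly_ring R\<^esub> f \<in> W)"

lemma poly_of_const_closed: "c \<in> carrier R \<Longrightarrow> poly_of_const c \<in> carrier (poly_ring R)"
proof -
  assume "c \<in> carrier R"
  then have "polynomial (carrier R) (poly_of_const c)"
    unfolding poly_of_const_def by (intro normalize_gives_polynomial) simp
  then show ?thesis by (simp only: univ_poly_carrier)
qed

lemma length_poly_of_const: "length (poly_of_const c) \<le> Suc 0" "c \<noteq> \<zero> \<Longrightarrow> length (poly_of_const c) = 1"
  by (auto simp: poly_of_const_def)

lemma eval_poly_of_const: "c \<in> carrier R \<Longrightarrow> x \<in> carrier R \<Longrightarrow> eval (poly_of_const c) x = c"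
  by (auto simp: poly_of_const_def)

lemma length_const_mult:
  assumes "c \<in> carrier R" "f \<in> carrier (poly_ring R)"
  shows "length (poly_of_const c \<otimes>\<^bsub>poly_ring R\<^esub> f) \<le> length f"
proof (cases "f = []")
  case True
  then show ?thesis using P.r_null[OF poly_of_const_closed[OF assms(1)]] by (simp add: univ_poly_zero)
next
  case False
  then show ?thesis
    using length_mult_le[OF poly_of_const_closed[OF assms(1)] assms(2) length_poly_of_const(1), of "length f - 1"]
    by (cases f) auto
qed

lemma eval_ops:
  assumes "x \<in> carrier R" "f \<in> carrier (poly_ring R)" "g \<in> carrier (poly_ring R)"
  shows "eval (f \<oplus>\<^bsub>poly_ring R\<^esub> g) x = eval f x \<oplus> eval g x"
    "eval (f \<otimes>\<^bsub>poly_ring R\<^esub> g) x = eval f x \<otimes> eval g x"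
    "eval (f \<ominus>\<^bsub>poly_ring R\<^esub> g) x = eval f x \<ominus> eval g x"
    "eval f x \<in> carrier R"
proof -
  interpret ev: ring_hom_cring "poly_ring R" R "\<lambda>f. eval f x"
    by (rule eval_cring_hom[OF carrier_is_subring assms(1)])
  show "eval (f \<oplus>\<^bsub>poly_ring R\<^esub> g) x = eval f x \<oplus> eval g x"
    "eval (f \<otimes>\<^bsub>poly_ring R\<^esub> g) x = eval f x \<otimes> eval g x" "eval f x \<in> carrier R"
    using assms by auto
  show "eval (f \<ominus>\<^bsub>poly_ring R\<^esub> g) x = eval f x \<ominus> eval g x"
    using assms by (simp add: P.minus_eq minus_eq)
qed

lemma eval_closed: "x \<in> carrier R \<Longrightarrow> f \<in> carrier (poly_ring R) \<Longrightarrow> eval f x \<in> carrier R"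
  by (rule eval_ops(4))

lemma poly_subspace_minus:
  assumes W: "poly_subspace W" and "f \<in> W" "g \<in> W" shows "f \<ominus>\<^bsub>poly_ring R\<^esub> g \<in> W"
proof -
  have c: "f \<in> carrier (poly_ring R)" "g \<in> carrier (poly_ring R)" using assms by (auto simp: poly_subspace_def)
  have hom: "poly_of_const \<in> Ring.ring_hom R (poly_ring R)"
    using canonical_embedding_is_hom[OF carrier_is_subring] by simp
  interpret h: ring_hom_ring R "poly_ring R" poly_of_const
    by (rule ring_hom_ringI2[OF ring_axioms P.ring_axioms hom])
  have "poly_of_const (\<ominus> \<one>) \<otimes>\<^bsub>poly_ring R\<^esub> g = \<ominus>\<^bsub>poly_ring R\<^esub> g"
    using c by (simp add: P.l_minus)
  moreover have "poly_of_const (\<ominus> \<one>) \<otimes>\<^bsub>poly_ring R\<^esub> g \<in> W"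
  proof -
    have "\<ominus> \<one> \<in> carrier R" by simp
    then show ?thesis using W assms(3) unfolding poly_subspace_def by blast
  qed
  ultimately show ?thesis using W assms(2) by (simp add: poly_subspace_def P.minus_eq)
qed

lemma codeword_diff:
  assumes "f \<in> carrier (poly_ring R)" "g \<in> carrier (poly_ring R)" "S \<subseteq> carrier R"
  shows "{s \<in> S. codeword R S f s \<noteq> codeword R S g s} = {s \<in> S. eval (f \<ominus>\<^bsub>poly_ring R\<^esub> g) s \<noteq> \<zero>}"
proof (rule Collect_cong, rule conj_cong[OF refl])
  fix s assume s: "s \<in> S"
  then have sc: "s \<in> carrier R" using assms by auto
  note e = eval_ops(3)[OF sc assms(1,2)] eval_ops(4)[OF sc assms(1,2)] eval_ops(4)[OF sc assms(2,1)]
  show "(codeword R S f s \<noteq> codeword R S g s) = (eval (f \<ominus>\<^bsub>poly_ring R\<^esub> g) s \<noteq> \<zero>)"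
    using s e by (simp add: codeword_def)
qed

text \<open>Distances are weights of differences. The hypothesis \<open>nontriv\<close> provides two
  distinct codewords; for a single codeword \<open>min_dist\<close> would be 0 by the convention for
  the empty set.\<close>

lemma min_dist_ge:
  assumes W: "poly_subspace W" and S: "S \<subseteq> carrier R"
    and nontriv: "\<exists>f\<in>W. \<exists>s\<in>S. eval f s \<noteq> \<zero>"
    and d: "\<And>f. f \<in> W \<Longrightarrow> \<exists>s\<in>S. eval f s \<noteq> \<zero> \<Longrightarrow> d \<le> real (card {s \<in> S. eval f s \<noteq> \<zero>})"
  shows "d \<le> real (min_dist S (codeword R S ` W))"
proof -
  let ?D = "{hamming_dist S x y | x y. x \<in> codeword R S ` W \<and> y \<in> codeword R S ` W \<and> x \<noteq> y}"
  have Wc: "W \<subseteq> carrier (poly_ring R)" and W0: "\<zero>\<^bsub>poly_ring R\<^esub> \<in> W" using W by (auto simp: poly_subspace_def)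
  have "?D \<noteq> {}"
  proof -
    obtain f s where f: "f \<in> W" "s \<in> S" "eval f s \<noteq> \<zero>" using nontriv by blast
    have "codeword R S f s \<noteq> codeword R S \<zero>\<^bsub>poly_ring R\<^esub> s"
      using f by (simp add: codeword_def univ_poly_zero)
    then have "codeword R S f \<noteq> codeword R S \<zero>\<^bsub>poly_ring R\<^esub>" by auto
    then show ?thesis using f W0 by blast
  qed
  then have "Inf ?D \<in> ?D" by (rule Inf_nat_def1)
  then obtain x y where xy: "min_dist S (codeword R S ` W) = hamming_dist S x y"
    "x \<in> codeword R S ` W" "y \<in> codeword R S ` W" "x \<noteq> y" unfolding min_dist_def by auto
  then obtain f g where fg: "f \<in> W" "g \<in> W" "x = codeword R S f" "y = codeword R S g" by blast
  have diff: "{s \<in> S. x s \<noteq> y s} = {s \<in> S. eval (f \<ominus>\<^bsub>poly_ring R\<^esub> g) s \<noteq> \<zero>}"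
    unfolding fg(3,4) using fg Wc by (intro codeword_diff S) auto
  have "\<exists>s\<in>S. x s \<noteq> y s"
  proof (rule ccontr)
    assume "\<not> (\<exists>s\<in>S. x s \<noteq> y s)"
    then have "x = y" unfolding fg(3,4) codeword_def by (auto simp: fun_eq_iff restrict_def)
    then show False using xy(4) by simp
  qed
  then have "\<exists>s\<in>S. eval (f \<ominus>\<^bsub>poly_ring R\<^esub> g) s \<noteq> \<zero>" using diff by blast
  then have "d \<le> real (card {s \<in> S. eval (f \<ominus>\<^bsub>poly_ring R\<^esub> g) s \<noteq> \<zero>})"
    using d poly_subspace_minus[OF W fg(1,2)] by blast
  then show ?thesis unfolding xy(1) hamming_dist_def diff .
qed

text \<open>A list of length k has degree k - 1, which is the source of the summand 1. It is kept
  because it later absorbs the rounding of real degree bounds.\<close>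

lemma card_nonzeros_ge:
  assumes f: "f \<in> carrier (poly_ring R)" and S: "S \<subseteq> carrier R" "finite S"
    and len: "length f \<le> k" and nz: "\<exists>s\<in>S. eval f s \<noteq> \<zero>"
  shows "real (card {s \<in> S. eval f s \<noteq> \<zero>}) \<ge> real (card S) - real k + 1"
proof -
  have "f \<noteq> []" using nz by auto
  then have "card {s \<in> S. eval f s = \<zero>} \<le> length f - 1" "length f \<ge> 1"
    using card_roots_le_degree[OF f, of "{s \<in> S. eval f s = \<zero>}"] S by (auto simp: Suc_le_eq)
  then have "card {s \<in> S. eval f s = \<zero>} + 1 \<le> k" using len by linarith
  moreover have "card {s \<in> S. eval f s = \<zero>} + card {s \<in> S. eval f s \<noteq> \<zero>} = card S"
  proof -
    have "S = {s \<in> S. eval f s = \<zero>} \<union> {s \<in> S. eval f s \<noteq> \<zero>}" by auto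
    moreover have "card ({s \<in> S. eval f s = \<zero>} \<union> {s \<in> S. eval f s \<noteq> \<zero>}) =
        card {s \<in> S. eval f s = \<zero>} + card {s \<in> S. eval f s \<noteq> \<zero>}"
      using S(2) by (intro card_Un_disjoint) auto
    ultimately show ?thesis by simp
  qed
  ultimately show ?thesis by linarith
qed

lemma poly_subspace_length: "poly_subspace {f \<in> carrier (poly_ring R). length f \<le> k}"
  unfolding poly_subspace_def
proof (intro conjI ballI)
  show "\<zero>\<^bsub>poly_ring R\<^esub> \<in> {f \<in> carrier (poly_ring R). length f \<le> k}"
    using P.zero_closed by (simp add: univ_poly_zero)
  show "f \<oplus>\<^bsub>poly_ring R\<^esub> g \<in> {f \<in> carrier (poly_ring R). length f \<le> k}"
    if "f \<in> {f \<in> carrier (poly_ring R). length f \<le> k}" "g \<in> {f \<in> carrier (poly_ring R). length f \<le> k}" for f g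
    using that length_add_le[of f g] by auto
  show "poly_of_const c \<otimes>\<^bsub>poly_ring R\<^esub> f \<in> {f \<in> carrier (poly_ring R). length f \<le> k}"
    if "c \<in> carrier R" "f \<in> {f \<in> carrier (poly_ring R). length f \<le> k}" for c f
    using that length_const_mult[of c f] poly_of_const_closed[of c] by auto
qed auto

text \<open>Evaluations form a subspace of the function space, so \<open>card_carrier_eq\<close>
  turns its dimension into a count of codewords.\<close>

lemma card_code:
  assumes W: "poly_subspace W" and S: "S \<subseteq> carrier R" and fin: "finite (carrier R)"
  shows "card (codeword R S ` W) = card (carrier R) ^ code_dim R S (codeword R S ` W)"
proof -
  let ?C = "codeword R S ` W"
  have Wc: "W \<subseteq> carrier (poly_ring R)" using W by (simp add: poly_subspace_def)
  have md: "module R (func_space S)" by (rule func_space_is_module)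
  have "vectorspace R (func_space S)" using md field_axioms by (simp add: vectorspace_def)
  then interpret fs: vectorspace R "func_space S" .
  have sub: "?C \<subseteq> S \<rightarrow>\<^sub>E carrier R"
  proof
    fix x assume "x \<in> ?C"
    then obtain f where f: "f \<in> W" "x = codeword R S f" by blast
    have "eval f s \<in> carrier R" if "s \<in> S" for s using that f(1) Wc S by (intro eval_closed) auto
    then show "x \<in> S \<rightarrow>\<^sub>E carrier R" unfolding f(2) codeword_def by auto
  qed
  have "LinearCombinations.submodule R ?C (func_space S)"
  proof (rule LinearCombinations.submodule.intro)
    show "module R (func_space S)" by (rule md)
    show "?C \<subseteq> carrier (func_space S)" using sub by (simp add: func_space_def)
    show "x \<oplus>\<^bsub>func_space S\<^esub> y \<in> ?C" if x: "x \<in> ?C" and y: "y \<in> ?C" for x y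
    proof -
      obtain f g where fg: "f \<in> W" "g \<in> W" "x = codeword R S f" "y = codeword R S g" using x y by blast
      have "x \<oplus>\<^bsub>func_space S\<^esub> y = codeword R S (f \<oplus>\<^bsub>poly_ring R\<^esub> g)"
      proof
        fix s
        have "eval (f \<oplus>\<^bsub>poly_ring R\<^esub> g) s = eval f s \<oplus> eval g s" if "s \<in> S"
          using that fg(1,2) Wc S by (intro eval_ops) auto
        then show "(x \<oplus>\<^bsub>func_space S\<^esub> y) s = codeword R S (f \<oplus>\<^bsub>poly_ring R\<^esub> g) s"
          unfolding fg(3,4) by (simp add: func_space_def codeword_def)
      qed
      then show ?thesis using W fg by (auto simp: poly_subspace_def)
    qed
    show "\<zero>\<^bsub>func_space S\<^esub> \<in> ?C"
    proof -
      have "\<zero>\<^bsub>func_space S\<^esub> = codeword R S \<zero>\<^bsub>poly_ring R\<^esub>"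
        by (auto simp: func_space_def codeword_def univ_poly_zero)
      then show ?thesis using W by (auto simp: poly_subspace_def)
    qed
    show "c \<odot>\<^bsub>func_space S\<^esub> x \<in> ?C" if c: "c \<in> carrier R" and x: "x \<in> ?C" for c x
    proof -
      obtain f where f: "f \<in> W" "x = codeword R S f" using x by blast
      have "c \<odot>\<^bsub>func_space S\<^esub> x = codeword R S (poly_of_const c \<otimes>\<^bsub>poly_ring R\<^esub> f)"
      proof
        fix s
        have "eval (poly_of_const c \<otimes>\<^bsub>poly_ring R\<^esub> f) s = c \<otimes> eval f s" if s: "s \<in> S"
        proof -
          have "s \<in> carrier R" "f \<in> carrier (poly_ring R)" using s f(1) Wc S by auto
          then show ?thesis
            using eval_ops(2)[OF _ poly_of_const_closed[OF c], of s f] eval_poly_of_const[OF c, of s] by simp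
        qed
        then show "(c \<odot>\<^bsub>func_space S\<^esub> x) s = codeword R S (poly_of_const c \<otimes>\<^bsub>poly_ring R\<^esub> f) s"
          unfolding f(2) by (simp add: func_space_def codeword_def)
      qed
      then show ?thesis using W f c by (auto simp: poly_subspace_def)
    qed
  qed
  then have "subspace R ?C (func_space S)" using fs.vectorspace_axioms by (simp add: subspace_def)
  then have vs: "vectorspace R ((func_space S)\<lparr>carrier := ?C\<rparr>)" by (rule fs.subspace_is_vs)
  have "finite S" using S fin finite_subset by blast
  then have "finite ?C" using finite_subset[OF sub] fin by (simp add: finite_PiE)
  then show ?thesis using vectorspace.card_carrier_eq[OF vs fin] by (simp add: code_dim_def)
qed

lemma card_carrier_ge_2: "finite (carrier R) \<Longrightarrow> card (carrier R) \<ge> 2"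
proof -
  assume "finite (carrier R)"
  then have "card {\<zero>, \<one>} \<le> card (carrier R)" by (intro card_mono) auto
  then show ?thesis by simp
qed

lemma card_polys_le:
  assumes fin: "finite (carrier R)"
  shows "finite {f \<in> carrier (poly_ring R). length f \<le> k}"
    "card {f \<in> carrier (poly_ring R). length f \<le> k} \<le> card (carrier R) ^ k"
proof -
  let ?L = "{xs. set xs \<subseteq> carrier R \<and> length xs = k}"
  have finL: "finite ?L" using finite_lists_length_eq[OF fin] by (simp add: conj_commute)
  \<comment> \<open>Padding with leading zeros embeds the polynomials into the lists of length
    exactly \<open>k\<close>; \<open>normalize\<close> undoes it.\<close>
  let ?pad = "\<lambda>f::'a list. replicate (k - length f) \<zero> @ f"
  have inj: "inj_on ?pad {f \<in> carrier (poly_ring R). length f \<le> k}"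
  proof (rule inj_onI)
    fix f g assume *: "f \<in> {f \<in> carrier (poly_ring R). length f \<le> k}"
      "g \<in> {f \<in> carrier (poly_ring R). length f \<le> k}" "?pad f = ?pad g"
    then have pol: "polynomial (carrier R) f" "polynomial (carrier R) g" by (auto simp: univ_poly_carrier)
    have "f = normalize (?pad f)"
      using normalize_replicate_zero[of "k - length f" f] normalize_polynomial[OF pol(1)] by simp
    also have "\<dots> = g"
      unfolding *(3) using normalize_replicate_zero[of "k - length g" g] normalize_polynomial[OF pol(2)] by simp
    finally show "f = g" .
  qed
  have sub: "?pad ` {f \<in> carrier (poly_ring R). length f \<le> k} \<subseteq> ?L"
  proof
    fix x assume "x \<in> ?pad ` {f \<in> carrier (poly_ring R). length f \<le> k}"
    then obtain f where f: "x = ?pad f" "polynomial (carrier R) f" "length f \<le> k"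
      by (auto simp: univ_poly_carrier)
    then show "x \<in> ?L" using polynomial_incl[OF f(2)] by (auto simp: set_replicate_conv_if)
  qed
  show "finite {f \<in> carrier (poly_ring R). length f \<le> k}"
    using inj finite_subset[OF sub finL] by (rule finite_imageD[rotated])
  show "card {f \<in> carrier (poly_ring R). length f \<le> k} \<le> card (carrier R) ^ k"
    using card_inj_on_le[OF inj sub finL] card_lists_length_eq[OF fin] by simp
qed

lemma rs_code_eq: "rs_code R S k = codeword R S ` {f \<in> carrier (poly_ring R). length f \<le> nat \<lceil>k\<rceil>}"
  by (simp add: rs_code_def pdeg_less_iff)

lemma rs_code_rate:
  assumes fin: "finite (carrier R)" and S: "S \<subseteq> carrier R" and k: "0 \<le> k"
  shows "code_rate R S (rs_code R S k) \<le> (k + 1) / real (card S)"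
proof -
  let ?Q = "card (carrier R)" and ?W = "{f \<in> carrier (poly_ring R). length f \<le> nat \<lceil>k\<rceil>}"
  have "?Q ^ code_dim R S (rs_code R S k) = card (rs_code R S k)"
    unfolding rs_code_eq using card_code[OF poly_subspace_length S fin] by simp
  also have "\<dots> \<le> card ?W" unfolding rs_code_eq by (rule card_image_le[OF card_polys_le(1)[OF fin]])
  also have "\<dots> \<le> ?Q ^ nat \<lceil>k\<rceil>" by (rule card_polys_le(2)[OF fin])
  finally have "code_dim R S (rs_code R S k) \<le> nat \<lceil>k\<rceil>"
    using card_carrier_ge_2[OF fin] by (simp add: power_le_imp_le_exp)
  then have "real (code_dim R S (rs_code R S k)) \<le> real (nat \<lceil>k\<rceil>)" by simp
  also have "\<dots> \<le> k + 1" using k by linarith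
  finally show ?thesis unfolding code_rate_def by (intro divide_right_mono) auto
qed

lemma rs_code_dist:
  assumes fin: "finite (carrier R)" and S: "S \<subseteq> carrier R" "S \<noteq> {}" and k: "0 < k"
  shows "rel_min_dist S (rs_code R S k) \<ge> (real (card S) - k) / real (card S)"
proof -
  have finS: "finite S" using S fin finite_subset by blast
  have "real (card S) - k \<le> real (min_dist S (rs_code R S k))"
    unfolding rs_code_eq
  proof (rule min_dist_ge[OF poly_subspace_length S(1)])
    have "poly_of_const \<one> \<in> {f \<in> carrier (poly_ring R). length f \<le> nat \<lceil>k\<rceil>}"
    proof -
      have "1 \<le> nat \<lceil>k\<rceil>" using k by linarith
      then show ?thesis using poly_of_const_closed[of \<one>] length_poly_of_const(1)[of \<one>] by auto
    qed
    moreover obtain s where "s \<in> S" using S(2) by blast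
    moreover have "eval (poly_of_const \<one>) s \<noteq> \<zero>" using eval_poly_of_const[of \<one> s] \<open>s \<in> S\<close> S(1) by auto
    ultimately show "\<exists>f\<in>{f \<in> carrier (poly_ring R). length f \<le> nat \<lceil>k\<rceil>}. \<exists>s\<in>S. eval f s \<noteq> \<zero>" by blast
    fix f assume f: "f \<in> {f \<in> carrier (poly_ring R). length f \<le> nat \<lceil>k\<rceil>}" "\<exists>s\<in>S. eval f s \<noteq> \<zero>"
    have "real (card {s \<in> S. eval f s \<noteq> \<zero>}) \<ge> real (card S) - real (nat \<lceil>k\<rceil>) + 1"
      using f by (intro card_nonzeros_ge S finS) auto
    \<comment> \<open>Rounding up costs less than 1, which the summand 1 from the root count
      repays.\<close>
    moreover have "real (nat \<lceil>k\<rceil>) < k + 1" using k by linarith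
    ultimately show "real (card S) - k \<le> real (card {s \<in> S. eval f s \<noteq> \<zero>})" by linarith
  qed
  then show ?thesis unfolding rel_min_dist_def by (intro divide_right_mono) auto
qed

text \<open>Polynomials of pairwise distinct degrees are linearly independent.\<close>

lemma card_poly_subspace_ge:
  assumes W: "poly_subspace W" and fin: "finite (carrier R)" "finite W"
    and U: "U \<subseteq> W" "finite U" "inj_on length U" "[] \<notin> U"
  shows "card W \<ge> card (carrier R) ^ card U"
proof -
  let ?Q = "card (carrier R)"
  have Wc: "W \<subseteq> carrier (poly_ring R)" using W by (simp add: poly_subspace_def)
  \<comment> \<open>\<open>W'\<close> plays the role of the span of \<open>U\<close>, remembered
    only through its size and a bound on lengths. Elements of \<open>U\<close> are added in order of
    increasing length, so each new one is longer than everything obtained so far.\<close>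
  have "\<exists>W'\<subseteq>W. card W' = ?Q ^ card U \<and> (\<forall>f\<in>W'. f = [] \<or> (\<exists>u\<in>U. length f \<le> length u))"
    using U(2,1,3,4)
  proof (induction U rule: finite_ranking_induct[where f = length])
    case empty
    show ?case using W by (intro exI[of _ "{\<zero>\<^bsub>poly_ring R\<^esub>}"]) (auto simp: poly_subspace_def univ_poly_zero)
  next
    case (insert x U)
    have U: "U \<subseteq> W" "inj_on length U" "[] \<notin> U" using insert.prems by (auto intro: inj_on_subset)
    show ?case
    proof (cases "x \<in> U")
      case True
      then show ?thesis using insert.IH[OF U] by (simp add: insert_absorb)
    next
      case False
      obtain W' where W': "W' \<subseteq> W" "card W' = ?Q ^ card U" "\<forall>f\<in>W'. f = [] \<or> (\<exists>u\<in>U. length f \<le> length u)"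
        using insert.IH[OF U] by blast
      have x: "x \<in> W" "x \<noteq> []" "x \<in> carrier (poly_ring R)" using insert.prems Wc by auto
      have lt: "length u < length x" if "u \<in> U" for u
        using insert.hyps(2)[OF that] insert.prems(2) that False by (metis inj_on_contraD insertI1 insertI2 le_neq_implies_less)
      have lt': "length f < length x" if "f \<in> W'" for f
        using W'(3) that lt x(2) by (metis le_less_trans length_greater_0_conv list.size(3))
      let ?h = "\<lambda>(c, f). poly_of_const c \<otimes>\<^bsub>poly_ring R\<^esub> x \<oplus>\<^bsub>poly_ring R\<^esub> f"
      have inj: "inj_on ?h (carrier R \<times> W')"
      proof (rule inj_onI, clarify)
        fix c f d g assume *: "c \<in> carrier R" "f \<in> W'" "d \<in> carrier R" "g \<in> W'"
          "poly_of_const c \<otimes>\<^bsub>poly_ring R\<^esub> x \<oplus>\<^bsub>poly_ring R\<^esub> f = poly_of_const d \<otimes>\<^bsub>poly_ring R\<^esub> x \<oplus>\<^bsub>poly_ring R\<^esub> g"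
        have fgc: "f \<in> carrier (poly_ring R)" "g \<in> carrier (poly_ring R)" using * W' Wc by auto
        have pc: "poly_of_const c \<in> carrier (poly_ring R)" "poly_of_const d \<in> carrier (poly_ring R)"
          using * poly_of_const_closed by auto
        \<comment> \<open>Read as division by \<open>x\<close> with the shorter polynomial as
          remainder; uniqueness of division determines both the remainder and the constant.\<close>
        have "f \<oplus>\<^bsub>poly_ring R\<^esub> poly_of_const c \<otimes>\<^bsub>poly_ring R\<^esub> x = g \<oplus>\<^bsub>poly_ring R\<^esub> poly_of_const d \<otimes>\<^bsub>poly_ring R\<^esub> x"
          using *(5) fgc pc x by (simp add: P.a_comm)
        from division_unique[OF x(3) fgc(1) lt'[OF *(2)] fgc(2) lt'[OF *(4)] pc this]
        have "f = g" "poly_of_const c = poly_of_const d" by auto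
        moreover have "c = d"
        proof -
          have "c = eval (poly_of_const c) \<zero>" by (rule eval_poly_of_const[symmetric, OF *(1) zero_closed])
          also have "\<dots> = eval (poly_of_const d) \<zero>" by (simp only: \<open>poly_of_const c = poly_of_const d\<close>)
          also have "\<dots> = d" by (rule eval_poly_of_const[OF *(3) zero_closed])
          finally show ?thesis .
        qed
        ultimately show "c = d \<and> f = g" by simp
      qed
      have sub: "?h ` (carrier R \<times> W') \<subseteq> W"
        using W W' x by (auto simp: poly_subspace_def)
      have "card (?h ` (carrier R \<times> W')) = ?Q ^ card (Set.insert x U)"
        using card_image[OF inj] W'(2) False insert.hyps(1) by (simp add: card_cartesian_product)
      moreover have "\<forall>f\<in>?h ` (carrier R \<times> W'). f = [] \<or> (\<exists>u\<in>Set.insert x U. length f \<le> length u)"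
      proof (intro ballI disjI2)
        fix h assume "h \<in> ?h ` (carrier R \<times> W')"
        then obtain c f where cf: "c \<in> carrier R" "f \<in> W'"
          "h = poly_of_const c \<otimes>\<^bsub>poly_ring R\<^esub> x \<oplus>\<^bsub>poly_ring R\<^esub> f" by auto
        have "length h \<le> length x"
          unfolding cf(3) using length_add_le[of "poly_of_const c \<otimes>\<^bsub>poly_ring R\<^esub> x" f]
            length_const_mult[OF cf(1) x(3)] lt'[OF cf(2)] by simp
        then show "\<exists>u\<in>Set.insert x U. length h \<le> length u" by blast
      qed
      ultimately show ?thesis using sub by blast
    qed
  qed
  then obtain W' where "W' \<subseteq> W" "card W' = ?Q ^ card U" by blast
  then show ?thesis using card_mono[OF fin(2)] by metis
qed

lemma base_filtration_subspace:
  assumes u: "u \<in> carrier (poly_ring R)" shows "poly_subspace (base_filtration u N)"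
  unfolding poly_subspace_def
proof (intro conjI ballI subsetI)
  show "f \<in> carrier (poly_ring R)" if "f \<in> base_filtration u N" for f by (rule base_filtration_closed[OF u that])
  show "\<zero>\<^bsub>poly_ring R\<^esub> \<in> base_filtration u N" by (rule base_filtration.zero)
  show "f \<oplus>\<^bsub>poly_ring R\<^esub> g \<in> base_filtration u N" if "f \<in> base_filtration u N" "g \<in> base_filtration u N" for f g
    by (rule base_filtration_add[OF u that])
  show "poly_of_const c \<otimes>\<^bsub>poly_ring R\<^esub> f \<in> base_filtration u N" if c: "c \<in> carrier R" and f: "f \<in> base_filtration u N" for c f
    using f
  proof induction
    case zero
    then show ?case using poly_of_const_closed[OF c] base_filtration.zero by simp
  next
    case (step d f)
    note f = base_filtration_closed[OF u step.hyps(3)]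
    have "poly_of_const c \<otimes>\<^bsub>poly_ring R\<^esub> (d \<oplus>\<^bsub>poly_ring R\<^esub> f \<otimes>\<^bsub>poly_ring R\<^esub> u) =
      poly_of_const c \<otimes>\<^bsub>poly_ring R\<^esub> d \<oplus>\<^bsub>poly_ring R\<^esub> (poly_of_const c \<otimes>\<^bsub>poly_ring R\<^esub> f) \<otimes>\<^bsub>poly_ring R\<^esub> u"
      using poly_of_const_closed[OF c] step.hyps(1) f u by (simp add: P.r_distr P.m_assoc)
    moreover have "length (poly_of_const c \<otimes>\<^bsub>poly_ring R\<^esub> d) \<le> N"
      using length_const_mult[OF c step.hyps(1)] step.hyps(2) by simp
    ultimately show ?case
      using base_filtration.step[OF _ _ step.IH] poly_of_const_closed[OF c] step.hyps(1) by simp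
  qed
qed

end

section \<open>Counting lattice points in mixed radix\<close>

text \<open>\<open>digit_points Q ws\<close> consists of the pairs (value, weight) of mixed-radix expansions in which the
  digit with weight \<open>w\<close> has radix \<open>Q div w\<close>; the head of the list is the most significant digit.\<close>

fun radix_prod :: "nat \<Rightarrow> nat list \<Rightarrow> nat" where
  "radix_prod Q [] = 1"
| "radix_prod Q (w # ws) = radix_prod Q ws * (Q div w)"

definition extend_digit :: "nat \<Rightarrow> nat \<Rightarrow> nat \<Rightarrow> (nat \<times> nat) set \<Rightarrow> (nat \<times> nat) set" where
  "extend_digit B w T S = (\<lambda>(i, d, e). (d + B * i, e + w * i)) ` ({..<T} \<times> S)"

lemma extend_digitE:
  assumes "z \<in> extend_digit B w T S"
  obtains i d e where "i < T" "(d, e) \<in> S" "fst z = d + B * i" "snd z = e + w * i"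
  using assms by (auto simp: extend_digit_def)

fun digit_points :: "nat \<Rightarrow> nat list \<Rightarrow> (nat \<times> nat) set" where
  "digit_points Q [] = {(0, 0)}"
| "digit_points Q (w # ws) = extend_digit (radix_prod Q ws) w (Q div w) (digit_points Q ws)"

text \<open>The exponent \<open>0\<close> makes a truncated power necessary: a plain \<open>max 0 x ^ k\<close> is \<open>1\<close> for \<open>k = 0\<close> and
  negative \<open>x\<close>.\<close>

definition pos_pow :: "nat \<Rightarrow> real \<Rightarrow> real" where
  "pos_pow k x = (if x \<le> 0 then 0 else x ^ k)"

lemma power_diff_le:
  fixes u v :: real
  assumes "0 \<le> v" "v \<le> u"
  shows "u ^ Suc k - v ^ Suc k \<le> real (Suc k) * (u - v) * u ^ k"
proof (induction k)
  case (Suc k)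
  have "u ^ Suc (Suc k) - v ^ Suc (Suc k) = u * (u ^ Suc k - v ^ Suc k) + (u - v) * v ^ Suc k"
    by (simp add: algebra_simps)
  also have "\<dots> \<le> u * (real (Suc k) * (u - v) * u ^ k) + (u - v) * u ^ Suc k"
    using assms Suc.IH by (intro add_mono mult_left_mono power_mono) auto
  also have "\<dots> = real (Suc (Suc k)) * (u - v) * u ^ Suc k" by (simp add: algebra_simps)
  finally show ?case .
qed simp

text \<open>The difference is the integral of k + 1 times the truncated \<open>k\<close>-th power
  over an interval of length \<open>w\<close> ending at \<open>x\<close>, bounded by the value at
  its right end.\<close>

lemma pos_pow_step:
  assumes "0 < w"
  shows "pos_pow (Suc k) x - pos_pow (Suc k) (x - w) \<le> real (Suc k) * w * pos_pow k x"
proof (cases "x \<le> 0")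
  case True
  then show ?thesis using assms by (simp add: pos_pow_def)
next
  case False
  define v where "v = max 0 (x - w)"
  have v: "0 \<le> v" "v \<le> x" "x - v \<le> w" using False assms by (auto simp: v_def)
  have "pos_pow (Suc k) (x - w) = v ^ Suc k" by (auto simp: pos_pow_def v_def max_def)
  then have "pos_pow (Suc k) x - pos_pow (Suc k) (x - w) = x ^ Suc k - v ^ Suc k"
    using False by (simp add: pos_pow_def)
  also have "\<dots> \<le> real (Suc k) * (x - v) * x ^ k" using v by (intro power_diff_le)
  also have "\<dots> \<le> real (Suc k) * w * x ^ k"
    using v False by (intro mult_right_mono mult_left_mono) auto
  finally show ?thesis using False by (simp add: pos_pow_def)
qed

text \<open>Telescoping of \<open>pos_pow_step\<close>. A sum over slices of a simplex is compared
  with a volume, in the direction that lower bounds on lattice point counts require.\<close>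

lemma pos_pow_sum:
  assumes "0 < w"
  shows "pos_pow (Suc k) x - pos_pow (Suc k) (x - w * real T) \<le> real (Suc k) * w * (\<Sum>i<T. pos_pow k (x - w * real i))"
proof (induction T)
  case (Suc T)
  have "pos_pow (Suc k) (x - w * real T) - pos_pow (Suc k) (x - w * real (Suc T))
      \<le> real (Suc k) * w * pos_pow k (x - w * real T)"
    using pos_pow_step[OF assms, of k "x - w * real T"] by (simp add: algebra_simps)
  then show ?case using Suc.IH by (simp add: distrib_left del: of_nat_Suc)
qed simp

lemma finite_digit_points: "finite (digit_points Q ws)"
  by (induction ws) (auto simp: extend_digit_def)

lemma digit_points_less:
  assumes "\<And>w. w \<in> set ws \<Longrightarrow> w dvd Q" "Q > 0" "(d, e) \<in> digit_points Q ws"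
  shows "d < radix_prod Q ws"
  using assms(1,3)
proof (induction ws arbitrary: d e)
  case (Cons w ws)
  then obtain i d' e' where i: "i < Q div w" "(d', e') \<in> digit_points Q ws" "d = d' + radix_prod Q ws * i"
    by (auto simp: extend_digit_def)
  have "d < radix_prod Q ws + radix_prod Q ws * i" using Cons.IH[OF _ i(2)] Cons.prems(1) i(3) by simp
  also have "\<dots> = radix_prod Q ws * Suc i" by simp
  also have "\<dots> \<le> radix_prod Q ws * (Q div w)" using i(1) by (intro mult_le_mono2) simp
  finally show ?case by simp
qed simp

text \<open>Division with remainder by \<open>B\<close> recovers the new digit, as all lower values
  are below \<open>B\<close>.\<close>

lemma extend_digit_inj:
  assumes "\<And>d e. (d, e) \<in> S \<Longrightarrow> d < B" "inj_on fst S"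
  shows "inj_on fst (extend_digit B w T S)" "inj_on (\<lambda>(i, d, e). (d + B * i, e + w * i)) ({..<T} \<times> S)"
proof -
  have key: "i = i' \<and> d = d' \<and> e = e'"
    if "(d, e) \<in> S" "(d', e') \<in> S" "d + B * i = d' + B * i'" for i i' d d' e e'
  proof -
    have "d < B" "d' < B" using that assms(1) by auto
    then have "(d + B * i) div B = i" "(d' + B * i') div B = i'" by auto
    then have "i = i'" using that(3) by simp
    moreover have "d = d'" using that(3) \<open>i = i'\<close> by simp
    moreover have "e = e'" using inj_onD[OF assms(2), of "(d, e)" "(d', e')"] that \<open>d = d'\<close> by simp
    ultimately show ?thesis by simp
  qed
  show "inj_on fst (extend_digit B w T S)"
  proof (rule inj_onI)
    fix z z' assume "z \<in> extend_digit B w T S" "z' \<in> extend_digit B w T S" "fst z = fst z'"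
    then obtain i d e i' d' e' where "z = (d + B * i, e + w * i)" "z' = (d' + B * i', e' + w * i')"
      "(d, e) \<in> S" "(d', e') \<in> S" "d + B * i = d' + B * i'" by (auto simp: extend_digit_def)
    then show "z = z'" using key by metis
  qed
  show "inj_on (\<lambda>(i, d, e). (d + B * i, e + w * i)) ({..<T} \<times> S)"
  proof (rule inj_onI)
    fix z z' assume *: "z \<in> {..<T} \<times> S" "z' \<in> {..<T} \<times> S"
      "(\<lambda>(i, d, e). (d + B * i, e + w * i)) z = (\<lambda>(i, d, e). (d + B * i, e + w * i)) z'"
    obtain i d e i' d' e' where z: "z = (i, d, e)" "z' = (i', d', e')" by (cases z, cases z') auto
    have "(d, e) \<in> S" "(d', e') \<in> S" "d + B * i = d' + B * i'" using * z by auto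
    from key[OF this] show "z = z'" using z by simp
  qed
qed

lemma digit_points_inj:
  assumes "\<And>w. w \<in> set ws \<Longrightarrow> w dvd Q" "Q > 0"
  shows "inj_on fst (digit_points Q ws)"
  using assms(1)
proof (induction ws)
  case (Cons w ws)
  have d: "\<And>v. v \<in> set ws \<Longrightarrow> v dvd Q" using Cons.prems by simp
  show ?case unfolding digit_points.simps
    by (rule extend_digit_inj(1)[OF digit_points_less[OF d assms(2)] Cons.IH[OF d]])
qed simp

lemma extend_digit_count:
  assumes "\<And>d e. (d, e) \<in> S \<Longrightarrow> d < B" "inj_on fst S" "finite S"
  shows "card {z \<in> extend_digit B w T S. real (snd z) < x} =
    (\<Sum>i<T. card {z \<in> S. real (snd z) < x - real w * real i})"
proof -
  let ?f = "\<lambda>(i, d, e). (d + B * i, e + w * i)"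
  let ?I = "SIGMA i:{..<T}. {z \<in> S. real (snd z) < x - real w * real i}"
  have "{z \<in> extend_digit B w T S. real (snd z) < x} = ?f ` ?I"
  proof (intro equalityI subsetI)
    fix z assume z: "z \<in> {z \<in> extend_digit B w T S. real (snd z) < x}"
    then obtain i d e where i: "i < T" "(d, e) \<in> S" "z = (d + B * i, e + w * i)"
      by (auto simp: extend_digit_def)
    then have "(i, d, e) \<in> ?I" using z by simp
    moreover have "z = ?f (i, d, e)" using i(3) by simp
    ultimately show "z \<in> ?f ` ?I" by (rule rev_image_eqI)
  next
    fix z assume "z \<in> ?f ` ?I"
    then obtain i d e where i: "i < T" "(d, e) \<in> S" "real e < x - real w * real i" "z = (d + B * i, e + w * i)"
      by auto
    have "(i, d, e) \<in> {..<T} \<times> S" using i by simp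
    then have "z \<in> extend_digit B w T S" unfolding extend_digit_def
      by (rule rev_image_eqI) (simp add: i(4))
    then show "z \<in> {z \<in> extend_digit B w T S. real (snd z) < x}" using i(3,4) by simp
  qed
  moreover have "inj_on ?f ?I"
    using extend_digit_inj(2)[OF assms(1,2), where w=w and T=T] by (rule inj_on_subset) auto
  ultimately have "card {z \<in> extend_digit B w T S. real (snd z) < x} = card ?I"
    by (simp add: card_image)
  also have "\<dots> = (\<Sum>i<T. card {z \<in> S. real (snd z) < x - real w * real i})"
    using assms(3) by (intro card_SigmaI) auto
  finally show ?thesis .
qed

text \<open>Inductive step of the lattice point count: the slice where the new digit is i holds the
  points of weight below x - w i. The number \<open>T\<close> of digit values is left free because
  the most significant digit is later cut short by the degree bound; the subtracted power is the
  part of the simplex lost to the cut.\<close>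

lemma extend_digit_count_ge:
  assumes S: "\<And>d e. (d, e) \<in> S \<Longrightarrow> d < B" "inj_on fst S" "finite S" and w: "w > 0" and P: "P > 0"
    and IH: "\<And>y. y \<le> x \<Longrightarrow> real (card {z \<in> S. real (snd z) < y}) \<ge> pos_pow k y / (fact k * P)"
  shows "real (card {z \<in> extend_digit B w T S. real (snd z) < x}) \<ge>
    (pos_pow (Suc k) x - pos_pow (Suc k) (x - real w * real T)) / (fact (Suc k) * (P * real w))"
proof -
  have "(pos_pow (Suc k) x - pos_pow (Suc k) (x - real w * real T)) / (fact (Suc k) * (P * real w)) \<le>
      (real (Suc k) * real w * (\<Sum>i<T. pos_pow k (x - real w * real i))) / (fact (Suc k) * (P * real w))"
    using w P pos_pow_sum[of "real w" k x T] by (intro divide_right_mono) auto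
  also have "\<dots> = (\<Sum>i<T. pos_pow k (x - real w * real i)) / (fact k * P)"
    using w P by (simp add: field_simps del: of_nat_Suc)
  also have "\<dots> = (\<Sum>i<T. pos_pow k (x - real w * real i) / (fact k * P))" by (rule sum_divide_distrib)
  also have "\<dots> \<le> (\<Sum>i<T. real (card {z \<in> S. real (snd z) < x - real w * real i}))"
    by (intro sum_mono IH) simp
  also have "\<dots> = real (card {z \<in> extend_digit B w T S. real (snd z) < x})"
    by (subst extend_digit_count[OF S, where x=x and w=w and T=T]) (simp_all only: of_nat_sum)
  finally show ?thesis .
qed

lemma prod_list_real_pos: "\<forall>v\<in>set ws. v > 0 \<Longrightarrow> (\<Prod>v\<leftarrow>ws. real v) > 0"
  by (induction ws) auto

text \<open>The bound is the volume of the simplex of nonnegative points with weighted sum below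
  \<open>x\<close>. For \<open>x \<le> real Q\<close> the radices do not truncate it: a digit of
  weight \<open>w\<close> that reached \<open>Q div w\<close> would contribute the weight
  \<open>Q\<close> on its own.\<close>

lemma digit_points_count:
  assumes "\<And>w. w \<in> set ws \<Longrightarrow> w dvd Q" "Q > 0" "x \<le> real Q"
  shows "real (card {z \<in> digit_points Q ws. real (snd z) < x}) \<ge>
    pos_pow (length ws) x / (fact (length ws) * (\<Prod>w\<leftarrow>ws. real w))"
  using assms(1,3)
proof (induction ws arbitrary: x)
  case Nil
  show ?case
  proof (cases "x \<le> 0")
    case False
    then have "{z \<in> digit_points Q []. real (snd z) < x} = {(0, 0)}" by auto
    then show ?thesis using False by (simp add: pos_pow_def)
  qed (simp add: pos_pow_def)
next
  case (Cons w ws)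
  have d: "\<And>v. v \<in> set ws \<Longrightarrow> v dvd Q" and wQ: "w dvd Q" using Cons.prems by auto
  then have w0: "w > 0" using assms(2) by (auto intro!: Nat.gr0I)
  have "\<forall>v\<in>set ws. v > 0" using d assms(2) by (metis dvd_pos_nat)
  then have P: "(\<Prod>v\<leftarrow>ws. real v) > 0" using prod_list_real_pos by simp
  have "real w * real (Q div w) = real Q" using wQ by (metis dvd_mult_div_cancel of_nat_mult)
  then have z: "pos_pow (Suc (length ws)) (x - real w * real (Q div w)) = 0"
    using Cons.prems(2) by (simp add: pos_pow_def)
  have "real (card {z \<in> digit_points Q (w # ws). real (snd z) < x}) \<ge>
    (pos_pow (Suc (length ws)) x - pos_pow (Suc (length ws)) (x - real w * real (Q div w))) /
      (fact (Suc (length ws)) * ((\<Prod>v\<leftarrow>ws. real v) * real w))"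
    unfolding digit_points.simps
  proof (rule extend_digit_count_ge)
    show "pos_pow (length ws) y / (fact (length ws) * (\<Prod>v\<leftarrow>ws. real v)) \<le>
        real (card {z \<in> digit_points Q ws. real (snd z) < y})" if "y \<le> x" for y
      using Cons.IH[OF d, of y] that Cons.prems(2) by simp
  qed (use digit_points_less[OF d assms(2)] digit_points_inj[OF d assms(2)] finite_digit_points w0 P in auto)
  then show ?case unfolding z by (simp add: mult_ac)
qed

lemma pred_dvd_power_pred:
  fixes x :: nat
  assumes "x \<ge> 1"
  shows "x - 1 dvd x ^ k - 1"
proof (induction k)
  case (Suc k)
  have "x ^ k \<ge> 1" using assms by simp
  then have "x ^ Suc k - 1 = x * (x ^ k - 1) + (x - 1)" using assms by (simp add: diff_mult_distrib2)
  then show ?case using Suc by simp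
qed simp

section \<open>Polynomials with small g- and h-degree\<close>

context expander_setup
begin

abbreviation "hp \<equiv> h_poly F K"

lemma hp_eq: "hp = X [^]\<^bsub>poly_ring F\<^esub> (q - 1)"
  by (simp add: h_poly_def H_props(5))

lemma X_closed: "X \<in> carrier (poly_ring F)" "X [^]\<^bsub>poly_ring F\<^esub> (n::nat) \<in> carrier (poly_ring F)"
  using var_closed(1)[OF carrier_is_subring] var_pow_closed[OF carrier_is_subring] by auto

lemma hp_props: "hp \<in> carrier (poly_ring F)" "length hp = q"
  unfolding hp_eq using X_closed q_ge_4 by (simp_all add: var_pow_eq)

text \<open>A pair (degree, weight) in the format of \<open>digit_points\<close>. The degree is
  exact, which later gives linear independence, while the weight only bounds both base degrees, so
  that pairs add under multiplication. \<open>Suc\<close> converts degrees into lengths.\<close>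

definition realizable :: "nat \<times> nat \<Rightarrow> bool" where
  "realizable z \<longleftrightarrow> (\<exists>u\<in>carrier (poly_ring F). length u = Suc (fst z) \<and>
     u \<in> base_filtration g (Suc (snd z)) \<and> u \<in> base_filtration hp (Suc (snd z)))"

lemma realizable_mult:
  assumes "realizable (d, e)" "realizable (d', e')" shows "realizable (d + d', e + e')"
proof -
  obtain u where u: "u \<in> carrier (poly_ring F)" "length u = Suc d"
    "u \<in> base_filtration g (Suc e)" "u \<in> base_filtration hp (Suc e)" using assms(1) by (auto simp: realizable_def)
  obtain v where v: "v \<in> carrier (poly_ring F)" "length v = Suc d'"
    "v \<in> base_filtration g (Suc e')" "v \<in> base_filtration hp (Suc e')" using assms(2) by (auto simp: realizable_def)
  have "u \<noteq> []" "v \<noteq> []" using u v by auto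
  then have "length (u \<otimes>\<^bsub>poly_ring F\<^esub> v) = Suc (d + d')" using length_mult[OF u(1) v(1)] u v by simp
  then show ?thesis unfolding realizable_def
    using base_filtration_mult[OF g_carrier u(3) v(3)] base_filtration_mult[OF hp_props(1) u(4) v(4)] u v
    by (intro bexI[of _ "u \<otimes>\<^bsub>poly_ring F\<^esub> v"]) auto
qed

lemma realizable_one: "realizable (0, 0)"
proof -
  have c: "\<one>\<^bsub>poly_ring F\<^esub> \<in> carrier (poly_ring F)" "length \<one>\<^bsub>poly_ring F\<^esub> = Suc 0"
    by (simp, simp add: univ_poly_one)
  then show ?thesis unfolding realizable_def
    using base_filtration_const[OF g_carrier c(1), of "Suc 0"] base_filtration_const[OF hp_props(1) c(1), of "Suc 0"]
    by (intro bexI[of _ "\<one>\<^bsub>poly_ring F\<^esub>"]) auto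
qed

lemma realizable_pow: "realizable (d, e) \<Longrightarrow> realizable (d * i, e * i)"
  by (induction i) (use realizable_one realizable_mult in auto)

lemma realizable_X: "realizable (1, 1)"
proof -
  have l: "length (X :: 'a list) = 2" by (simp add: var_def)
  show ?thesis unfolding realizable_def
    using base_filtration_const[OF g_carrier X_closed(1), of 2] base_filtration_const[OF hp_props(1) X_closed(1), of 2] l X_closed(1)
    by (intro bexI[of _ "X"]) (auto simp: numeral_2_eq_2)
qed

lemma hp_pow_filtration: "hp [^]\<^bsub>poly_ring F\<^esub> (n::nat) \<in> base_filtration hp (Suc 0)"
proof (induction n)
  case 0
  have "length \<one>\<^bsub>poly_ring F\<^esub> = Suc 0" by (simp add: univ_poly_one)
  then show ?case using base_filtration_const[OF hp_props(1) P.one_closed] by simp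
next
  case (Suc n)
  then show ?case using base_filtration_base_mult[OF hp_props(1)] by simp
qed

lemma g_pow_filtration: "g [^]\<^bsub>poly_ring F\<^esub> (n::nat) \<in> base_filtration g (Suc 0)"
proof (induction n)
  case 0
  have "length \<one>\<^bsub>poly_ring F\<^esub> = Suc 0" by (simp add: univ_poly_one)
  then show ?case using base_filtration_const[OF g_carrier P.one_closed] by simp
next
  case (Suc n)
  then show ?case using base_filtration_base_mult[OF g_carrier] by simp
qed

text \<open>Modulo powers of \<open>X [^] (q - 1)\<close>, the exponents \<open>q ^ k * s\<close> and \<open>s\<close> agree.\<close>

lemma X_pow_filtration: "X [^]\<^bsub>poly_ring F\<^esub> (q ^ k * s) \<in> base_filtration hp (Suc s)"
proof -
  have "q - 1 dvd q ^ k - 1" by (rule pred_dvd_power_pred) (use p_ge_2 in simp)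
  then obtain M where M: "q ^ k - 1 = (q - 1) * M" by (rule dvdE)
  have "q ^ k \<ge> 1" using p_ge_2 by simp
  then have e: "q ^ k * s = s + (q - 1) * (M * s)"
    using M by (metis add.commute add_mult_distrib le_add_diff_inverse2 mult.assoc mult_1)
  have "X [^]\<^bsub>poly_ring F\<^esub> (q ^ k * s) = X [^]\<^bsub>poly_ring F\<^esub> s \<otimes>\<^bsub>poly_ring F\<^esub> hp [^]\<^bsub>poly_ring F\<^esub> (M * s)"
    unfolding e hp_eq using X_closed(1) by (simp add: P.nat_pow_mult P.nat_pow_pow)
  moreover have "X [^]\<^bsub>poly_ring F\<^esub> s \<in> base_filtration hp (Suc s)"
    by (rule base_filtration_const[OF hp_props(1) X_closed(2)]) (simp add: var_pow_eq)
  ultimately show ?thesis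
    using base_filtration_mult[OF hp_props(1) _ hp_pow_filtration, of _ s] by simp
qed

lemma g_frob: "g [^]\<^bsub>poly_ring F\<^esub> (p ^ k) =
    X [^]\<^bsub>poly_ring F\<^esub> (q * p ^ k) \<oplus>\<^bsub>poly_ring F\<^esub> X [^]\<^bsub>poly_ring F\<^esub> (p * p ^ k) \<oplus>\<^bsub>poly_ring F\<^esub> X [^]\<^bsub>poly_ring F\<^esub> (p ^ k)"
  unfolding g_poly_def
  using X_closed by (simp add: P.frobenius_pow_add[OF prime_p poly_ring_char[OF char_p]] P.nat_pow_pow)

lemma length_pow:
  assumes "f \<in> carrier (poly_ring F)" "length f = Suc d"
  shows "length (f [^]\<^bsub>poly_ring F\<^esub> (n::nat)) = Suc (d * n)"
proof (induction n)
  case 0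
  show ?case by (simp add: univ_poly_one)
next
  case (Suc n)
  then have "f [^]\<^bsub>poly_ring F\<^esub> n \<noteq> []" "f \<noteq> []" using assms by auto
  then show ?case using Suc length_mult[of "f [^]\<^bsub>poly_ring F\<^esub> n" f] assms by simp
qed

lemma realizable_g_pow:
  assumes "X [^]\<^bsub>poly_ring F\<^esub> (q * p ^ k) \<in> base_filtration hp (Suc s)"
    "X [^]\<^bsub>poly_ring F\<^esub> (p * p ^ k) \<in> base_filtration hp (Suc s)"
    "X [^]\<^bsub>poly_ring F\<^esub> (p ^ k) \<in> base_filtration hp (Suc s)"
  shows "realizable (q * p ^ k, s)"
  unfolding realizable_def
proof (intro bexI[of _ "g [^]\<^bsub>poly_ring F\<^esub> (p ^ k)"] conjI)
  show "length (g [^]\<^bsub>poly_ring F\<^esub> (p ^ k)) = Suc (fst (q * p ^ k, s))"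
    using length_pow[OF g_carrier g_length] by simp
  show "g [^]\<^bsub>poly_ring F\<^esub> (p ^ k) \<in> base_filtration g (Suc (snd (q * p ^ k, s)))"
    using base_filtration_mono[OF g_pow_filtration] by simp
  show "g [^]\<^bsub>poly_ring F\<^esub> (p ^ k) \<in> base_filtration hp (Suc (snd (q * p ^ k, s)))"
    unfolding g_frob using assms by (simp add: base_filtration_add[OF hp_props(1)])
qed (use g_carrier in simp)

text \<open>Raising \<open>g\<close> to the power q^k gives the exponents q^(k+1), p q^k and q^k. Up
  to powers of X^(q-1) they count as 1, p and 1, so the weight is p.\<close>

lemma realizable_low_digit: "realizable (q ^ Suc k, p)"
proof -
  have e: "p ^ (m * k) = q ^ k" by (simp add: power_mult)
  have "X [^]\<^bsub>poly_ring F\<^esub> (q ^ Suc k * 1) \<in> base_filtration hp (Suc p)"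
    "X [^]\<^bsub>poly_ring F\<^esub> (q ^ k * p) \<in> base_filtration hp (Suc p)"
    "X [^]\<^bsub>poly_ring F\<^esub> (q ^ k * 1) \<in> base_filtration hp (Suc p)"
    using X_pow_filtration[of "Suc k" 1] X_pow_filtration[of k p] X_pow_filtration[of k 1] p_ge_2
      base_filtration_mono[of _ hp "Suc 1" "Suc p"] by auto
  then show ?thesis using realizable_g_pow[of "m * k" p] unfolding e by (simp add: mult.commute)
qed

text \<open>Raising \<open>g\<close> to the power q^k p^(m-1) turns the middle exponent into
  q^(k+1), which counts only as 1, while the other two count as p^(m-1). Compared with the low
  digit, the degree grows by the factor p^(m-1) but the weight only by p^(m-2); this gain is the
  reason for splitting digits.\<close>

lemma realizable_high_digit: "realizable (q ^ Suc k * p ^ (m - 1), p ^ (m - 1))"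
proof -
  have e: "p ^ (m * k + (m - 1)) = q ^ k * p ^ (m - 1)" by (simp add: power_mult power_add)
  have e2: "p * (q ^ k * p ^ (m - 1)) = q ^ Suc k * 1"
    using m_ge_2 by (simp add: power_eq_if[of p m] mult_ac)
  have one: "1 \<le> p ^ (m - 1)" using p_ge_2 by simp
  have "X [^]\<^bsub>poly_ring F\<^esub> (q ^ Suc k * p ^ (m - 1)) \<in> base_filtration hp (Suc (p ^ (m - 1)))"
    "X [^]\<^bsub>poly_ring F\<^esub> (q ^ k * p ^ (m - 1)) \<in> base_filtration hp (Suc (p ^ (m - 1)))"
    "X [^]\<^bsub>poly_ring F\<^esub> (q ^ Suc k * 1) \<in> base_filtration hp (Suc (p ^ (m - 1)))"
    by (rule X_pow_filtration, rule X_pow_filtration)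
      (rule base_filtration_mono[OF X_pow_filtration[of "Suc k" 1]], use one in simp)
  then show ?thesis using realizable_g_pow[of "m * k + (m - 1)" "p ^ (m - 1)"] unfolding e e2 by (simp add: mult_ac)
qed

text \<open>Each base-\<open>q\<close> digit of the exponent of \<open>g\<close> is b + p^(m-1) c
  with b below p^(m-1) and c below p; the weight of c comes first, being the more significant. These
  ranges are \<open>q div p\<close> and \<open>q div p ^ (m - 1)\<close>, so weights determine
  radices as in \<open>radix_prod\<close>. The final 1 belongs to the power of X.\<close>

fun digit_weights :: "nat \<Rightarrow> nat list" where
  "digit_weights 0 = [1]"
| "digit_weights (Suc n) = p ^ (m - 1) # p # digit_weights n"

lemma q_eq: "q = p * p ^ (m - 1)" using m_ge_2 by (simp add: power_eq_if[of p m])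

lemma q_div: "q div p = p ^ (m - 1)" "q div p ^ (m - 1) = p" "q div 1 = q"
  using p_ge_2 unfolding q_eq by auto

lemma digit_weights_props:
  "w \<in> set (digit_weights n) \<Longrightarrow> w dvd q"
  "radix_prod q (digit_weights n) = q ^ Suc n" "length (digit_weights n) = 2 * n + 1"
  "(\<Prod>w\<leftarrow>digit_weights n. real w) = real q ^ n"
proof -
  show "w \<in> set (digit_weights n) \<Longrightarrow> w dvd q"
    by (induction n) (auto simp: q_eq)
  show "radix_prod q (digit_weights n) = q ^ Suc n"
  proof (induction n)
    case (Suc n)
    have "radix_prod q (digit_weights (Suc n)) = q ^ Suc n * (q div p) * (q div p ^ (m - 1))"
      using Suc.IH by simp
    also have "\<dots> = q ^ Suc n * (p * p ^ (m - 1))" unfolding q_div by (simp add: mult_ac)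
    finally show ?case unfolding q_eq[symmetric] by (simp add: mult_ac)
  qed simp
  show "length (digit_weights n) = 2 * n + 1" by (induction n) auto
  have e: "real q = real p * real (p ^ (m - 1))" using q_eq by (metis of_nat_mult)
  show "(\<Prod>w\<leftarrow>digit_weights n. real w) = real q ^ n"
  proof (induction n)
    case (Suc n)
    have "(\<Prod>w\<leftarrow>digit_weights (Suc n). real w) = (real p * real (p ^ (m - 1))) * real q ^ n"
      using Suc.IH by simp
    then show ?case unfolding e[symmetric] by simp
  qed simp
qed

lemma realizable_extend:
  assumes "z \<in> extend_digit B w T S" "realizable (B, w)" "\<And>z. z \<in> S \<Longrightarrow> realizable z" shows "realizable z"
proof -
  obtain i d e where "z = (d + B * i, e + w * i)" "(d, e) \<in> S" using assms(1) by (auto simp: extend_digit_def)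
  then show ?thesis using realizable_mult[OF assms(3) realizable_pow[OF assms(2)]] by simp
qed

lemma realizable_low_points:
  assumes "\<And>z. z \<in> digit_points q (digit_weights n) \<Longrightarrow> realizable z" "z \<in> digit_points q (p # digit_weights n)"
  shows "realizable z"
  using assms(2) unfolding digit_points.simps digit_weights_props(2)
  by (rule realizable_extend[OF _ realizable_low_digit assms(1)])

lemma realizable_digit_points: "z \<in> digit_points q (digit_weights n) \<Longrightarrow> realizable z"
proof (induction n arbitrary: z)
  case 0
  have "z \<in> extend_digit 1 1 q {(0, 0)}" using 0 by simp
  then show ?case by (rule realizable_extend[OF _ realizable_X]) (use realizable_one in simp)
next
  case (Suc n)
  have r: "radix_prod q (p # digit_weights n) = q ^ Suc n * p ^ (m - 1)"
    unfolding radix_prod.simps digit_weights_props(2) q_div(1) ..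
  have "z \<in> extend_digit (q ^ Suc n * p ^ (m - 1)) (p ^ (m - 1)) (q div p ^ (m - 1)) (digit_points q (p # digit_weights n))"
    using Suc.prems unfolding digit_weights.simps digit_points.simps(2)[of q "p ^ (m - 1)"] r .
  then show ?case
    by (rule realizable_extend[OF _ realizable_high_digit realizable_low_points[OF Suc.IH]])
qed

text \<open>The top digit c is left out of the list \<open>?ws\<close> and added separately with
  only \<open>T\<close> values. This enforces the bound on lengths and produces the subtracted
  power; one unit of this digit has degree q^m p^(m-1) and weight p^(m-1).\<close>

lemma exists_independent_family:
  assumes T: "T \<le> p" and x: "x \<le> real q"
  shows "\<exists>U. finite U \<and> U \<subseteq> carrier (poly_ring F) \<and> inj_on length U \<and> [] \<notin> U \<and>
    (\<forall>u\<in>U. \<exists>e. real e < x \<and> u \<in> base_filtration g (Suc e) \<and> u \<in> base_filtration hp (Suc e)) \<and>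
    (\<forall>u\<in>U. length u \<le> q ^ m * p ^ (m - 1) * T) \<and>
    real (card U) \<ge> (pos_pow (2 * m + 1) x - pos_pow (2 * m + 1) (x - real (p ^ (m - 1)) * real T)) / (fact (2 * m + 1) * real q ^ m)"
proof -
  obtain n where n: "m = Suc n" using m_ge_2 by (cases m) auto
  let ?ws = "p # digit_weights n"
  let ?S = "digit_points q ?ws"
  let ?B = "q ^ Suc n * p ^ (m - 1)"
  have q0: "q > 0" using p_ge_2 by simp
  have ws: "\<And>w. w \<in> set ?ws \<Longrightarrow> w dvd q" using digit_weights_props(1) q_eq by auto
  have r: "radix_prod q ?ws = ?B"
    unfolding radix_prod.simps digit_weights_props(2) q_div(1) ..
  have less: "d < ?B" if "(d, e) \<in> ?S" for d e using digit_points_less[OF ws q0 that] unfolding r .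
  note inj = digit_points_inj[OF ws q0]
  have len: "length ?ws = 2 * m" using digit_weights_props(3)[of n] n by simp
  have prod: "(\<Prod>w\<leftarrow>?ws. real w) = real p * real q ^ n" using digit_weights_props(4)[of n] by simp
  define E where "E = {z \<in> extend_digit ?B (p ^ (m - 1)) T ?S. real (snd z) < x}"
  have cardE: "real (card E) \<ge> (pos_pow (Suc (2 * m)) x - pos_pow (Suc (2 * m)) (x - real (p ^ (m - 1)) * real T)) /
      (fact (Suc (2 * m)) * ((real p * real q ^ n) * real (p ^ (m - 1))))"
    unfolding E_def
  proof (rule extend_digit_count_ge[OF less inj finite_digit_points])
    show "pos_pow (2 * m) y / (fact (2 * m) * (real p * real q ^ n)) \<le> real (card {z \<in> ?S. real (snd z) < y})"
      if "y \<le> x" for y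
      using digit_points_count[of ?ws q y, OF ws q0] that x unfolding len prod by linarith
  qed (use p_ge_2 in auto)
  have pq: "(real p * real q ^ n) * real (p ^ (m - 1)) = real q ^ m"
  proof -
    have "real q = real p * real (p ^ (m - 1))" using q_eq by (metis of_nat_mult)
    then have "real q ^ m = (real p * real (p ^ (m - 1))) * real q ^ n" unfolding n by simp
    then show ?thesis by (simp add: mult_ac)
  qed
  have goodE: "realizable z" if "z \<in> E" for z
  proof (rule realizable_extend[where S="?S"])
    show "z \<in> extend_digit ?B (p ^ (m - 1)) T ?S" using that by (simp add: E_def)
    show "realizable (?B, p ^ (m - 1))" by (rule realizable_high_digit)
    show "realizable y" if "y \<in> ?S" for y using realizable_low_points[OF realizable_digit_points that] .
  qed
  have injE: "inj_on fst E"
    unfolding E_def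
    by (rule inj_on_subset[OF extend_digit_inj(1)[of ?S ?B "p ^ (m - 1)" T, OF less inj]]) (assumption, assumption, rule Collect_restrict)
  have finE: "finite E" unfolding E_def extend_digit_def
    by (rule finite_subset[OF Collect_restrict]) (intro finite_imageI finite_cartesian_product finite_lessThan finite_digit_points)
  have "\<forall>z\<in>E. \<exists>u. u \<in> carrier (poly_ring F) \<and> length u = Suc (fst z) \<and>
     u \<in> base_filtration g (Suc (snd z)) \<and> u \<in> base_filtration hp (Suc (snd z))"
    using goodE unfolding realizable_def by blast
  then obtain u where u: "\<And>z. z \<in> E \<Longrightarrow> u z \<in> carrier (poly_ring F) \<and> length (u z) = Suc (fst z) \<and>
     u z \<in> base_filtration g (Suc (snd z)) \<and> u z \<in> base_filtration hp (Suc (snd z))"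
    by metis
  have inju: "inj_on (\<lambda>z. length (u z)) E"
    using injE u by (auto simp: inj_on_def)
  show ?thesis
  proof (intro exI[of _ "u ` E"] conjI ballI)
    show "finite (u ` E)" using finE by simp
    show "u ` E \<subseteq> carrier (poly_ring F)" using u by auto
    show "inj_on length (u ` E)" using inju by (auto simp: inj_on_def)
    show "[] \<notin> u ` E" using u by force
    show "\<exists>e. real e < x \<and> v \<in> base_filtration g (Suc e) \<and> v \<in> base_filtration hp (Suc e)" if "v \<in> u ` E" for v
    proof -
      obtain z where z: "z \<in> E" "v = u z" using \<open>v \<in> u ` E\<close> by blast
      then have "real (snd z) < x" by (simp add: E_def)
      then show ?thesis using u[OF z(1)] z(2) by blast
    qed
    show "length v \<le> q ^ m * p ^ (m - 1) * T" if "v \<in> u ` E" for v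
    proof -
      obtain z where z: "z \<in> E" "v = u z" using \<open>v \<in> u ` E\<close> by blast
      obtain i d e where i: "i < T" "(d, e) \<in> ?S" "fst z = d + ?B * i"
        using z(1) unfolding E_def by (auto elim: extend_digitE simp del: digit_points.simps power_Suc)
      have "Suc (fst z) \<le> ?B + ?B * i" using less[OF i(2)] i(3) by simp
      also have "\<dots> = ?B * Suc i" by simp
      also have "\<dots> \<le> ?B * T" using i(1) by (intro mult_le_mono2) simp
      finally show ?thesis using u[OF z(1)] z(2) n by simp
    qed
    have "card (u ` E) = card E"
      using inju by (intro card_image) (auto simp: inj_on_def)
    then show "real (card (u ` E)) \<ge> (pos_pow (2 * m + 1) x - pos_pow (2 * m + 1) (x - real (p ^ (m - 1)) * real T)) / (fact (2 * m + 1) * real q ^ m)"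
      using cardE unfolding pq by simp
  qed
qed

end

section \<open>The evaluation code\<close>

lemma (in field) poly_subspace_Int:
  "poly_subspace U \<Longrightarrow> poly_subspace W \<Longrightarrow> poly_subspace (U \<inter> W)"
  by (auto simp: poly_subspace_def)

lemma (in field) codeword_inj_on:
  assumes W: "poly_subspace W" and S: "S \<subseteq> carrier R" "finite S"
    and len: "\<And>f. f \<in> W \<Longrightarrow> length f \<le> card S"
  shows "inj_on (codeword R S) W"
proof (rule inj_onI, rule ccontr)
  interpret P: domain "poly_ring R" using univ_poly_is_domain[OF carrier_is_subring] .
  fix f g assume fg: "f \<in> W" "g \<in> W" "codeword R S f = codeword R S g" "f \<noteq> g"
  let ?d = "f \<ominus>\<^bsub>poly_ring R\<^esub> g"
  have c: "f \<in> carrier (poly_ring R)" "g \<in> carrier (poly_ring R)" using W fg by (auto simp: poly_subspace_def)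
  have d: "?d \<in> W" "?d \<in> carrier (poly_ring R)" using poly_subspace_minus[OF W fg(1,2)] c by auto
  have "?d \<noteq> []" using P.r_right_minus_eq[OF c] fg(4) by (simp add: univ_poly_zero)
  moreover have "S \<subseteq> {x \<in> carrier R. eval ?d x = \<zero>}"
    using codeword_diff[OF c S(1)] fg(3) S(1) by auto
  ultimately have "card S \<le> length ?d - 1" "length ?d > 0" using card_roots_le_degree[OF d(2)] by auto
  then show False using len[OF d(1)] by linarith
qed

locale code_setup = expander_setup +
  fixes \<alpha> :: 'a and r :: real
  assumes alpha: "\<alpha> \<in> carrier F"
    and free: "stabilizer (A_group F m p K) (\<lambda>\<phi>. \<phi>) \<alpha> = {\<one>\<^bsub>A_group F m p K\<^esub>}"
    and r: "0 < r" "r < 1"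
begin

abbreviation "Om \<equiv> Omega F m p K \<alpha>"
abbreviation "ev \<equiv> (\<lambda>\<phi>. \<phi> \<alpha>) :: ('a \<Rightarrow> 'a) \<Rightarrow> 'a"

lemma A_apply:
  assumes "\<phi> \<in> carrier A" "\<psi> \<in> carrier A" "\<beta> \<in> carrier F"
  shows "(\<phi> \<otimes>\<^bsub>A\<^esub> \<psi>) \<beta> = \<phi> (\<psi> \<beta>)" "\<phi> \<beta> \<in> carrier F" "\<one>\<^bsub>A\<^esub> \<beta> = \<beta>"
proof -
  obtain h v k w where *: "\<phi> = aff h v" "h \<in> H" "v \<in> V" "\<psi> = aff k w" "k \<in> H" "w \<in> V"
    using assms(1,2) unfolding carrier_A A_set_def by auto
  then have c: "h \<in> carrier F" "v \<in> carrier F" "k \<in> carrier F" "w \<in> carrier F" "h \<noteq> \<zero>" "k \<noteq> \<zero>"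
    using HV by auto
  show "(\<phi> \<otimes>\<^bsub>A\<^esub> \<psi>) \<beta> = \<phi> (\<psi> \<beta>)"
    unfolding A_ops *(1,4) using c assms(3) by (simp add: aff_mult) (simp add: aff_def r_distr m_assoc a_assoc)
  show "\<phi> \<beta> \<in> carrier F" "\<one>\<^bsub>A\<^esub> \<beta> = \<beta>"
    unfolding A_ops *(1) using c assms(3) by (simp_all add: aff_def)
qed

lemma ev_inj: "inj_on ev (carrier A)"
proof (rule inj_onI)
  interpret A: group A by (rule group_A)
  fix \<phi> \<psi> assume *: "\<phi> \<in> carrier A" "\<psi> \<in> carrier A" "\<phi> \<alpha> = \<psi> \<alpha>"
  have i: "inv\<^bsub>A\<^esub> \<psi> \<in> carrier A" using * by simp
  have "(inv\<^bsub>A\<^esub> \<psi> \<otimes>\<^bsub>A\<^esub> \<phi>) \<alpha> = (inv\<^bsub>A\<^esub> \<psi> \<otimes>\<^bsub>A\<^esub> \<psi>) \<alpha>"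
    unfolding A_apply(1)[OF i *(1) alpha] A_apply(1)[OF i *(2) alpha] *(3) ..
  also have "\<dots> = \<alpha>" using A.l_inv[OF *(2)] A_apply(3)[OF i i alpha] by simp
  finally have "inv\<^bsub>A\<^esub> \<psi> \<otimes>\<^bsub>A\<^esub> \<phi> \<in> stabilizer A (\<lambda>\<phi>. \<phi>) \<alpha>" using * i by (simp add: stabilizer_def)
  then have "inv\<^bsub>A\<^esub> \<psi> \<otimes>\<^bsub>A\<^esub> \<phi> = \<one>\<^bsub>A\<^esub>" unfolding free by simp
  then have "\<phi> = inv\<^bsub>A\<^esub> (inv\<^bsub>A\<^esub> \<psi>)" using A.inv_equality[of \<phi> "inv\<^bsub>A\<^esub> \<psi>"] A.inv_comm[OF _ i *(1)] * i by metis
  then show "\<phi> = \<psi>" using * by simp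
qed

lemma Om_eq: "Om = ev ` carrier A"
  unfolding Omega_def orbit_def by auto

lemma Om_props: "Om \<subseteq> carrier F" "finite Om" "card Om = (q - 1) * q ^ m" "real (card Om) = nn"
  "real (code_length F m p K) = nn"
proof -
  show "Om \<subseteq> carrier F" unfolding Om_eq using A_apply(2) alpha by blast
  then show "finite Om" using finite_carrier finite_subset by blast
  show *: "card Om = (q - 1) * q ^ m"
    unfolding Om_eq card_image[OF ev_inj] unfolding carrier_A by (rule card_A)
  show "real (card Om) = nn" "real (code_length F m p K) = nn"
    unfolding * code_length_eq nn_def by (rule refl)+
qed

lemma coset_image:
  assumes "S \<subseteq> carrier A" "\<phi> \<in> carrier A"
  shows "ev ` (S #>\<^bsub>A\<^esub> \<phi>) = (\<lambda>t. t (\<phi> \<alpha>)) ` S"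
proof -
  have "ev ` (S #>\<^bsub>A\<^esub> \<phi>) = (\<lambda>t. ev (t \<otimes>\<^bsub>A\<^esub> \<phi>)) ` S" unfolding r_coset_def by blast
  also have "\<dots> = (\<lambda>t. t (\<phi> \<alpha>)) ` S"
    using assms alpha by (intro image_cong refl) (auto simp: A_apply(1))
  finally show ?thesis .
qed

text \<open>Orbits depend on the carrier only, so the orbits of a subgroup in \<open>Om\<close> are
  the images of its right cosets under \<open>ev\<close>. Together with \<open>ev_inj\<close> this
  identifies the code coordinates with the edges of the coset graph.\<close>

lemma orbits_eq:
  assumes S: "S \<subseteq> carrier A"
  shows "orbits (AGL\<lparr>carrier := S\<rparr>) Om (\<lambda>\<phi>. \<phi>) = (\<lambda>C. ev ` C) ` (rcosets\<^bsub>A\<^esub> S)"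
proof -
  have orb: "orbit (AGL\<lparr>carrier := S\<rparr>) (\<lambda>\<phi>. \<phi>) (ev \<phi>) = ev ` (S #>\<^bsub>A\<^esub> \<phi>)" if \<phi>: "\<phi> \<in> carrier A" for \<phi>
  proof -
    show ?thesis unfolding coset_image[OF S \<phi>] orbit_def by auto
  qed
  have "orbits (AGL\<lparr>carrier := S\<rparr>) Om (\<lambda>\<phi>. \<phi>) = (\<lambda>\<phi>. orbit (AGL\<lparr>carrier := S\<rparr>) (\<lambda>\<phi>. \<phi>) (ev \<phi>)) ` carrier A"
    unfolding orbits_def Om_eq by auto
  also have "\<dots> = (\<lambda>\<phi>. ev ` (S #>\<^bsub>A\<^esub> \<phi>)) ` carrier A" using orb by (intro image_cong) auto
  also have "\<dots> = (\<lambda>C. ev ` C) ` (rcosets\<^bsub>A\<^esub> S)" unfolding RCOSETS_def by blast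
  finally show ?thesis .
qed

lemma left_orbits_eq: "left_orbits F m p K \<alpha> = (\<lambda>C. ev ` C) ` (rcosets\<^bsub>A\<^esub> TT)"
  unfolding left_orbits_def by (rule orbits_eq[OF subgroup.subset[OF subgroup_translation]])

lemma right_orbits_eq: "right_orbits F m p K \<alpha> = (\<lambda>C. ev ` C) ` (rcosets\<^bsub>A\<^esub> SS)"
  unfolding right_orbits_def by (rule orbits_eq[OF subgroup.subset[OF subgroup_scaling]])

lemma coset_orbit:
  assumes S: "subgroup S A" and C: "C \<in> rcosets\<^bsub>A\<^esub> S"
  shows "card (ev ` C) = card S" "ev ` C \<subseteq> Om" "ev ` C \<subseteq> carrier F" "finite C" "C \<subseteq> carrier A" "card C = card S"
proof -
  note c = group.rcosets_facts[OF group_A S finite_A]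
  show 1: "finite C" "C \<subseteq> carrier A" "card C = card S" using c(2,3,6) C by auto
  show "card (ev ` C) = card S" using card_image[OF inj_on_subset[OF ev_inj 1(2)]] 1(3) by simp
  show "ev ` C \<subseteq> Om" unfolding Om_eq using 1(2) by blast
  then show "ev ` C \<subseteq> carrier F" using Om_props(1) by blast
qed

text \<open>\<open>g\<close> is additive and vanishes on \<open>G\<close>, so it is unchanged by
  translations from \<open>G\<close>.\<close>

lemma g_const_on_orbit:
  assumes C: "C \<in> rcosets\<^bsub>A\<^esub> TT"
  shows "\<exists>k\<in>carrier F. \<forall>x\<in>ev ` C. eval g x = k"
proof -
  obtain \<phi> where \<phi>: "\<phi> \<in> carrier A" "C = TT #>\<^bsub>A\<^esub> \<phi>" using C by (auto simp: RCOSETS_def)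
  have ac: "\<phi> \<alpha> \<in> carrier F" using A_apply(2)[OF \<phi>(1) \<phi>(1) alpha] .
  have "eval g x = eval g (\<phi> \<alpha>)" if "x \<in> ev ` C" for x
  proof -
    obtain t where t: "t \<in> TT" "x = t (\<phi> \<alpha>)"
      using \<open>x \<in> ev ` C\<close> unfolding \<phi>(2) coset_image[OF subgroup.subset[OF subgroup_translation] \<phi>(1)] by blast
    obtain a where a: "a \<in> G" "t = aff \<one> a" using t(1) unfolding translation_maps_eq by auto
    have "x = \<phi> \<alpha> \<oplus> a" using t(2) a ac HV(4) by (simp add: aff_def)
    then show ?thesis using a ac HV(4)[OF a(1)] by (simp add: eval_g_add) (simp add: G_set_def eval_closed[OF _ g_carrier])
  qed
  then show ?thesis using eval_closed[OF ac g_carrier] by blast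
qed

lemma H_pow: "h \<in> H \<Longrightarrow> h [^] (q - 1) = \<one>"
proof -
  assume h: "h \<in> H"
  have "q = Suc (q - 1)" using q_ge_4 by linarith
  then have "h [^] (q - 1) \<otimes> h = \<one> \<otimes> h"
    using K_pow_q[OF H_props(8)[OF h]] H_inv(4)[OF h] by (metis nat_pow_Suc l_one)
  then show ?thesis
    using m_rcancel[OF H_inv(5)[OF h] H_inv(4)[OF h] nat_pow_closed[OF H_inv(4)[OF h]] one_closed] by blast
qed

text \<open>Scaling by h multiplies the value of X^(q-1) by h^(q-1) = 1.\<close>

lemma h_const_on_orbit:
  assumes C: "C \<in> rcosets\<^bsub>A\<^esub> SS"
  shows "\<exists>k\<in>carrier F. \<forall>x\<in>ev ` C. eval hp x = k"
proof -
  obtain \<phi> where \<phi>: "\<phi> \<in> carrier A" "C = SS #>\<^bsub>A\<^esub> \<phi>" using C by (auto simp: RCOSETS_def)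
  have ac: "\<phi> \<alpha> \<in> carrier F" using A_apply(2)[OF \<phi>(1) \<phi>(1) alpha] .
  have "eval hp x = eval hp (\<phi> \<alpha>)" if "x \<in> ev ` C" for x
  proof -
    obtain t where t: "t \<in> SS" "x = t (\<phi> \<alpha>)"
      using \<open>x \<in> ev ` C\<close> unfolding \<phi>(2) coset_image[OF subgroup.subset[OF subgroup_scaling] \<phi>(1)] by blast
    obtain h where h: "h \<in> H" "t = aff h \<zero>" using t(1) unfolding scaling_maps_eq by auto
    have "x = h \<otimes> \<phi> \<alpha>" using t(2) h ac HV(1) by (simp add: aff_def)
    note x = this
    have hc: "h \<in> carrier F" using HV(1)[OF h(1)] .
    have "eval hp x = h [^] (q - 1) \<otimes> \<phi> \<alpha> [^] (q - 1)"
      unfolding hp_eq x using hc ac by (simp only: eval_var_pow m_closed nat_pow_distrib)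
    then show ?thesis unfolding hp_eq H_pow[OF h(1)] using ac by (simp only: eval_var_pow l_one nat_pow_closed)
  qed
  then show ?thesis using eval_closed[OF ac hp_props(1)] by blast
qed

abbreviation "WW D \<equiv> W_space F m p K r D"

text \<open>Since r < 1, both bounds lie below the degrees of \<open>g\<close> and
  \<open>hp\<close>, so \<open>base_deg_less_iff\<close> turns conditions on base degrees into
  filtrations.\<close>

lemma W_eq: "WW D = {f \<in> carrier (poly_ring F). length f \<le> nat D} \<inter>
    base_filtration g (nat \<lceil>r * real q\<rceil>) \<inter> base_filtration hp (nat \<lceil>r * real (q - 1)\<rceil>)"
proof -
  have "r * real q \<le> real (length g - 1)"
    using r mult_right_mono[of r 1 "real q"] by (simp add: g_length)
  moreover have "length g \<ge> 2" using g_length q_ge_4 by simp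
  ultimately have 1: "base_deg F g f < ereal (r * real q) \<longleftrightarrow> f \<in> base_filtration g (nat \<lceil>r * real q\<rceil>)"
    if "f \<in> carrier (poly_ring F)" for f
    using base_deg_less_iff[OF g_carrier _ that] by blast
  have "r * real (q - 1) \<le> real (length hp - 1)"
    unfolding hp_props(2) using r mult_right_mono[of r 1 "real (q - 1)"] by linarith
  moreover have "length hp \<ge> 2" unfolding hp_props(2) using q_ge_4 by linarith
  ultimately have 2: "base_deg F hp f < ereal (r * real (q - 1)) \<longleftrightarrow> f \<in> base_filtration hp (nat \<lceil>r * real (q - 1)\<rceil>)"
    if "f \<in> carrier (poly_ring F)" for f
    using base_deg_less_iff[OF hp_props(1) _ that] by blast
  have 3: "pdeg f < ereal (real_of_int D) \<longleftrightarrow> length f \<le> nat D" for f :: "'a list"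
    by (simp add: pdeg_less_iff)
  show ?thesis
    unfolding W_space_def card_G H_props(5) 3 using 1 2 by blast
qed

lemma W_subspace: "poly_subspace (WW D)"
  unfolding W_eq
  by (intro poly_subspace_Int poly_subspace_length base_filtration_subspace g_carrier hp_props(1))

lemma W_mem:
  assumes "f \<in> WW D"
  shows "f \<in> carrier (poly_ring F)" "length f \<le> nat D"
    "f \<in> base_filtration g (nat \<lceil>r * real q\<rceil>)" "f \<in> base_filtration hp (nat \<lceil>r * real (q - 1)\<rceil>)"
  using assms unfolding W_eq by auto

lemma local_poly_left:
  assumes f: "f \<in> WW D" and C: "C \<in> rcosets\<^bsub>A\<^esub> TT"
  shows "\<exists>e\<in>carrier (poly_ring F). length e \<le> nat \<lceil>r * real (card TT)\<rceil> \<and> (\<forall>x\<in>ev ` C. eval f x = eval e x)"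
  using g_const_on_orbit[OF C] eval_base_filtration[OF g_carrier W_mem(3)[OF f] coset_orbit(3)[OF subgroup_translation C]]
  unfolding card_translation_maps by blast

lemma local_poly_right:
  assumes f: "f \<in> WW D" and C: "C \<in> rcosets\<^bsub>A\<^esub> SS"
  shows "\<exists>e\<in>carrier (poly_ring F). length e \<le> nat \<lceil>r * real (card SS)\<rceil> \<and> (\<forall>x\<in>ev ` C. eval f x = eval e x)"
  using h_const_on_orbit[OF C] eval_base_filtration[OF hp_props(1) W_mem(4)[OF f] coset_orbit(3)[OF subgroup_scaling C]]
  unfolding card_scaling_maps by blast

lemma restrict_codeword:
  assumes "S \<subseteq> Om" "\<forall>x\<in>S. eval f x = eval e x" "e \<in> carrier (poly_ring F)" "length e \<le> nat \<lceil>k\<rceil>"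
  shows "restrict (codeword F Om f) S \<in> rs_code F S k"
proof -
  have "restrict (codeword F Om f) S = codeword F S e"
    using assms(1,2) by (auto simp: codeword_def restrict_def fun_eq_iff)
  then show ?thesis unfolding rs_code_eq using assms(3,4) by blast
qed

theorem code_subset_tanner: "eval_code F m p K \<alpha> r D \<subseteq> tanner_code F m p K \<alpha> r"
proof
  fix c assume "c \<in> eval_code F m p K \<alpha> r D"
  then obtain f where f: "f \<in> WW D" "c = codeword F Om f" unfolding eval_code_def by blast
  have "c \<in> Om \<rightarrow>\<^sub>E carrier F"
    unfolding f(2) codeword_def using Om_props(1) eval_closed[OF _ W_mem(1)[OF f(1)]] by auto
  moreover have "restrict c S \<in> left_code F m p r S" if "S \<in> left_orbits F m p K \<alpha>" for S
  proof -
    obtain C where C: "C \<in> rcosets\<^bsub>A\<^esub> TT" "S = ev ` C"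
      using \<open>S \<in> left_orbits F m p K \<alpha>\<close> unfolding left_orbits_eq by blast
    obtain e where "e \<in> carrier (poly_ring F)" "length e \<le> nat \<lceil>r * real (card TT)\<rceil>" "\<forall>x\<in>S. eval f x = eval e x"
      using local_poly_left[OF f(1) C(1)] C(2) by blast
    then show ?thesis
      unfolding f(2) left_code_def card_G card_translation_maps
      using restrict_codeword coset_orbit(2)[OF subgroup_translation C(1)] C(2) by blast
  qed
  moreover have "restrict c S \<in> right_code F K r S" if "S \<in> right_orbits F m p K \<alpha>" for S
  proof -
    obtain C where C: "C \<in> rcosets\<^bsub>A\<^esub> SS" "S = ev ` C"
      using \<open>S \<in> right_orbits F m p K \<alpha>\<close> unfolding right_orbits_eq by blast
    obtain e where "e \<in> carrier (poly_ring F)" "length e \<le> nat \<lceil>r * real (card SS)\<rceil>" "\<forall>x\<in>S. eval f x = eval e x"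
      using local_poly_right[OF f(1) C(1)] C(2) by blast
    then show ?thesis
      unfolding f(2) right_code_def H_props(5) card_scaling_maps
      using restrict_codeword coset_orbit(2)[OF subgroup_scaling C(1)] C(2) by blast
  qed
  ultimately show "c \<in> tanner_code F m p K \<alpha> r" unfolding tanner_code_def by blast
qed

text \<open>Rounding r n up costs at most one dimension, hence 1 / n in the rate; the distance loses
  nothing. The smaller local length is q - 1, so one error term serves both sides.\<close>

lemma rs_local:
  assumes S: "S \<subseteq> carrier F" "card S = n" and n: "real n \<ge> real q - 1"
  shows "code_rate F S (rs_code F S (r * real n)) \<le> r + 1 / (real q - 1)"
    "rel_min_dist S (rs_code F S (r * real n)) \<ge> 1 - r"
proof -
  have n0: "real n > 0" using n q_real(4) by linarith
  have "code_rate F S (rs_code F S (r * real n)) \<le> (r * real n + 1) / real (card S)"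
    using r by (intro rs_code_rate[OF finite_carrier S(1)]) simp
  also have "\<dots> = r + 1 / real n" using n0 S(2) by (simp add: field_simps)
  also have "\<dots> \<le> r + 1 / (real q - 1)"
    by (intro add_left_mono divide_left_mono n mult_pos_pos n0 q_real(4)) simp
  finally show "code_rate F S (rs_code F S (r * real n)) \<le> r + 1 / (real q - 1)" .
  have "S \<noteq> {}" using S(2) n0 by auto
  then have "(real (card S) - r * real n) / real (card S) \<le> rel_min_dist S (rs_code F S (r * real n))"
    using r n0 by (intro rs_code_dist[OF finite_carrier S(1)]) simp_all
  then show "rel_min_dist S (rs_code F S (r * real n)) \<ge> 1 - r"
    using n0 S(2) by (simp add: diff_divide_distrib)
qed

theorem left_local_codes:
  assumes "S \<in> left_orbits F m p K \<alpha>"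
  shows "card S = card G" "code_rate F S (left_code F m p r S) \<le> r + 1 / (real q - 1)"
    "rel_min_dist S (left_code F m p r S) \<ge> 1 - r"
proof -
  obtain C where C: "C \<in> rcosets\<^bsub>A\<^esub> TT" "S = ev ` C" using assms unfolding left_orbits_eq by blast
  note o = coset_orbit[OF subgroup_translation C(1), folded C(2)]
  show c: "card S = card G" unfolding o(1) card_translation_maps card_G ..
  have "real (card G) \<ge> real q - 1" unfolding card_G by linarith
  then show "code_rate F S (left_code F m p r S) \<le> r + 1 / (real q - 1)"
    "rel_min_dist S (left_code F m p r S) \<ge> 1 - r"
    unfolding left_code_def using rs_local[OF o(3) c] by blast+
qed

theorem right_local_codes:
  assumes "S \<in> right_orbits F m p K \<alpha>"
  shows "card S = card H" "code_rate F S (right_code F K r S) \<le> r + 1 / (real q - 1)"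
    "rel_min_dist S (right_code F K r S) \<ge> 1 - r"
proof -
  obtain C where C: "C \<in> rcosets\<^bsub>A\<^esub> SS" "S = ev ` C" using assms unfolding right_orbits_eq by blast
  note o = coset_orbit[OF subgroup_scaling C(1), folded C(2)]
  show c: "card S = card H" unfolding o(1) card_scaling_maps H_props(5) ..
  have "real (card H) \<ge> real q - 1" unfolding H_props(5) q_real(2) by (rule order_refl)
  then show "code_rate F S (right_code F K r S) \<le> r + 1 / (real q - 1)"
    "rel_min_dist S (right_code F K r S) \<ge> 1 - r"
    unfolding right_code_def using rs_local[OF o(3) c] by blast+
qed

lemma card_preimage:
  assumes "C \<subseteq> carrier A"
  shows "card {\<phi> \<in> C. P (ev \<phi>)} = card {s \<in> ev ` C. P s}"
proof -
  have "{s \<in> ev ` C. P s} = ev ` {\<phi> \<in> C. P (ev \<phi>)}" by auto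
  moreover have "inj_on ev {\<phi> \<in> C. P (ev \<phi>)}" using assms by (intro inj_on_subset[OF ev_inj]) auto
  ultimately show ?thesis by (simp add: card_image)
qed

text \<open>On a coset that meets the support, \<open>f\<close> agrees with a polynomial of degree
  below r times the coset size that is not identically zero there, so its zeros are at most that
  proportion. The summand 1 of \<open>card_nonzeros_ge\<close> again cancels the rounding.\<close>

lemma coset_density:
  assumes S: "subgroup S A" and C: "C \<in> rcosets\<^bsub>A\<^esub> S" and S0: "card S > 0"
    and e: "e \<in> carrier (poly_ring F)" "length e \<le> nat \<lceil>r * real (card S)\<rceil>" "\<forall>x\<in>ev ` C. eval f x = eval e x"
    and ne: "C \<inter> {\<phi> \<in> carrier A. eval f (ev \<phi>) \<noteq> \<zero>} \<noteq> {}"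
  shows "(1 - r) * real (card C) \<le> real (card ({\<phi> \<in> carrier A. eval f (ev \<phi>) \<noteq> \<zero>} \<inter> C))"
proof -
  note o = coset_orbit[OF S C]
  have "{\<phi> \<in> carrier A. eval f (ev \<phi>) \<noteq> \<zero>} \<inter> C = {\<phi> \<in> C. eval f (ev \<phi>) \<noteq> \<zero>}" using o(5) by auto
  then have "card ({\<phi> \<in> carrier A. eval f (ev \<phi>) \<noteq> \<zero>} \<inter> C) = card {s \<in> ev ` C. eval f s \<noteq> \<zero>}"
    using card_preimage[OF o(5), of "\<lambda>s. eval f s \<noteq> \<zero>"] by simp
  also have "{s \<in> ev ` C. eval f s \<noteq> \<zero>} = {s \<in> ev ` C. eval e s \<noteq> \<zero>}" using e(3) by auto
  finally have eq: "card ({\<phi> \<in> carrier A. eval f (ev \<phi>) \<noteq> \<zero>} \<inter> C) = card {s \<in> ev ` C. eval e s \<noteq> \<zero>}" .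
  have "\<exists>s\<in>ev ` C. eval e s \<noteq> \<zero>" using ne e(3) by auto
  then have "real (card {s \<in> ev ` C. eval e s \<noteq> \<zero>}) \<ge> real (card (ev ` C)) - real (nat \<lceil>r * real (card S)\<rceil>) + 1"
    using o(4) by (intro card_nonzeros_ge e(1,2) o(3)) auto
  moreover have "real (nat \<lceil>r * real (card S)\<rceil>) < r * real (card S) + 1"
  proof -
    have "0 \<le> r * real (card S)" using r by simp
    then show ?thesis by linarith
  qed
  ultimately show ?thesis unfolding eq o(1,6) by (simp add: algebra_simps)
qed

text \<open>One bound counts the zeros of a polynomial of degree below \<open>D\<close> on all of
  \<open>Om\<close>, the other is \<open>support_density\<close> for the support transported to the
  group. The hypothesis \<open>D \<ge> 1\<close> puts the constant 1 into the space, so that the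
  code is nontrivial and \<open>min_dist\<close> is not the default 0.\<close>

theorem code_rel_min_dist:
  assumes D: "D \<ge> 1"
  shows "rel_min_dist Om (eval_code F m p K \<alpha> r D) \<ge> max (1 - real_of_int D / nn) ((1 - r)\<^sup>2 - sqrt (2 * real m / real p))"
proof -
  let ?b = "max (1 - real_of_int D / nn) ((1 - r)\<^sup>2 - sqrt (2 * real m / real p))"
  have one: "\<one>\<^bsub>poly_ring F\<^esub> \<in> carrier (poly_ring F)" "length \<one>\<^bsub>poly_ring F\<^esub> = Suc 0"
    by (simp, simp add: univ_poly_one)
  have "0 < r * real q" "0 < r * real (q - 1)" using mult_pos_pos[OF r(1) q_real(6)] mult_pos_pos[OF r(1) q_real(4)] unfolding q_real(2) .
  then have "Suc 0 \<le> nat \<lceil>r * real q\<rceil>" "Suc 0 \<le> nat \<lceil>r * real (q - 1)\<rceil>" "Suc 0 \<le> nat D" using D by linarith+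
  then have W1: "\<one>\<^bsub>poly_ring F\<^esub> \<in> WW D"
    unfolding W_eq using one base_filtration_const[OF g_carrier one(1)] base_filtration_const[OF hp_props(1) one(1)] by simp
  have "nn * ?b \<le> real (min_dist Om (codeword F Om ` WW D))"
  proof (rule min_dist_ge[OF W_subspace Om_props(1)])
    have "card Om \<noteq> 0" using Om_props(4) nn(2) by auto
    then obtain s where s: "s \<in> Om" by fastforce
    have "eval \<one>\<^bsub>poly_ring F\<^esub> s = \<one>" using s Om_props(1) by (auto simp: univ_poly_one)
    then show "\<exists>f\<in>WW D. \<exists>s\<in>Om. eval f s \<noteq> \<zero>" using W1 s one_not_zero by metis
    fix f assume f: "f \<in> WW D" "\<exists>s\<in>Om. eval f s \<noteq> \<zero>"
    let ?Z = "{\<phi> \<in> carrier A. eval f (ev \<phi>) \<noteq> \<zero>}"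
    have cZ: "card {s \<in> Om. eval f s \<noteq> \<zero>} = card ?Z"
      using card_preimage[OF subset_refl, of "\<lambda>s. eval f s \<noteq> \<zero>"] by (simp add: Om_eq)
    have "real (card {s \<in> Om. eval f s \<noteq> \<zero>}) \<ge> real (card Om) - real (nat D) + 1"
      by (rule card_nonzeros_ge[OF W_mem(1)[OF f(1)] Om_props(1,2) W_mem(2)[OF f(1)] f(2)])
    then have 1: "real (card ?Z) \<ge> nn - real_of_int D" unfolding cZ Om_props(4) using D by linarith
    have "real (card ?Z) / nn \<ge> (1 - r)\<^sup>2 - sqrt (2 * real m / real p)"
    proof (rule support_density[OF _ _ r])
      show "?Z \<subseteq> carrier A" by auto
      show "?Z \<noteq> {}" using f(2) unfolding Om_eq by auto
      show "(1 - r) * real (card C) \<le> real (card (?Z \<inter> C))" if C: "C \<in> rcosets\<^bsub>A\<^esub> TT" "C \<inter> ?Z \<noteq> {}" for C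
      proof -
        have "card TT > 0" unfolding card_translation_maps using q_ge_4 by linarith
        then show ?thesis using local_poly_left[OF f(1) C(1)] coset_density[OF subgroup_translation C(1)] C(2) by blast
      qed
      show "(1 - r) * real (card C) \<le> real (card (?Z \<inter> C))" if C: "C \<in> rcosets\<^bsub>A\<^esub> SS" "C \<inter> ?Z \<noteq> {}" for C
      proof -
        have "card SS > 0" unfolding card_scaling_maps using q_ge_4 by linarith
        then show ?thesis using local_poly_right[OF f(1) C(1)] coset_density[OF subgroup_scaling C(1)] C(2) by blast
      qed
    qed
    moreover have "real (card ?Z) / nn \<ge> 1 - real_of_int D / nn"
      using divide_right_mono[OF 1, of nn] nn(2) by (simp add: diff_divide_distrib)
    ultimately have "?b \<le> real (card ?Z) / nn" by (rule max.boundedI[rotated])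
    then show "nn * ?b \<le> real (card {s \<in> Om. eval f s \<noteq> \<zero>})"
      unfolding cZ using nn(2) by (simp only: pos_le_divide_eq mult.commute)
  qed
  then show ?thesis
    unfolding rel_min_dist_def eval_code_def Om_props(4) using nn(2) by (simp only: pos_le_divide_eq mult.commute)
qed

text \<open>Two counts of \<open>WW D\<close> are compared. The family of distinct degrees bounds
  its size from below, and evaluation is injective because degrees stay below D \<le> n, so the code
  has the same size. The weight bound r (q - 1) is the stricter of the two and serves for both
  filtrations.\<close>

lemma code_dim_ge:
  assumes D: "D \<le> int ((q - 1) * q ^ m)" and T: "T \<le> p" "q ^ m * p ^ (m - 1) * T \<le> nat D"
  shows "real (code_dim F Om (eval_code F m p K \<alpha> r D)) \<ge>
    (pos_pow (2 * m + 1) (r * real (q - 1)) - pos_pow (2 * m + 1) (r * real (q - 1) - real (p ^ (m - 1)) * real T))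
      / (fact (2 * m + 1) * real q ^ m)"
proof -
  let ?Q = "card (carrier F)"
  have "r * real (q - 1) \<le> 1 * real (q - 1)" using r by (intro mult_right_mono) auto
  then have x: "r * real (q - 1) \<le> real q" "r * real (q - 1) \<le> r * real q"
    unfolding q_real(2) using mult_left_mono[of "real q - 1" "real q" r] r by auto
  obtain U where U: "finite U" "U \<subseteq> carrier (poly_ring F)" "inj_on length U" "[] \<notin> U"
    "\<forall>u\<in>U. \<exists>e. real e < r * real (q - 1) \<and> u \<in> base_filtration g (Suc e) \<and> u \<in> base_filtration hp (Suc e)"
    "\<forall>u\<in>U. length u \<le> q ^ m * p ^ (m - 1) * T"
    "real (card U) \<ge> (pos_pow (2 * m + 1) (r * real (q - 1)) - pos_pow (2 * m + 1) (r * real (q - 1) - real (p ^ (m - 1)) * real T))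
      / (fact (2 * m + 1) * real q ^ m)"
    using exists_independent_family[OF T(1) x(1)] by (elim exE conjE)
  have UW: "U \<subseteq> WW D"
  proof
    fix u assume u: "u \<in> U"
    obtain e where e: "real e < r * real (q - 1)" "u \<in> base_filtration g (Suc e)" "u \<in> base_filtration hp (Suc e)"
      using U(5) u by blast
    have "Suc e \<le> nat \<lceil>r * real (q - 1)\<rceil>" "Suc e \<le> nat \<lceil>r * real q\<rceil>" using e(1) x(2) by linarith+
    then have "u \<in> base_filtration g (nat \<lceil>r * real q\<rceil>)" "u \<in> base_filtration hp (nat \<lceil>r * real (q - 1)\<rceil>)"
      using base_filtration_mono[OF e(2)] base_filtration_mono[OF e(3)] by blast+
    moreover have "length u \<le> nat D" using U(6) u T(2) le_trans by blast
    ultimately show "u \<in> WW D" unfolding W_eq using U(2) u by blast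
  qed
  have "WW D \<subseteq> {f \<in> carrier (poly_ring F). length f \<le> nat D}" unfolding W_eq by blast
  then have finW: "finite (WW D)" using card_polys_le(1)[OF finite_carrier] finite_subset by blast
  have "?Q ^ card U \<le> card (WW D)"
    by (rule card_poly_subspace_ge[OF W_subspace finite_carrier finW UW U(1,3,4)])
  also have "\<dots> = card (codeword F Om ` WW D)"
  proof (rule card_image[symmetric], rule codeword_inj_on[OF W_subspace Om_props(1,2)])
    show "length f \<le> card Om" if "f \<in> WW D" for f
      using W_mem(2)[OF that] D unfolding Om_props(3) by linarith
  qed
  also have "\<dots> = ?Q ^ code_dim F Om (codeword F Om ` WW D)"
    by (rule card_code[OF W_subspace Om_props(1) finite_carrier])
  finally have "card U \<le> code_dim F Om (codeword F Om ` WW D)"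
    using card_carrier_ge_2[OF finite_carrier] by (simp add: power_le_imp_le_exp)
  then show ?thesis using U(7) unfolding eval_code_def by linarith
qed

text \<open>Scaling the simplex down by q turns \<open>code_dim_ge\<close> into powers of numbers
  close to r and r - T / p, where T / p is at least D / n up to errors of order 1 / p and 1 / q. The
  remaining factor q^(2m+1) / (q^m n) equals q / (q - 1), which is at least 1 and is
  dropped.\<close>

theorem code_rate_ge:
  assumes D: "0 \<le> D" "D \<le> int (code_length F m p K)"
  shows "real (code_dim F Om (eval_code F m p K \<alpha> r D)) / nn \<ge>
    1 / fact (2 * m + 1) * ((r - r * (1 / real q)) ^ (2 * m + 1) -
      max 0 (r - r * (1 / real q) - (real_of_int D / nn * (1 - 1 / real q) - 1 / real p)) ^ (2 * m + 1))"
proof -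
  define k where "k = 2 * m + 1"
  define Q where "Q = real q"
  define B where "B = p ^ (m - 1)"
  \<comment> \<open>The number of values of the top digit whose whole block of degrees fits below
    \<open>D\<close>.\<close>
  define T where "T = nat D div (q ^ m * B)"
  define x where "x = r * (Q - 1)"
  have Q: "Q > 1" "Q > 0" "Q - 1 > 0" using q_real by (simp_all only: Q_def)
  have nnQ: "nn = (Q - 1) * Q ^ m" unfolding nn(1) Q_def ..
  have B0: "B > 0" using p_ge_2 by (simp add: B_def)
  have qB: "q = p * B" unfolding B_def by (rule q_eq)
  then have QB: "Q = real p * real B" unfolding Q_def by (metis of_nat_mult)
  have qm0: "q ^ m > 0" using p_ge_2 by simp
  have D': "D \<le> int ((q - 1) * q ^ m)" using D(2) unfolding code_length_eq .
  have Tle: "q ^ m * B * T \<le> nat D" unfolding T_def by (rule times_div_less_eq_dividend)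
  have "T \<le> p"
  proof -
    have "q ^ m * B * T \<le> (q - 1) * q ^ m" using Tle D' by linarith
    also have "\<dots> \<le> (p * B) * q ^ m" using qB by (intro mult_right_mono) auto
    finally have "(q ^ m * B) * T \<le> (q ^ m * B) * p" by (simp only: mult_ac)
    then show ?thesis using qm0 B0 by (simp only: mult_le_cancel1) simp
  qed
  note dim = code_dim_ge[OF D' this Tle[unfolded B_def], folded B_def k_def, unfolded q_real(2), folded Q_def x_def]
  have Tge: "real T / real p \<ge> real_of_int D / nn * (1 - 1 / Q) - 1 / real p"
  proof -
    have "nat D < q ^ m * B * Suc T" using dividend_less_times_div[of "q ^ m * B" "nat D"] qm0 B0 unfolding T_def mult_Suc_right by (simp add: add.commute)
    then have "real (nat D) < real (q ^ m * B * Suc T)" by (simp only: of_nat_less_iff)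
    then have "real_of_int D < Q ^ m * real B * (real T + 1)"
      using D(1) by (simp only: Q_def of_nat_mult of_nat_power of_nat_Suc of_nat_nat add.commute)
    then have "real_of_int D / (Q ^ m * Q) \<le> Q ^ m * real B * (real T + 1) / (Q ^ m * Q)"
      using Q by (intro divide_right_mono) auto
    also have "\<dots> = (real T + 1) / real p" unfolding QB using B0 p_ge_2 by (simp add: field_simps)
    also have "real_of_int D / (Q ^ m * Q) = real_of_int D / nn * (1 - 1 / Q)"
      unfolding nnQ using Q by (simp add: field_simps)
    finally show ?thesis by (simp add: add_divide_distrib)
  qed
  define y where "y = x / Q"
  have y: "y = r - r * (1 / Q)" unfolding y_def x_def using Q by (simp add: field_simps)
  have y0: "y > 0" unfolding y_def x_def using Q r by simp
  have k0: "k > 0" by (simp add: k_def)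
  have pp: "pos_pow k z = max 0 z ^ k" for z using k0 by (simp add: pos_pow_def max_def)
  have scale: "max 0 (Q * z) = Q * max 0 z" for z using Q by (simp add: max_def mult_le_0_iff zero_le_mult_iff)
  have "x = Q * y" unfolding y_def using Q by simp
  have "x - real B * real T = Q * (y - real T / real p)"
    unfolding \<open>x = Q * y\<close> QB using p_ge_2 by (simp add: algebra_simps)
  then have num: "pos_pow k x - pos_pow k (x - real B * real T) = Q ^ k * (y ^ k - max 0 (y - real T / real p) ^ k)"
  proof -
    have my: "max 0 y = y" using y0 by simp
    show ?thesis
      unfolding pp \<open>x - real B * real T = Q * (y - real T / real p)\<close>
      unfolding \<open>x = Q * y\<close> scale my by (simp only: power_mult_distrib right_diff_distrib)
  qed
  define E where "E = y ^ k - max 0 (y - real T / real p) ^ k"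
  have E0: "E \<ge> 0" unfolding E_def using y0 by (simp add: power_mono)
  have "E \<ge> y ^ k - max 0 (y - (real_of_int D / nn * (1 - 1 / Q) - 1 / real p)) ^ k" (is "_ \<ge> ?R")
    unfolding E_def using Tge by (intro diff_left_mono power_mono max.mono) auto
  then have "1 / fact k * ?R \<le> 1 / fact k * E" by (intro mult_left_mono) auto
  also have "\<dots> \<le> 1 / fact k * E * (Q / (Q - 1))"
    using E0 Q by (intro mult_le_cancel_left1[THEN iffD2]) (auto simp: field_simps)
  also have "\<dots> = Q ^ k * E / (fact k * Q ^ m) / nn"
  proof -
    have "Q ^ k = Q * Q ^ m * Q ^ m" by (simp add: k_def power_add mult_2)
    then show ?thesis unfolding nnQ using Q by (simp add: field_simps)
  qed
  also have "\<dots> \<le> real (code_dim F Om (eval_code F m p K \<alpha> r D)) / nn"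
    using dim nn(2) unfolding num E_def by (intro divide_right_mono) auto
  finally show ?thesis unfolding y k_def Q_def .
qed

text \<open>n lies between (q / 2)^(m+1) and q^(m+1); the factor 1 / 2 also accounts for q - 1 in
  place of q.\<close>

theorem local_lengths_bounds:
  "1 / 2 * nn powr (1 / real (m + 1)) \<le> real q - 1" "real q \<le> 2 * nn powr (1 / real (m + 1))"
proof -
  define Q where "Q = real q"
  have Q: "Q > 1" "Q > 0" "Q - 1 > 0" "Q \<le> 2 * (Q - 1)" using q_real by (simp_all only: Q_def)
  have nnQ: "nn = (Q - 1) * Q ^ m" unfolding nn(1) Q_def ..
  have root: "(z ^ (m + 1)) powr (1 / real (m + 1)) = z" if "z > 0" for z :: real
    using that by (simp add: powr_realpow[symmetric] powr_powr del: of_nat_Suc power_Suc)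
  have half: "1 / 2 * a \<le> b - 1" if "a \<le> b" "b \<le> 2 * (b - 1)" for a b :: real using that by simp
  have "nn powr (1 / real (m + 1)) \<le> (Q ^ (m + 1)) powr (1 / real (m + 1))"
    unfolding nnQ using Q by (intro powr_mono2) (auto intro!: mult_right_mono)
  then have "nn powr (1 / real (m + 1)) \<le> Q" using root[OF Q(2)] by simp
  then show "1 / 2 * nn powr (1 / real (m + 1)) \<le> real q - 1" using half Q(4) unfolding Q_def by blast
  have "(Q / 2) ^ (m + 1) = (Q / 2) * (Q / 2) ^ m" by simp
  also have "\<dots> \<le> (Q - 1) * Q ^ m" using Q by (intro mult_mono power_mono) auto
  finally have "((Q / 2) ^ (m + 1)) powr (1 / real (m + 1)) \<le> nn powr (1 / real (m + 1))"
    unfolding nnQ using Q by (intro powr_mono2) auto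
  then have "Q / 2 \<le> nn powr (1 / real (m + 1))" using root[of "Q / 2"] Q by simp
  then have "Q \<le> 2 * nn powr (1 / real (m + 1))" by simp
  then show "real q \<le> 2 * nn powr (1 / real (m + 1))" unfolding Q_def .
qed

end

section \<open>Asymptotics\<close>

lemma eventually_primes_at_top:
  "eventually P primes_at_top \<longleftrightarrow> eventually (\<lambda>p. prime p \<longrightarrow> P p) at_top"
  by (simp add: primes_at_top_def eventually_inf_principal)

lemma eventually_primesI: "(\<And>p. prime p \<Longrightarrow> P p) \<Longrightarrow> eventually P primes_at_top"
  by (simp add: eventually_primes_at_top)

text \<open>By the infinitude of primes the filter is proper, so that a limit along it determines
  the \<open>Liminf\<close>.\<close>

lemma primes_at_top_neq_bot: "primes_at_top \<noteq> bot"
proof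
  assume "primes_at_top = bot"
  then have "eventually (\<lambda>p::nat. \<not> prime p) at_top"
    using eventually_primes_at_top[of "\<lambda>_. False"] by simp
  then obtain N where "\<And>p::nat. p \<ge> N \<Longrightarrow> \<not> prime p" by (auto simp: eventually_at_top_linorder)
  then show False using bigger_prime[of N] by force
qed

lemma tendsto_primes: "(f \<longlongrightarrow> l) at_top \<Longrightarrow> (f \<longlongrightarrow> l) primes_at_top"
  unfolding primes_at_top_def by (rule tendsto_mono[OF inf_le1])

lemma inverse_prime_tendsto: "((\<lambda>p. 1 / real p) \<longlongrightarrow> 0) primes_at_top"
  using lim_1_over_n by (rule tendsto_primes)

lemma inverse_prime_power_tendsto:
  assumes "m > 0"
  shows "((\<lambda>p. 1 / real (p ^ m)) \<longlongrightarrow> 0) primes_at_top"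
proof -
  have "((\<lambda>p. (1 / real p) ^ m) \<longlongrightarrow> 0 ^ m) primes_at_top"
    by (intro tendsto_power inverse_prime_tendsto)
  then show ?thesis using assms by (simp add: power_one_over zero_power)
qed

lemma Liminf_primes_ge:
  fixes f g :: "nat \<Rightarrow> real"
  assumes "(f \<longlongrightarrow> l) primes_at_top" "eventually (\<lambda>p. f p \<le> g p) primes_at_top"
  shows "ereal l \<le> Liminf primes_at_top (\<lambda>p. ereal (g p))"
proof -
  have "((\<lambda>p. ereal (f p)) \<longlongrightarrow> ereal l) primes_at_top" using assms(1) by simp
  then have "ereal l = Liminf primes_at_top (\<lambda>p. ereal (f p))"
    using lim_imp_Liminf[OF primes_at_top_neq_bot] by metis
  also have "\<dots> \<le> Liminf primes_at_top (\<lambda>p. ereal (g p))"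
    using assms(2) by (intro Liminf_mono) (simp add: eventually_mono)
  finally show ?thesis .
qed

theorem theorem4p3:
  fixes m :: nat and r \<rho> :: real
    and F :: "nat \<Rightarrow> ('a, 'b) ring_scheme"
    and K :: "nat \<Rightarrow> 'a set"
    and \<alpha> :: "nat \<Rightarrow> 'a"
    and D :: "nat \<Rightarrow> int"
  assumes m: "m \<ge> 2"
    and r: "0 < r" "r < 1"
    and \<rho>: "0 < \<rho>" "\<rho> \<le> 1"
    and F: "\<And>p. prime p \<Longrightarrow> field (F p)"
      "\<And>p. prime p \<Longrightarrow> finite (carrier (F p))"
      "\<And>p. prime p \<Longrightarrow> [p] \<cdot>\<^bsub>F p\<^esub> \<one>\<^bsub>F p\<^esub> = \<zero>\<^bsub>F p\<^esub>"
    and G_in_F: "\<And>p. prime p \<Longrightarrow> ring.splitted (F p) (g_poly (F p) m p)"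
    and K: "\<And>p. prime p \<Longrightarrow> subfield (K p) (F p)"
      "\<And>p. prime p \<Longrightarrow> card (K p) = p ^ m"
    and F_large: "\<And>p. prime p \<Longrightarrow> card (carrier (F p)) \<ge> card (carrier (A_group (F p) m p (K p)))"
    and \<alpha>: "\<And>p. prime p \<Longrightarrow> \<alpha> p \<in> carrier (F p)"
      "\<And>p. prime p \<Longrightarrow>
         stabilizer (A_group (F p) m p (K p)) (\<lambda>\<phi>. \<phi>) (\<alpha> p) = {\<one>\<^bsub>A_group (F p) m p (K p)\<^esub>}"
    and D_le: "\<And>p. prime p \<Longrightarrow> D p \<le> int (code_length (F p) m p (K p))"
    and D_lim: "((\<lambda>p. real_of_int (D p) / real (code_length (F p) m p (K p))) \<longlongrightarrow> \<rho>) primes_at_top"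
  shows
    "expander_family m r F K \<alpha> (\<lambda>p. eval_code (F p) m p (K p) (\<alpha> p) r (D p))
     \<and>
     ((\<forall>p. prime p \<longrightarrow>
         card (G_set (F p) m p) = p ^ m \<and> card (H_set (F p) (K p)) = p ^ m - 1 \<and>
         (\<forall>S \<in> left_orbits (F p) m p (K p) (\<alpha> p). card S = card (G_set (F p) m p)) \<and>
         (\<forall>S \<in> right_orbits (F p) m p (K p) (\<alpha> p). card S = card (H_set (F p) (K p)))) \<and>
      (\<lambda>p. real (card (G_set (F p) m p)))
        \<in> \<Theta>[primes_at_top](\<lambda>p. real (code_length (F p) m p (K p)) powr (1 / real (m + 1))) \<and>
      (\<lambda>p. real (card (H_set (F p) (K p))))
        \<in> \<Theta>[primes_at_top](\<lambda>p. real (code_length (F p) m p (K p)) powr (1 / real (m + 1))) \<and>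
      (\<exists>\<epsilon> :: nat \<Rightarrow> real. (\<epsilon> \<longlongrightarrow> 0) primes_at_top \<and>
         (\<forall>p. prime p \<longrightarrow>
            (\<forall>S \<in> left_orbits (F p) m p (K p) (\<alpha> p).
               code_rate (F p) S (left_code (F p) m p r S) \<le> r + \<epsilon> p \<and>
               rel_min_dist S (left_code (F p) m p r S) \<ge> 1 - r - \<epsilon> p) \<and>
            (\<forall>S \<in> right_orbits (F p) m p (K p) (\<alpha> p).
               code_rate (F p) S (right_code (F p) (K p) r S) \<le> r + \<epsilon> p \<and>
               rel_min_dist S (right_code (F p) (K p) r S) \<ge> 1 - r - \<epsilon> p))))
     \<and>
     Liminf primes_at_top
       (\<lambda>p. ereal (rel_min_dist (Omega (F p) m p (K p) (\<alpha> p))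
                     (eval_code (F p) m p (K p) (\<alpha> p) r (D p))))
       \<ge> ereal (max (1 - \<rho>) ((1 - r)\<^sup>2))
     \<and>
     Liminf primes_at_top
       (\<lambda>p. ereal (real (code_dim (F p) (Omega (F p) m p (K p) (\<alpha> p))
                            (eval_code (F p) m p (K p) (\<alpha> p) r (D p)))
                   / real (code_length (F p) m p (K p))))
       \<ge> ereal (1 / fact (2 * m + 1) * (r ^ (2 * m + 1) - max 0 (r - \<rho>) ^ (2 * m + 1)))"
proof -
  let ?n = "\<lambda>p. real (code_length (F p) m p (K p))"
  have cs: "code_setup (F p) m p (K p) (\<alpha> p) r" if "prime p" for p
    by (intro code_setup.intro expander_setup.intro expander_setup_axioms.intro code_setup_axioms.intro
        m r that F(1)[OF that] F(2)[OF that] F(3)[OF that] G_in_F[OF that] K(1)[OF that] K(2)[OF that]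
        \<alpha>(1)[OF that] \<alpha>(2)[OF that])
  note es = code_setup.axioms(1)[OF cs]
  have card_G: "card (G_set (F p) m p) = p ^ m" if "prime p" for p
    using expander_setup.card_G[OF es[OF that]] .
  have card_H: "card (H_set (F p) (K p)) = p ^ m - 1" if "prime p" for p
    using expander_setup.H_props(5)[OF es[OF that]] .
  have nn: "expander_setup.nn m p = ?n p" if "prime p" for p
    using code_setup.Om_props(5)[OF cs[OF that]] by simp
  have npos: "?n p > 0" if "prime p" for p
    using expander_setup.nn(2)[OF es[OF that]] nn[OF that] by simp
  have qpos: "real (p ^ m) \<ge> 4" if "prime p" for p using expander_setup.q_real(1)[OF es[OF that]] .
  \<comment> \<open>A positive limit of D / n forces D \<ge> 1 eventually. For D \<le> 0 the code
    contains only the zero word, and its minimum distance is 0 by convention.\<close>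
  have Dpos: "eventually (\<lambda>p. prime p \<and> D p \<ge> 1) primes_at_top"
  proof -
    have "eventually (\<lambda>p. real_of_int (D p) / ?n p > 0) primes_at_top"
      by (rule order_tendstoD(1)[OF D_lim \<rho>(1)])
    moreover have "eventually prime primes_at_top" by (rule eventually_primesI)
    ultimately show ?thesis
    proof eventually_elim
      case (elim p)
      then show ?case using npos[of p] by (auto simp: zero_less_divide_iff)
    qed
  qed
  have s0: "((\<lambda>p. sqrt (2 * real m / real p)) \<longlongrightarrow> 0) primes_at_top"
  proof -
    have "((\<lambda>p. sqrt (2 * real m * (1 / real p))) \<longlongrightarrow> sqrt (2 * real m * 0)) primes_at_top"
      by (intro tendsto_intros inverse_prime_tendsto)
    then show ?thesis by simp
  qed
  have m0: "m > 0" using m by simp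
  note q0 = inverse_prime_power_tendsto[OF m0]

  have expander: "expander_family m r F K \<alpha> (\<lambda>p. eval_code (F p) m p (K p) (\<alpha> p) r (D p))"
    unfolding expander_family_def
  proof (intro conjI allI impI)
    show "eval_code (F p) m p (K p) (\<alpha> p) r (D p) \<subseteq> tanner_code (F p) m p (K p) (\<alpha> p) r"
      if "prime p" for p by (rule code_setup.code_subset_tanner[OF cs[OF that]])
    show "((\<lambda>p. second_singular_value
             (norm_biadj (A_group (F p) m p (K p)) (translation_maps (F p) m p) (scaling_maps (F p) (K p))))
        \<longlongrightarrow> 0) primes_at_top"
      using expander_setup.coset_graph_expansion[OF es]
      by (intro tendsto_sandwich[OF _ _ tendsto_const s0] eventually_primesI) auto
  qed

  have lengths: "(\<lambda>p. real (card (G_set (F p) m p))) \<in> \<Theta>[primes_at_top](\<lambda>p. ?n p powr (1 / real (m + 1)))"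
    "(\<lambda>p. real (card (H_set (F p) (K p)))) \<in> \<Theta>[primes_at_top](\<lambda>p. ?n p powr (1 / real (m + 1)))"
  proof -
    have b: "1 / 2 * ?n p powr (1 / real (m + 1)) \<le> real (p ^ m) - 1" "real (p ^ m) \<le> 2 * ?n p powr (1 / real (m + 1))"
      if "prime p" for p
      using code_setup.local_lengths_bounds[OF cs[OF that]] unfolding nn[OF that] by auto
    have H: "real (card (H_set (F p) (K p))) = real (p ^ m) - 1" if "prime p" for p
      using card_H[OF that] expander_setup.q_real(2)[OF es[OF that]] by metis
    show "(\<lambda>p. real (card (G_set (F p) m p))) \<in> \<Theta>[primes_at_top](\<lambda>p. ?n p powr (1 / real (m + 1)))"
    proof (rule bigthetaI'[of "1 / 2" 2])
      show "eventually (\<lambda>p. 1 / 2 * norm (?n p powr (1 / real (m + 1))) \<le> norm (real (card (G_set (F p) m p))) \<and>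
          norm (real (card (G_set (F p) m p))) \<le> 2 * norm (?n p powr (1 / real (m + 1)))) primes_at_top"
      proof (rule eventually_primesI)
        fix p :: nat assume p: "prime p"
        show "1 / 2 * norm (?n p powr (1 / real (m + 1))) \<le> norm (real (card (G_set (F p) m p))) \<and>
          norm (real (card (G_set (F p) m p))) \<le> 2 * norm (?n p powr (1 / real (m + 1)))"
          using b[OF p] unfolding card_G[OF p] real_norm_def by (simp del: of_nat_power)
      qed
    qed auto
    show "(\<lambda>p. real (card (H_set (F p) (K p)))) \<in> \<Theta>[primes_at_top](\<lambda>p. ?n p powr (1 / real (m + 1)))"
    proof (rule bigthetaI'[of "1 / 2" 2])
      show "eventually (\<lambda>p. 1 / 2 * norm (?n p powr (1 / real (m + 1))) \<le> norm (real (card (H_set (F p) (K p)))) \<and>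
          norm (real (card (H_set (F p) (K p)))) \<le> 2 * norm (?n p powr (1 / real (m + 1)))) primes_at_top"
      proof (rule eventually_primesI)
        fix p :: nat assume p: "prime p"
        show "1 / 2 * norm (?n p powr (1 / real (m + 1))) \<le> norm (real (card (H_set (F p) (K p)))) \<and>
          norm (real (card (H_set (F p) (K p)))) \<le> 2 * norm (?n p powr (1 / real (m + 1)))"
          using b[OF p] qpos[OF p] unfolding H[OF p] real_norm_def by (simp del: of_nat_power)
      qed
    qed auto
  qed

  have local: "\<exists>\<epsilon> :: nat \<Rightarrow> real. (\<epsilon> \<longlongrightarrow> 0) primes_at_top \<and>
         (\<forall>p. prime p \<longrightarrow>
            (\<forall>S \<in> left_orbits (F p) m p (K p) (\<alpha> p).
               code_rate (F p) S (left_code (F p) m p r S) \<le> r + \<epsilon> p \<and>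
               rel_min_dist S (left_code (F p) m p r S) \<ge> 1 - r - \<epsilon> p) \<and>
            (\<forall>S \<in> right_orbits (F p) m p (K p) (\<alpha> p).
               code_rate (F p) S (right_code (F p) (K p) r S) \<le> r + \<epsilon> p \<and>
               rel_min_dist S (right_code (F p) (K p) r S) \<ge> 1 - r - \<epsilon> p))"
  \<comment> \<open>The error is the rate loss 1 / (q - 1) of the shorter local code; it is at most
    2 / q, which gives the sandwich.\<close>
  proof (intro exI[of _ "\<lambda>p. 1 / (real (p ^ m) - 1)"] conjI allI impI ballI)
    have "((\<lambda>p. 2 * (1 / real (p ^ m))) \<longlongrightarrow> 2 * 0) primes_at_top" by (intro tendsto_intros q0)
    then have lim: "((\<lambda>p. 2 * (1 / real (p ^ m))) \<longlongrightarrow> 0) primes_at_top" by simp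
    show "((\<lambda>p. 1 / (real (p ^ m) - 1)) \<longlongrightarrow> 0) primes_at_top"
    proof (rule tendsto_sandwich[OF _ _ tendsto_const lim])
      have *: "0 \<le> 1 / (x - 1) \<and> 1 / (x - 1) \<le> 2 * (1 / x)" if "x \<ge> 4" for x :: real
        using that by (simp add: field_simps)
      show "\<forall>\<^sub>F p in primes_at_top. 0 \<le> 1 / (real (p ^ m) - 1)"
        "\<forall>\<^sub>F p in primes_at_top. 1 / (real (p ^ m) - 1) \<le> 2 * (1 / real (p ^ m))"
        using *[OF qpos] by (auto intro!: eventually_primesI simp del: of_nat_power)
    qed
    fix p :: nat assume p: "prime p"
    have e: "1 / (real (p ^ m) - 1) \<ge> 0" using qpos[OF p] by (simp del: of_nat_power)
    fix S assume S: "S \<in> left_orbits (F p) m p (K p) (\<alpha> p)"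
    note l = code_setup.left_local_codes[OF cs[OF p] S]
    show "code_rate (F p) S (left_code (F p) m p r S) \<le> r + 1 / (real (p ^ m) - 1)" by (rule l(2))
    show "rel_min_dist S (left_code (F p) m p r S) \<ge> 1 - r - 1 / (real (p ^ m) - 1)" using l(3) e by linarith
  next
    fix p :: nat assume p: "prime p"
    have e: "1 / (real (p ^ m) - 1) \<ge> 0" using qpos[OF p] by (simp del: of_nat_power)
    fix S assume S: "S \<in> right_orbits (F p) m p (K p) (\<alpha> p)"
    note l = code_setup.right_local_codes[OF cs[OF p] S]
    show "code_rate (F p) S (right_code (F p) (K p) r S) \<le> r + 1 / (real (p ^ m) - 1)" by (rule l(2))
    show "rel_min_dist S (right_code (F p) (K p) r S) \<ge> 1 - r - 1 / (real (p ^ m) - 1)" using l(3) e by linarith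
  qed

  have dist: "ereal (max (1 - \<rho>) ((1 - r)\<^sup>2)) \<le> Liminf primes_at_top
       (\<lambda>p. ereal (rel_min_dist (Omega (F p) m p (K p) (\<alpha> p)) (eval_code (F p) m p (K p) (\<alpha> p) r (D p))))"
  proof (rule Liminf_primes_ge)
    have "((\<lambda>p. max (1 - real_of_int (D p) / ?n p) ((1 - r)\<^sup>2 - sqrt (2 * real m / real p)))
        \<longlongrightarrow> max (1 - \<rho>) ((1 - r)\<^sup>2 - 0)) primes_at_top"
      by (intro tendsto_intros D_lim s0)
    then show "((\<lambda>p. max (1 - real_of_int (D p) / ?n p) ((1 - r)\<^sup>2 - sqrt (2 * real m / real p)))
        \<longlongrightarrow> max (1 - \<rho>) ((1 - r)\<^sup>2)) primes_at_top" by simp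
    show "eventually (\<lambda>p. max (1 - real_of_int (D p) / ?n p) ((1 - r)\<^sup>2 - sqrt (2 * real m / real p)) \<le>
        rel_min_dist (Omega (F p) m p (K p) (\<alpha> p)) (eval_code (F p) m p (K p) (\<alpha> p) r (D p))) primes_at_top"
      using Dpos
    proof eventually_elim
      case (elim p)
      then show ?case using code_setup.code_rel_min_dist[OF cs, of p "D p"] nn[of p] by simp
    qed
  qed

  have rate: "ereal (1 / fact (2 * m + 1) * (r ^ (2 * m + 1) - max 0 (r - \<rho>) ^ (2 * m + 1))) \<le>
     Liminf primes_at_top (\<lambda>p. ereal (real (code_dim (F p) (Omega (F p) m p (K p) (\<alpha> p))
                            (eval_code (F p) m p (K p) (\<alpha> p) r (D p))) / ?n p))"
  proof (rule Liminf_primes_ge)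
    let ?lb = "\<lambda>p. 1 / fact (2 * m + 1) * ((r - r * (1 / real (p ^ m))) ^ (2 * m + 1) -
      max 0 (r - r * (1 / real (p ^ m)) - (real_of_int (D p) / ?n p * (1 - 1 / real (p ^ m)) - 1 / real p)) ^ (2 * m + 1))"
    have "(?lb \<longlongrightarrow> 1 / fact (2 * m + 1) * ((r - r * 0) ^ (2 * m + 1) -
      max 0 (r - r * 0 - (\<rho> * (1 - 0) - 0)) ^ (2 * m + 1))) primes_at_top"
      by (intro tendsto_mult tendsto_diff tendsto_power tendsto_max tendsto_const D_lim q0 inverse_prime_tendsto)
    then show "(?lb \<longlongrightarrow> 1 / fact (2 * m + 1) * (r ^ (2 * m + 1) - max 0 (r - \<rho>) ^ (2 * m + 1))) primes_at_top"
      by (simp only: mult_zero_right diff_zero mult_1_right)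
    show "eventually (\<lambda>p. ?lb p \<le> real (code_dim (F p) (Omega (F p) m p (K p) (\<alpha> p))
                            (eval_code (F p) m p (K p) (\<alpha> p) r (D p))) / ?n p) primes_at_top"
      using Dpos
    proof eventually_elim
      case (elim p)
      then have p: "prime p" "0 \<le> D p" by auto
      show ?case using code_setup.code_rate_ge[OF cs[OF p(1)] p(2) D_le[OF p(1)]] unfolding nn[OF p(1)] .
    qed
  qed

  show ?thesis
    by (intro conjI allI impI ballI expander lengths local dist rate card_G card_H
        code_setup.left_local_codes(1)[OF cs] code_setup.right_local_codes(1)[OF cs])
qed

end
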